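(* Fix any positive integers $r,s$. Then there is a polynomial time algorithm that, given a positive integer $l$, an integer objective vector $c\in\mathbb{Z}^{r\times s\times l}$, and integer line-sums $(u_{i,j})$, $(v_{i,k})$ and $(w_{j,k})$ (indexed by $1\le i\le r$, $1\le j\le s$, $1\le k\le l$), solves the integer transportation problem $$\min\Big\{\,cx\ :\ x\in\mathbb{N}^{r\times s\times l}\,,\ \sum_i x_{i,j,k}=w_{j,k}\,,\ \sum_j x_{i,j,k}=v_{i,k}\,,\ \sum_k x_{i,j,k}=u_{i,j}\,\Big\},$$ where the equations are imposed for all $j,k$, all $i,k$, and all $i,j$, respectively.
   Context: $\mathbb{N}$ denotes the set of nonnegative integers, and $cx=\sum_{i,j,k}c_{i,j,k}x_{i,j,k}$. Solving an integer program means that the algorithm concludes with precisely one of the following correct outputs: it asserts that there is no feasible solution, or it asserts that the objective function is unbounded on the feasible set, or it returns an optimal solution. The numbers $r,s$ are fixed and not part of the input. The input size is $l$ (its value) plus the bit size of the integers in $c$, $(u_{i,j})$, $(v_{i,k})$, $(w_{j,k})$ (binary encoding); polynomial time means polynomial in this input size. *)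

theory Defs
  imports Main "HOL-Library.Log_Nat" "HOL-Computational_Algebra.Polynomial"
begin

section \<open>A deterministic logarithmic-cost random access machine\<close>

text \<open>
  Polynomial time is measured on a random access machine with logarithmic cost, presented as a
  structured while language.  The memory consists of named arrays of integers; a program mentions
  only finitely many of them, and a scalar is an array that is used at index 0 only.
  Every operation is charged the binary lengths of all integers it handles, addresses
  included.  Hence the bit length of every integer produced is bounded by the running time plus
  the size of the input, and the running time is polynomially related to the running time of a
  Turing machine.
\<close>

definition bit_size :: "int \<Rightarrow> nat" where
  "bit_size z = 1 + floorlog 2 (nat \<bar>z\<bar>)"  \<comment> \<open>one bit for the sign\<close>

type_synonym vname = string
type_synonym state = "vname \<Rightarrow> int \<Rightarrow> int"

datatype aexp =
    N int
  | Get vname aexp  \<comment> \<open>indirect addressing\<close>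
  | Plus aexp aexp
  | Minus aexp aexp
  | Times aexp aexp
  | Div aexp aexp

datatype bexp = Less aexp aexp | BNot bexp | BAnd bexp bexp

datatype com =
    Skip
  | Assign vname aexp aexp  \<comment> \<open>\<open>Assign a e f\<close> is \<open>a[e] := f\<close>\<close>
  | Seq com com
  | Cond bexp com com
  | While bexp com

fun aval :: "aexp \<Rightarrow> state \<Rightarrow> int" where
  "aval (N n) \<sigma> = n"
| "aval (Get a e) \<sigma> = \<sigma> a (aval e \<sigma>)"
| "aval (Plus e f) \<sigma> = aval e \<sigma> + aval f \<sigma>"
| "aval (Minus e f) \<sigma> = aval e \<sigma> - aval f \<sigma>"
| "aval (Times e f) \<sigma> = aval e \<sigma> * aval f \<sigma>"
| "aval (Div e f) \<sigma> = aval e \<sigma> div aval f \<sigma>"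

fun acost :: "aexp \<Rightarrow> state \<Rightarrow> nat" where
  "acost (N n) \<sigma> = bit_size n"
| "acost (Get a e) \<sigma> = acost e \<sigma> + bit_size (aval e \<sigma>) + bit_size (\<sigma> a (aval e \<sigma>))"
| "acost (Plus e f) \<sigma> = acost e \<sigma> + acost f \<sigma> + bit_size (aval e \<sigma>) + bit_size (aval f \<sigma>)"
| "acost (Minus e f) \<sigma> = acost e \<sigma> + acost f \<sigma> + bit_size (aval e \<sigma>) + bit_size (aval f \<sigma>)"
| "acost (Times e f) \<sigma> = acost e \<sigma> + acost f \<sigma> + bit_size (aval e \<sigma>) + bit_size (aval f \<sigma>)"
| "acost (Div e f) \<sigma> = acost e \<sigma> + acost f \<sigma> + bit_size (aval e \<sigma>) + bit_size (aval f \<sigma>)"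

fun bval :: "bexp \<Rightarrow> state \<Rightarrow> bool" where
  "bval (Less e f) \<sigma> \<longleftrightarrow> aval e \<sigma> < aval f \<sigma>"
| "bval (BNot b) \<sigma> \<longleftrightarrow> \<not> bval b \<sigma>"
| "bval (BAnd b d) \<sigma> \<longleftrightarrow> bval b \<sigma> \<and> bval d \<sigma>"

fun bcost :: "bexp \<Rightarrow> state \<Rightarrow> nat" where
  "bcost (Less e f) \<sigma> = acost e \<sigma> + acost f \<sigma> + bit_size (aval e \<sigma>) + bit_size (aval f \<sigma>)"
| "bcost (BNot b) \<sigma> = 1 + bcost b \<sigma>"
| "bcost (BAnd b d) \<sigma> = 1 + bcost b \<sigma> + bcost d \<sigma>"

text \<open>
  \<open>exec p \<sigma> t \<sigma>'\<close>: started in state \<open>\<sigma>\<close>, the program \<open>p\<close> halts in state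
  \<open>\<sigma>'\<close> after time \<open>t\<close>.
\<close>

inductive exec :: "com \<Rightarrow> state \<Rightarrow> nat \<Rightarrow> state \<Rightarrow> bool" where
  Skip: "exec Skip \<sigma> 1 \<sigma>"
| Assign: "exec (Assign a e f) \<sigma>
    (acost e \<sigma> + acost f \<sigma> + bit_size (aval e \<sigma>) + bit_size (aval f \<sigma>))
    (\<sigma>(a := (\<sigma> a)(aval e \<sigma> := aval f \<sigma>)))"
| Seq: "exec p \<sigma>1 t1 \<sigma>2 \<Longrightarrow> exec q \<sigma>2 t2 \<sigma>3 \<Longrightarrow> exec (Seq p q) \<sigma>1 (t1 + t2) \<sigma>3"
| CondTrue: "bval b \<sigma> \<Longrightarrow> exec p \<sigma> t \<sigma>' \<Longrightarrow> exec (Cond b p q) \<sigma> (1 + bcost b \<sigma> + t) \<sigma>'"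
| CondFalse: "\<not> bval b \<sigma> \<Longrightarrow> exec q \<sigma> t \<sigma>' \<Longrightarrow> exec (Cond b p q) \<sigma> (1 + bcost b \<sigma> + t) \<sigma>'"
| WhileFalse: "\<not> bval b \<sigma> \<Longrightarrow> exec (While b p) \<sigma> (1 + bcost b \<sigma>) \<sigma>"
| WhileTrue: "bval b \<sigma>1 \<Longrightarrow> exec p \<sigma>1 t1 \<sigma>2 \<Longrightarrow> exec (While b p) \<sigma>2 t2 \<sigma>3 \<Longrightarrow>
    exec (While b p) \<sigma>1 (1 + bcost b \<sigma>1 + t1 + t2) \<sigma>3"

inductive_cases SkipE: "exec Skip \<sigma> t \<sigma>'"
inductive_cases AssignE: "exec (Assign a e f) \<sigma> t \<sigma>'"
inductive_cases SeqE: "exec (Seq p q) \<sigma> t \<sigma>'"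
inductive_cases CondE: "exec (Cond b p q) \<sigma> t \<sigma>'"
inductive_cases WhileE: "exec (While b p) \<sigma> t \<sigma>'"

lemma exec_deterministic:
  "exec p \<sigma> t \<sigma>' \<Longrightarrow> exec p \<sigma> t' \<sigma>'' \<Longrightarrow> t' = t \<and> \<sigma>'' = \<sigma>'"
proof (induction arbitrary: t' \<sigma>'' rule: exec.induct)
  case (Skip \<sigma>)
  then show ?case by (rule SkipE) simp
next
  case (Assign a e f \<sigma>)
  then show ?case by (rule AssignE) simp
next
  case (Seq p \<sigma>1 t1 \<sigma>2 q t2 \<sigma>3)
  from Seq.prems obtain u1 \<tau> u2 where
    "exec p \<sigma>1 u1 \<tau>" "exec q \<tau> u2 \<sigma>''" "t' = u1 + u2" by (rule SeqE)
  with Seq.IH show ?case by metis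
next
  case (CondTrue b \<sigma> p t \<sigma>' q)
  from CondTrue.prems CondTrue.hyps obtain u where
    "exec p \<sigma> u \<sigma>''" "t' = 1 + bcost b \<sigma> + u" by (auto elim: CondE)
  with CondTrue.IH show ?case by metis
next
  case (CondFalse b \<sigma> q t \<sigma>' p)
  from CondFalse.prems CondFalse.hyps obtain u where
    "exec q \<sigma> u \<sigma>''" "t' = 1 + bcost b \<sigma> + u" by (auto elim: CondE)
  with CondFalse.IH show ?case by metis
next
  case (WhileFalse b \<sigma> p)
  from WhileFalse.prems WhileFalse.hyps show ?case by (auto elim: WhileE)
next
  case (WhileTrue b \<sigma>1 p t1 \<sigma>2 t2 \<sigma>3)
  from WhileTrue.prems WhileTrue.hyps obtain u1 \<tau> u2 where
    "exec p \<sigma>1 u1 \<tau>" "exec (While b p) \<tau> u2 \<sigma>''"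
    "t' = 1 + bcost b \<sigma>1 + u1 + u2" by (auto elim: WhileE)
  with WhileTrue.IH show ?case by metis
qed

text \<open>
  Inputs and outputs are lists of integers, stored entry by entry in one array, with the length
  in a second one.  All other memory cells are initially 0.
\<close>

definition init_state :: "int list \<Rightarrow> state" where
  "init_state xs =
     (\<lambda>_ _. 0)(''in'' := (\<lambda>i. if 0 \<le> i \<and> i < int (length xs) then xs ! nat i else 0),
               ''inlen'' := (\<lambda>_. 0)(0 := int (length xs)))"

definition read_output :: "state \<Rightarrow> int list" where
  "read_output \<sigma> = map (\<lambda>i. \<sigma> ''out'' (int i)) [0..<nat (\<sigma> ''outlen'' 0)]"

definition computes_within :: "com \<Rightarrow> int list \<Rightarrow> nat \<Rightarrow> int list \<Rightarrow> bool" where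
  "computes_within p xs T ys \<longleftrightarrow>
     (\<exists>t \<sigma>. exec p (init_state xs) t \<sigma> \<and> t \<le> T \<and> read_output \<sigma> = ys)"

section \<open>The three-way integer transportation problem\<close>

text \<open>
  Arrays are functions; only their values at indices \<open>1 \<le> i \<le> r\<close>,
  \<open>1 \<le> j \<le> s\<close>, \<open>1 \<le> k \<le> l\<close> matter.
\<close>

definition objective ::
  "nat \<Rightarrow> nat \<Rightarrow> nat \<Rightarrow> (nat \<Rightarrow> nat \<Rightarrow> nat \<Rightarrow> int) \<Rightarrow> (nat \<Rightarrow> nat \<Rightarrow> nat \<Rightarrow> nat) \<Rightarrow> int" where
  "objective r s l c x = (\<Sum>i=1..r. \<Sum>j=1..s. \<Sum>k=1..l. c i j k * int (x i j k))"

definition feasible ::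
  "nat \<Rightarrow> nat \<Rightarrow> nat \<Rightarrow> (nat \<Rightarrow> nat \<Rightarrow> int) \<Rightarrow> (nat \<Rightarrow> nat \<Rightarrow> int) \<Rightarrow> (nat \<Rightarrow> nat \<Rightarrow> int) \<Rightarrow>
   (nat \<Rightarrow> nat \<Rightarrow> nat \<Rightarrow> nat) \<Rightarrow> bool" where
  "feasible r s l u v w x \<longleftrightarrow>
     (\<forall>j\<in>{1..s}. \<forall>k\<in>{1..l}. (\<Sum>i=1..r. int (x i j k)) = w j k) \<and>
     (\<forall>i\<in>{1..r}. \<forall>k\<in>{1..l}. (\<Sum>j=1..s. int (x i j k)) = v i k) \<and>
     (\<forall>i\<in>{1..r}. \<forall>j\<in>{1..s}. (\<Sum>k=1..l. int (x i j k)) = u i j)"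

datatype outcome = Infeasible | Unbounded | Optimal "nat \<Rightarrow> nat \<Rightarrow> nat \<Rightarrow> nat"

fun correct_outcome ::
  "nat \<Rightarrow> nat \<Rightarrow> nat \<Rightarrow> (nat \<Rightarrow> nat \<Rightarrow> nat \<Rightarrow> int) \<Rightarrow>
   (nat \<Rightarrow> nat \<Rightarrow> int) \<Rightarrow> (nat \<Rightarrow> nat \<Rightarrow> int) \<Rightarrow> (nat \<Rightarrow> nat \<Rightarrow> int) \<Rightarrow> outcome \<Rightarrow> bool" where
  "correct_outcome r s l c u v w Infeasible \<longleftrightarrow> (\<nexists>x. feasible r s l u v w x)"
| "correct_outcome r s l c u v w Unbounded \<longleftrightarrow>
     (\<forall>B. \<exists>x. feasible r s l u v w x \<and> objective r s l c x < B)"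
| "correct_outcome r s l c u v w (Optimal x) \<longleftrightarrow>
     feasible r s l u v w x \<and>
     (\<forall>y. feasible r s l u v w y \<longrightarrow> objective r s l c x \<le> objective r s l c y)"

definition entries2 :: "nat \<Rightarrow> nat \<Rightarrow> (nat \<Rightarrow> nat \<Rightarrow> 'a) \<Rightarrow> 'a list" where
  "entries2 m n f = [f i j. i \<leftarrow> [1..<Suc m], j \<leftarrow> [1..<Suc n]]"

definition entries3 :: "nat \<Rightarrow> nat \<Rightarrow> nat \<Rightarrow> (nat \<Rightarrow> nat \<Rightarrow> nat \<Rightarrow> 'a) \<Rightarrow> 'a list" where
  "entries3 m n p f = [f i j k. i \<leftarrow> [1..<Suc m], j \<leftarrow> [1..<Suc n], k \<leftarrow> [1..<Suc p]]"

definition input_data ::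
  "nat \<Rightarrow> nat \<Rightarrow> nat \<Rightarrow> (nat \<Rightarrow> nat \<Rightarrow> nat \<Rightarrow> int) \<Rightarrow>
   (nat \<Rightarrow> nat \<Rightarrow> int) \<Rightarrow> (nat \<Rightarrow> nat \<Rightarrow> int) \<Rightarrow> (nat \<Rightarrow> nat \<Rightarrow> int) \<Rightarrow> int list" where
  "input_data r s l c u v w =
     entries3 r s l c @ entries2 r s u @ entries2 r l v @ entries2 s l w"

definition encode_input ::
  "nat \<Rightarrow> nat \<Rightarrow> nat \<Rightarrow> (nat \<Rightarrow> nat \<Rightarrow> nat \<Rightarrow> int) \<Rightarrow>
   (nat \<Rightarrow> nat \<Rightarrow> int) \<Rightarrow> (nat \<Rightarrow> nat \<Rightarrow> int) \<Rightarrow> (nat \<Rightarrow> nat \<Rightarrow> int) \<Rightarrow> int list" where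
  "encode_input r s l c u v w = int l # input_data r s l c u v w"

definition input_size ::
  "nat \<Rightarrow> nat \<Rightarrow> nat \<Rightarrow> (nat \<Rightarrow> nat \<Rightarrow> nat \<Rightarrow> int) \<Rightarrow>
   (nat \<Rightarrow> nat \<Rightarrow> int) \<Rightarrow> (nat \<Rightarrow> nat \<Rightarrow> int) \<Rightarrow> (nat \<Rightarrow> nat \<Rightarrow> int) \<Rightarrow> nat" where
  "input_size r s l c u v w = l + sum_list (map bit_size (input_data r s l c u v w))"

fun encode_outcome :: "nat \<Rightarrow> nat \<Rightarrow> nat \<Rightarrow> outcome \<Rightarrow> int list" where
  "encode_outcome r s l Infeasible = [0]"
| "encode_outcome r s l Unbounded = [1]"
| "encode_outcome r s l (Optimal x) = 2 # map int (entries3 r s l x)"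

end

theory Submission
  imports Defs
begin

text \<open>
  Write \<open>F x\<close> for the cost of \<open>x\<close> plus a large multiple of its total infeasibility: the sum of
  the negative parts of the entries and of the absolute errors of the line sums.  Then
  minimizing \<open>F\<close> over all integer arrays solves the problem, starting from \<open>x = 0\<close>, and \<open>F\<close> is
  a sum of convex functions of the entries and of the line sums.

  Dickson's lemma, applied first to single \<open>r \<times> s\<close> layers and then to the multiset of layers,
  yields a constant \<open>K\<close>, independent of \<open>l\<close>, such that every nonzero array \<open>d\<close> dominates a nonzero
  array \<open>g\<close> of norm at most \<open>K\<close>: every entry and every line sum of \<open>g\<close> has the sign of that of
  \<open>d\<close> and is not larger in absolute value.  Hence the difference of a minimizer and the current
  \<open>x\<close> is a sign-compatible sum of distinct terms \<open>2 ^ i * g\<close>, of which there are only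
  polynomially many, say \<open>N\<close>.  By convexity the best such step reduces the distance of \<open>F x\<close>
  from the minimum by the factor \<open>1 - 1 / N\<close>, so polynomially many steps reach the minimum,
  and all steps can be enumerated because \<open>g\<close> is given by \<open>K\<close> signed unit vectors.
\<close>

section \<open>Elements of bounded size in conformal decompositions\<close>

text \<open>Minimizing over all integer arrays removes the search for a feasible starting point, but
  a step may then change line sums, so convexity helps only for steps that are sign-compatible in
  the line sums as well as in the entries. Hence \<open>conform\<close> treats both alike, and
  layers are bordered with their row and column sums before Dickson's lemma is applied. Applied
  directly to whole arrays, that lemma would give a bound depending on \<open>l\<close>. Row and
  column sums live inside one layer; only the sums over \<open>k\<close> couple layers. Once every
  layer is a sum of tables from a finite stock, it is enough to know how often each table occurs and
  what the sums over \<open>k\<close> are, a vector whose length depends on \<open>r\<close> and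
  \<open>s\<close> only. \<open>K\<close> is obtained non-constructively and built into the program
  as a constant, so the number of codes \<open>(2 * n + 2) ^ K\<close> is polynomial in
  \<open>l\<close>. The penalty coefficient \<open>4 * S * S\<close> comes from a bound
  \<open>S\<close> on the data: a feasible array costs at most \<open>S * S\<close>, while an
  infeasible one has penalized value at least \<open>2 * (S * S)\<close>. Infeasibility is therefore
  read off the minimum.\<close>

definition conf :: "int \<Rightarrow> int \<Rightarrow> bool" where
  "conf a b \<longleftrightarrow> 0 \<le> a \<and> a \<le> b \<or> b \<le> a \<and> a \<le> 0"

lemma conf_trans: "conf a b \<Longrightarrow> conf b c \<Longrightarrow> conf a c"
  by (auto simp: conf_def)

lemma conf_zero [simp]: "conf 0 a" "conf a 0 \<longleftrightarrow> a = 0"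
  by (auto simp: conf_def)

lemma conf_diff: "conf a b \<Longrightarrow> conf (b - a) b"
  by (auto simp: conf_def)

text \<open>The common sign of the \<open>g h\<close> excludes cancellation, which could otherwise
  make \<open>sum g A\<close> smaller in absolute value than \<open>sum f A\<close>.\<close>

lemma conf_sum:
  fixes f g :: "'a \<Rightarrow> int"
  assumes "\<And>h. h \<in> A \<Longrightarrow> conf (f h) (g h)"
    and "(\<forall>h\<in>A. 0 \<le> g h) \<or> (\<forall>h\<in>A. g h \<le> 0)"
  shows "conf (sum f A) (sum g A)"
  using assms(2)
proof
  assume "\<forall>h\<in>A. 0 \<le> g h"
  with assms(1) have *: "0 \<le> f h" "f h \<le> g h" if "h \<in> A" for h
    using that by (fastforce simp: conf_def)+
  have "0 \<le> sum f A" "sum f A \<le> sum g A"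
    using * by (auto intro: sum_nonneg sum_mono)
  then show ?thesis by (simp add: conf_def)
next
  assume "\<forall>h\<in>A. g h \<le> 0"
  with assms(1) have *: "f h \<le> 0" "g h \<le> f h" if "h \<in> A" for h
    using that by (fastforce simp: conf_def)+
  have "sum f A \<le> 0" "sum g A \<le> sum f A"
    using * by (auto intro: sum_nonpos sum_mono)
  then show ?thesis by (simp add: conf_def)
qed

section \<open>Dickson's lemma for the sign-compatible order\<close>

text \<open>Some subsequence is monotone; if it decreases, it reaches its least value and is
  constant from there on.\<close>

lemma nat_seq_mono_subseq:
  fixes a :: "nat \<Rightarrow> nat"
  shows "\<exists>\<phi> :: nat \<Rightarrow> nat. strict_mono \<phi> \<and> mono (a \<circ> \<phi>)"
proof -
  obtain \<phi> :: "nat \<Rightarrow> nat" where \<phi>: "strict_mono \<phi>" "monoseq (\<lambda>n. a (\<phi> n))"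
    using seq_monosub by blast
  show ?thesis
  proof (cases "incseq (\<lambda>n. a (\<phi> n))")
    case True
    then show ?thesis using \<phi>(1) by (intro exI[of _ \<phi>]) (auto simp: incseq_def mono_def)
  next
    case False
    then have dec: "decseq (\<lambda>n. a (\<phi> n))"
      using \<phi>(2) by (simp add: monoseq_iff)
    define v where "v = (LEAST v. \<exists>n. v = a (\<phi> n))"
    have "\<exists>n. v = a (\<phi> n)"
      unfolding v_def by (rule LeastI_ex) auto
    then obtain N where N: "v = a (\<phi> N)" by blast
    have le: "v \<le> a (\<phi> n)" for n
      unfolding v_def by (rule Least_le) auto
    have c: "a (\<phi> (n + N)) = v" for n
      using decseqD[OF dec, of N "n + N"] le[of "n + N"] N by simp
    have "strict_mono (\<lambda>n. \<phi> (n + N))"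
      using \<phi>(1) by (auto simp: strict_mono_def)
    moreover have "mono (a \<circ> (\<lambda>n. \<phi> (n + N)))"
      using c by (simp add: mono_def)
    ultimately show ?thesis by blast
  qed
qed

text \<open>\<open>conf a b\<close> follows once the positive and the negative part of
  \<open>a\<close> are at most those of \<open>b\<close>, so the claim for natural numbers is
  applied to the two parts in turn.\<close>

lemma int_seq_conf_subseq:
  fixes a :: "nat \<Rightarrow> int"
  shows "\<exists>\<phi> :: nat \<Rightarrow> nat. strict_mono \<phi> \<and> (\<forall>m n. m \<le> n \<longrightarrow> conf (a (\<phi> m)) (a (\<phi> n)))"
proof -
  obtain \<phi> :: "nat \<Rightarrow> nat" where \<phi>: "strict_mono \<phi>" "mono ((\<lambda>n. nat (a n)) \<circ> \<phi>)"
    using nat_seq_mono_subseq by blast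
  obtain \<psi> :: "nat \<Rightarrow> nat" where \<psi>: "strict_mono \<psi>" "mono ((\<lambda>n. nat (- a (\<phi> n))) \<circ> \<psi>)"
    using nat_seq_mono_subseq by blast
  have "conf (a (\<phi> (\<psi> m))) (a (\<phi> (\<psi> n)))" if "m \<le> n" for m n
  proof -
    have "\<psi> m \<le> \<psi> n" using \<psi>(1) that by (simp add: strict_mono_less_eq)
    then have "nat (a (\<phi> (\<psi> m))) \<le> nat (a (\<phi> (\<psi> n)))"
      using \<phi>(2) by (auto simp: mono_def)
    moreover have "nat (- a (\<phi> (\<psi> m))) \<le> nat (- a (\<phi> (\<psi> n)))"
      using \<psi>(2) that by (auto simp: mono_def)
    ultimately show ?thesis by (auto simp: conf_def)
  qed
  then show ?thesis
    using strict_mono_compose[OF \<phi>(1) \<psi>(1)] by blast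
qed

lemma vec_seq_conf_subseq:
  fixes x :: "nat \<Rightarrow> 'i \<Rightarrow> int"
  assumes "finite I"
  shows "\<exists>\<phi> :: nat \<Rightarrow> nat. strict_mono \<phi> \<and> (\<forall>m n. m \<le> n \<longrightarrow> (\<forall>i\<in>I. conf (x (\<phi> m) i) (x (\<phi> n) i)))"
  using assms
proof (induction I rule: finite_induct)
  case empty
  show ?case by (auto intro: exI[of _ id] simp: strict_mono_def)
next
  case (insert i I)
  then obtain \<phi> :: "nat \<Rightarrow> nat" where \<phi>: "strict_mono \<phi>"
    "\<And>m n j. m \<le> n \<Longrightarrow> j \<in> I \<Longrightarrow> conf (x (\<phi> m) j) (x (\<phi> n) j)" by blast
  obtain \<psi> :: "nat \<Rightarrow> nat" where \<psi>: "strict_mono \<psi>"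
    "\<And>m n. m \<le> n \<Longrightarrow> conf (x (\<phi> (\<psi> m)) i) (x (\<phi> (\<psi> n)) i)"
    using int_seq_conf_subseq[of "\<lambda>n. x (\<phi> n) i"] by blast
  have "strict_mono (\<lambda>n. \<phi> (\<psi> n))"
    using strict_mono_compose[OF \<phi>(1) \<psi>(1)] .
  moreover have "conf (x (\<phi> (\<psi> m)) j) (x (\<phi> (\<psi> n)) j)" if "m \<le> n" "j \<in> insert i I" for m n j
    using that \<psi> \<phi>(2)[of "\<psi> m" "\<psi> n"] by (auto simp: strict_mono_less_eq)
  ultimately show ?case by blast
qed

text \<open>Dickson's lemma for an arbitrary set \<Lambda>. If no finite subset sufficed, elements
  could be picked forever, none of them above an earlier one; a conforming subsequence of the picks
  contradicts this.\<close>

lemma finite_conf_basis: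
  fixes \<Lambda> :: "('i \<Rightarrow> int) set"
  assumes "finite I"
  shows "\<exists>B. finite B \<and> B \<subseteq> \<Lambda> \<and> (\<forall>x\<in>\<Lambda>. \<exists>y\<in>B. \<forall>i\<in>I. conf (y i) (x i))"
proof (rule ccontr)
  assume none: "\<not> ?thesis"
  define bad where "bad B x \<longleftrightarrow> x \<in> \<Lambda> \<and> (\<forall>y\<in>B. \<not> (\<forall>i\<in>I. conf (y i) (x i)))" for B x
  have ex: "\<exists>x. bad B x" if "finite B" "B \<subseteq> \<Lambda>" for B
  proof (rule ccontr)
    assume "\<not> ?thesis"
    then have "\<forall>x\<in>\<Lambda>. \<exists>y\<in>B. \<forall>i\<in>I. conf (y i) (x i)" by (simp add: bad_def)
    with that none show False by blast
  qed
  define pick where "pick B = (SOME x. bad B x)" for B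
  \<comment> \<open>\<open>S n\<close> collects the first \<open>n\<close> picks, and
    \<open>pick (S n)\<close> is the next one.\<close>
  define S where "S = rec_nat {} (\<lambda>_ B. insert (pick B) B)"
  have S_simps: "S 0 = {}" "S (Suc n) = insert (pick (S n)) (S n)" for n
    by (simp_all add: S_def)
  have S: "finite (S n) \<and> S n \<subseteq> \<Lambda> \<and> bad (S n) (pick (S n))" for n
  proof (induction n)
    case 0
    then show ?case using ex[of "{}"] someI_ex[of "bad {}"] by (auto simp: S_simps pick_def)
  next
    case (Suc n)
    then have "finite (S (Suc n))" "S (Suc n) \<subseteq> \<Lambda>" by (auto simp: S_simps bad_def)
    then show ?case
      using ex[of "S (Suc n)"] someI_ex[of "bad (S (Suc n))"] by (auto simp: pick_def)
  qed
  have mono: "S m \<subseteq> S n" if "m \<le> n" for m n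
    using that by (rule lift_Suc_mono_le[rotated]) (auto simp: S_simps)
  obtain \<phi> :: "nat \<Rightarrow> nat" where \<phi>: "strict_mono \<phi>"
    "\<And>m n i. m \<le> n \<Longrightarrow> i \<in> I \<Longrightarrow> conf (pick (S (\<phi> m)) i) (pick (S (\<phi> n)) i)"
    using vec_seq_conf_subseq[OF assms, of "\<lambda>n. pick (S n)"] by blast
  have "\<phi> 0 < \<phi> 1" using \<phi>(1) by (simp add: strict_mono_def)
  then have "pick (S (\<phi> 0)) \<in> S (\<phi> 1)"
    using mono[of "Suc (\<phi> 0)" "\<phi> 1"] by (auto simp: S_simps)
  moreover have "bad (S (\<phi> 1)) (pick (S (\<phi> 1)))" using S by blast
  ultimately show False using \<phi>(2)[of 0 1] by (auto simp: bad_def)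
qed

section \<open>Tables bordered by their row and column sums\<close>

text \<open>Storing the margins in row \<open>r\<close> and column \<open>s\<close> makes them
  coordinates, so that sign-compatibility on \<open>bordered r s\<close> covers entries and line
  sums of a layer at once.\<close>

definition margins :: "nat \<Rightarrow> nat \<Rightarrow> (nat \<times> nat \<Rightarrow> int) \<Rightarrow> bool" where
  "margins r s X \<longleftrightarrow> (\<forall>i<r. X (i, s) = (\<Sum>j<s. X (i, j))) \<and> (\<forall>j<s. X (r, j) = (\<Sum>i<r. X (i, j)))"

abbreviation (input) bordered :: "nat \<Rightarrow> nat \<Rightarrow> (nat \<times> nat) set" where
  "bordered r s \<equiv> {..<r} \<times> {..s} \<union> {..r} \<times> {..<s}"

lemma margins_sum:
  assumes "\<And>h. h \<in> B \<Longrightarrow> margins r s h"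
  shows "margins r s (\<lambda>p. \<Sum>h\<in>B. a h * h p)"
proof -
  have "(\<Sum>h\<in>B. a h * h (i, s)) = (\<Sum>j<s. \<Sum>h\<in>B. a h * h (i, j))" if "i < r" for i
  proof -
    have "(\<Sum>h\<in>B. a h * h (i, s)) = (\<Sum>h\<in>B. a h * (\<Sum>j<s. h (i, j)))"
      using assms that by (intro sum.cong) (auto simp: margins_def)
    also have "\<dots> = (\<Sum>j<s. \<Sum>h\<in>B. a h * h (i, j))"
      unfolding sum_distrib_left by (rule sum.swap)
    finally show ?thesis .
  qed
  moreover have "(\<Sum>h\<in>B. a h * h (r, j)) = (\<Sum>i<r. \<Sum>h\<in>B. a h * h (i, j))" if "j < s" for j
  proof -
    have "(\<Sum>h\<in>B. a h * h (r, j)) = (\<Sum>h\<in>B. a h * (\<Sum>i<r. h (i, j)))"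
      using assms that by (intro sum.cong) (auto simp: margins_def)
    also have "\<dots> = (\<Sum>i<r. \<Sum>h\<in>B. a h * h (i, j))"
      unfolding sum_distrib_left by (rule sum.swap)
    finally show ?thesis .
  qed
  ultimately show ?thesis by (simp add: margins_def)
qed

text \<open>\<open>B\<close> is a Dickson basis of the nonzero tables. A basis element that conforms
  to \<open>X\<close> is subtracted; the rest still conforms to \<open>X\<close> and has a smaller
  sum of absolute entries, so the repetition ends. All tables used conform to \<open>X\<close> and
  hence never cancel each other.\<close>

lemma brick_basis:
  "\<exists>B. finite B \<and> (\<forall>h\<in>B. margins r s h \<and> (\<exists>p\<in>{..<r} \<times> {..<s}. h p \<noteq> 0)) \<and>
     (\<forall>X. margins r s X \<longrightarrow> (\<exists>n :: (nat \<times> nat \<Rightarrow> int) \<Rightarrow> nat.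
        (\<forall>p\<in>bordered r s. X p = (\<Sum>h\<in>B. int (n h) * h p)) \<and>
        (\<forall>h\<in>B. n h > 0 \<longrightarrow> (\<forall>p\<in>bordered r s. conf (h p) (X p)))))"
proof -
  define \<Lambda> where "\<Lambda> = {X. margins r s X \<and> (\<exists>p\<in>{..<r} \<times> {..<s}. X p \<noteq> 0)}"
  have fin: "finite (bordered r s)" by simp
  obtain B where B: "finite B" "B \<subseteq> \<Lambda>"
    "\<And>X. X \<in> \<Lambda> \<Longrightarrow> \<exists>y\<in>B. \<forall>p\<in>bordered r s. conf (y p) (X p)"
    using finite_conf_basis[OF fin, of \<Lambda>] by blast
  have "\<exists>n :: (nat \<times> nat \<Rightarrow> int) \<Rightarrow> nat.
        (\<forall>p\<in>bordered r s. X p = (\<Sum>h\<in>B. int (n h) * h p)) \<and>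
        (\<forall>h\<in>B. n h > 0 \<longrightarrow> (\<forall>p\<in>bordered r s. conf (h p) (X p)))" if "margins r s X" for X
    using that
  proof (induction "\<Sum>p\<in>{..<r} \<times> {..<s}. nat \<bar>X p\<bar>" arbitrary: X rule: less_induct)
    case less
    show ?case
    proof (cases "X \<in> \<Lambda>")
      case False
      then have "\<forall>p\<in>{..<r} \<times> {..<s}. X p = 0" using less.prems by (auto simp: \<Lambda>_def)
      then have "\<forall>p\<in>bordered r s. X p = 0"
        using less.prems by (auto simp: margins_def le_less)
      then show ?thesis by (intro exI[of _ "\<lambda>_. 0"]) simp
    next
      case True
      then obtain g where g: "g \<in> B" "\<forall>p\<in>bordered r s. conf (g p) (X p)" using B(3) by blast
      have gm: "margins r s g" "\<exists>p\<in>{..<r} \<times> {..<s}. g p \<noteq> 0"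
        using g(1) B(2) by (auto simp: \<Lambda>_def)
      define Y where "Y p = X p - g p" for p
      have Ym: "margins r s Y"
        using less.prems gm(1) by (auto simp: margins_def Y_def sum_subtractf)
      have Yc: "\<forall>p\<in>bordered r s. conf (Y p) (X p)"
        using g(2) conf_diff by (auto simp: Y_def)
      have "(\<Sum>p\<in>{..<r} \<times> {..<s}. nat \<bar>Y p\<bar>) < (\<Sum>p\<in>{..<r} \<times> {..<s}. nat \<bar>X p\<bar>)"
      proof (rule sum_strict_mono_ex1)
        show "\<forall>p\<in>{..<r} \<times> {..<s}. nat \<bar>Y p\<bar> \<le> nat \<bar>X p\<bar>"
        proof
          fix p assume "p \<in> {..<r} \<times> {..<s}"
          then have "conf (Y p) (X p)" using Yc by auto
          then show "nat \<bar>Y p\<bar> \<le> nat \<bar>X p\<bar>" by (auto simp: conf_def)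
        qed
        obtain p where "p \<in> {..<r} \<times> {..<s}" "g p \<noteq> 0" using gm(2) by blast
        moreover from this have "conf (g p) (X p)" using g(2) by auto
        ultimately show "\<exists>p\<in>{..<r} \<times> {..<s}. nat \<bar>Y p\<bar> < nat \<bar>X p\<bar>"
          by (intro bexI[of _ p]) (auto simp: Y_def conf_def)
      qed simp
      from less.hyps[OF this Ym] obtain n where n:
        "\<forall>p\<in>bordered r s. Y p = (\<Sum>h\<in>B. int (n h) * h p)"
        "\<forall>h\<in>B. n h > 0 \<longrightarrow> (\<forall>p\<in>bordered r s. conf (h p) (Y p))" by blast
      define n' where "n' = n(g := Suc (n g))"
      have "X p = (\<Sum>h\<in>B. int (n' h) * h p)" if "p \<in> bordered r s" for p
      proof -
        have "(\<Sum>h\<in>B. int (n' h) * h p) = (\<Sum>h\<in>B. int (n h) * h p + (if h = g then g p else 0))"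
          by (intro sum.cong) (auto simp: n'_def algebra_simps)
        also have "\<dots> = Y p + g p"
          using n(1) that B(1) g(1) by (simp add: sum.distrib)
        finally show ?thesis by (simp add: Y_def)
      qed
      moreover have "conf (h p) (X p)" if "h \<in> B" "n' h > 0" "p \<in> bordered r s" for h p
      proof (cases "h = g")
        case True
        then show ?thesis using g(2) that by blast
      next
        case False
        then show ?thesis using n(2) Yc that conf_trans[of "h p" "Y p" "X p"]
          by (auto simp: n'_def)
      qed
      ultimately show ?thesis by blast
    qed
  qed
  then show ?thesis using B(1,2) by (intro exI[of _ B]) (auto simp: \<Lambda>_def)
qed

text \<open>Greedy filling up to capacity. It serves to decide from which layers the chosen copies
  of a table are taken.\<close>

lemma split_below_sum:
  fixes n :: "nat \<Rightarrow> nat"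
  assumes "m \<le> (\<Sum>k<l. n k)"
  shows "\<exists>f. (\<forall>k<l. f k \<le> n k) \<and> (\<Sum>k<l. f k) = m"
  using assms
proof (induction l arbitrary: m)
  case (Suc l)
  have "m - min m (n l) \<le> (\<Sum>k<l. n k)" using Suc.prems by auto
  from Suc.IH[OF this] obtain f where f: "\<forall>k<l. f k \<le> n k" "(\<Sum>k<l. f k) = m - min m (n l)"
    by blast
  have "(\<Sum>k<l. (f(l := min m (n l))) k) = (\<Sum>k<l. f k)" by (intro sum.cong) auto
  then show ?case using f
    by (intro exI[of _ "f(l := min m (n l))"]) (auto simp: less_Suc_eq)
qed simp

lemma sum_same_sign_eq_0:
  fixes f :: "'a \<Rightarrow> int"
  assumes "finite A" "(\<forall>h\<in>A. 0 \<le> f h) \<or> (\<forall>h\<in>A. f h \<le> 0)" "sum f A = 0" "h \<in> A"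
  shows "f h = 0"
proof (cases "\<forall>h\<in>A. 0 \<le> f h")
  case True
  then show ?thesis using assms by (simp add: sum_nonneg_eq_0_iff)
next
  case False
  then have "\<forall>h\<in>A. 0 \<le> - f h" using assms(2) by auto
  moreover have "sum (\<lambda>h. - f h) A = 0" using assms(3) by (simp add: sum_negf)
  ultimately have "\<forall>h\<in>A. - f h = 0" using assms(1) by (subst (asm) sum_nonneg_eq_0_iff) auto
  then show ?thesis using assms(4) by simp
qed

section \<open>A norm bound independent of the number of layers\<close>

definition conform3 :: "nat \<Rightarrow> nat \<Rightarrow> nat \<Rightarrow> (nat \<Rightarrow> nat \<Rightarrow> nat \<Rightarrow> int) \<Rightarrow> (nat \<Rightarrow> nat \<Rightarrow> nat \<Rightarrow> int) \<Rightarrow> bool" where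
  "conform3 r s l g x \<longleftrightarrow> (\<forall>i<r. \<forall>j<s. \<forall>k<l. conf (g i j k) (x i j k)) \<and>
     (\<forall>j<s. \<forall>k<l. conf (\<Sum>i<r. g i j k) (\<Sum>i<r. x i j k)) \<and>
     (\<forall>i<r. \<forall>k<l. conf (\<Sum>j<s. g i j k) (\<Sum>j<s. x i j k)) \<and>
     (\<forall>i<r. \<forall>j<s. conf (\<Sum>k<l. g i j k) (\<Sum>k<l. x i j k))"

text \<open>Every layer is a sum of tables from \<open>B\<close>, so \<open>x\<close> is summarized
  by the total multiplicity of each table together with the sums over the layers. Dickson's lemma
  for these summaries, whose length does not involve \<open>l\<close>, leaves finitely many; the
  copies counted by one below that of \<open>x\<close> are taken from layers that contain them, and
  they form \<open>g\<close>.\<close>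

lemma graver_bound:
  "\<exists>K. \<forall>l (x :: nat \<Rightarrow> nat \<Rightarrow> nat \<Rightarrow> int). (\<exists>i<r. \<exists>j<s. \<exists>k<l. x i j k \<noteq> 0) \<longrightarrow>
     (\<exists>g. (\<exists>i<r. \<exists>j<s. \<exists>k<l. g i j k \<noteq> 0) \<and>
        (\<Sum>i<r. \<Sum>j<s. \<Sum>k<l. \<bar>g i j k\<bar>) \<le> int K \<and>
        conform3 r s l g x)"
proof -
  define P where "P = {..<r} \<times> {..<s}"
  have finP: "finite P" by (simp add: P_def)
  obtain B where B: "finite B" "\<And>h. h \<in> B \<Longrightarrow> margins r s h" "\<And>h. h \<in> B \<Longrightarrow> \<exists>p\<in>P. h p \<noteq> 0"
    and decomp: "\<And>X. margins r s X \<Longrightarrow> \<exists>n :: (nat \<times> nat \<Rightarrow> int) \<Rightarrow> nat.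
        (\<forall>p\<in>bordered r s. X p = (\<Sum>h\<in>B. int (n h) * h p)) \<and>
        (\<forall>h\<in>B. n h > 0 \<longrightarrow> (\<forall>p\<in>bordered r s. conf (h p) (X p)))"
    using brick_basis[of r s] unfolding P_def by blast
  \<comment> \<open>\<open>Inl h\<close> carries the multiplicity of the table \<open>h\<close>,
    \<open>Inr p\<close> the sum over the layers at position \<open>p\<close>. The latter is
    determined by the former but is a coordinate of its own because it has to be sign-compatible
    too.\<close>
  define \<Lambda> :: "((nat \<times> nat \<Rightarrow> int) + nat \<times> nat \<Rightarrow> int) set" where
    "\<Lambda> = {\<nu>. (\<forall>h\<in>B. 0 \<le> \<nu> (Inl h)) \<and> (\<exists>h\<in>B. \<nu> (Inl h) > 0) \<and>
            (\<forall>p\<in>P. \<nu> (Inr p) = (\<Sum>h\<in>B. \<nu> (Inl h) * h p))}"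
  have "finite (Inl ` B \<union> Inr ` P)" using B(1) finP by simp
  from finite_conf_basis[OF this, of \<Lambda>] obtain C where C: "finite C" "C \<subseteq> \<Lambda>"
    "\<And>\<nu>. \<nu> \<in> \<Lambda> \<Longrightarrow> \<exists>\<mu>\<in>C. \<forall>i\<in>Inl ` B \<union> Inr ` P. conf (\<mu> i) (\<nu> i)" by blast
  \<comment> \<open>Bounds the norm of every array assembled from tables with these
    multiplicities.\<close>
  define size where "size \<mu> = (\<Sum>h\<in>B. \<bar>\<mu> (Inl h)\<bar> * (\<Sum>p\<in>P. \<bar>h p\<bar>))"
    for \<mu> :: "(nat \<times> nat \<Rightarrow> int) + nat \<times> nat \<Rightarrow> int"
  have size_nonneg: "0 \<le> size \<mu>" for \<mu>
    unfolding size_def by (intro sum_nonneg mult_nonneg_nonneg) auto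
  define K where "K = nat (\<Sum>\<mu>\<in>C. size \<mu>)"
  show ?thesis
  proof (intro exI[of _ K] allI impI)
    fix l and x :: "nat \<Rightarrow> nat \<Rightarrow> nat \<Rightarrow> int"
    assume "\<exists>i<r. \<exists>j<s. \<exists>k<l. x i j k \<noteq> 0"
    then obtain i0 j0 k0 where x0: "i0 < r" "j0 < s" "k0 < l" "x i0 j0 k0 \<noteq> 0" by blast
    define X where "X k p = (if snd p = s then \<Sum>j<s. x (fst p) j k
      else if fst p = r then \<Sum>i<r. x i (snd p) k else x (fst p) (snd p) k)" for k and p :: "nat \<times> nat"
    have "margins r s (X k)" for k
      by (auto simp: margins_def X_def intro!: sum.cong)
    then have "\<forall>k. \<exists>n :: (nat \<times> nat \<Rightarrow> int) \<Rightarrow> nat.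
        (\<forall>p\<in>bordered r s. X k p = (\<Sum>h\<in>B. int (n h) * h p)) \<and>
        (\<forall>h\<in>B. n h > 0 \<longrightarrow> (\<forall>p\<in>bordered r s. conf (h p) (X k p)))"
      using decomp by blast
    from choice[OF this] obtain n :: "nat \<Rightarrow> (nat \<times> nat \<Rightarrow> int) \<Rightarrow> nat" where
      n: "\<And>k p. p \<in> bordered r s \<Longrightarrow> X k p = (\<Sum>h\<in>B. int (n k h) * h p)"
      "\<And>k h p. h \<in> B \<Longrightarrow> n k h > 0 \<Longrightarrow> p \<in> bordered r s \<Longrightarrow> conf (h p) (X k p)" by blast
    define \<nu> where "\<nu> = case_sum (\<lambda>h. \<Sum>k<l. int (n k h)) (\<lambda>p. \<Sum>k<l. X k p)"
    \<comment> \<open>Layer \<open>k0\<close> is nonzero and therefore uses some table.\<close>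
    have "\<exists>h\<in>B. \<nu> (Inl h) > 0"
    proof (rule ccontr)
      assume "\<not> ?thesis"
      then have "(\<Sum>k<l. int (n k h)) \<le> 0" if "h \<in> B" for h using that by (auto simp: \<nu>_def not_less)
      moreover have "(\<Sum>k<l. int (n k h)) \<ge> int (n k0 h)" for h
        using x0(3) by (intro member_le_sum) auto
      ultimately have "n k0 h = 0" if "h \<in> B" for h using that by (metis of_nat_le_0_iff order_trans)
      then have "X k0 (i0, j0) = 0" using n(1)[of "(i0, j0)" k0] x0 by simp
      then show False using x0 by (simp add: X_def)
    qed
    moreover have "\<nu> (Inr p) = (\<Sum>h\<in>B. \<nu> (Inl h) * h p)" if "p \<in> P" for p
    proof -
      have "(\<Sum>k<l. X k p) = (\<Sum>k<l. \<Sum>h\<in>B. int (n k h) * h p)"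
        using that by (intro sum.cong n(1)) (auto simp: P_def)
      also have "\<dots> = (\<Sum>h\<in>B. \<Sum>k<l. int (n k h) * h p)" by (rule sum.swap)
      finally show ?thesis by (simp add: \<nu>_def sum_distrib_right)
    qed
    ultimately have "\<nu> \<in> \<Lambda>" by (auto simp: \<Lambda>_def \<nu>_def intro: sum_nonneg)
    from C(3)[OF this] obtain \<mu> where \<mu>: "\<mu> \<in> C" "\<And>h. h \<in> B \<Longrightarrow> conf (\<mu> (Inl h)) (\<nu> (Inl h))"
      "\<And>p. p \<in> P \<Longrightarrow> conf (\<mu> (Inr p)) (\<nu> (Inr p))" by blast
    have \<mu>\<Lambda>: "\<mu> \<in> \<Lambda>" using \<mu>(1) C(2) by blast
    \<comment> \<open>The function obtained here becomes \<open>m h\<close>: layer \<open>k\<close>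
      gives away \<open>m h k\<close> of its \<open>n k h\<close> copies of
      \<open>h\<close>.\<close>
    have "\<exists>f. (\<forall>k<l. f k \<le> n k h) \<and> (\<Sum>k<l. f k) = nat (\<mu> (Inl h))" if "h \<in> B" for h
    proof (rule split_below_sum)
      have "\<nu> (Inl h) = int (\<Sum>k<l. n k h)" by (simp add: \<nu>_def)
      then show "nat (\<mu> (Inl h)) \<le> (\<Sum>k<l. n k h)"
        using \<mu>(2)[OF that] by (auto simp: conf_def nat_le_iff simp del: of_nat_sum)
    qed
    then have "\<forall>h. \<exists>f. h \<in> B \<longrightarrow> (\<forall>k<l. f k \<le> n k h) \<and> (\<Sum>k<l. f k) = nat (\<mu> (Inl h))" by blast
    from choice[OF this] obtain m where m: "\<And>h k. h \<in> B \<Longrightarrow> k < l \<Longrightarrow> m h k \<le> n k h"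
      "\<And>h. h \<in> B \<Longrightarrow> (\<Sum>k<l. m h k) = nat (\<mu> (Inl h))" by blast
    have m_sum: "(\<Sum>k<l. int (m h k)) = \<mu> (Inl h)" if "h \<in> B" for h
    proof -
      have "(\<Sum>k<l. int (m h k)) = int (nat (\<mu> (Inl h)))" unfolding m(2)[OF that, symmetric] by simp
      then show ?thesis using \<mu>\<Lambda> that by (simp add: \<Lambda>_def)
    qed
    define G where "G k p = (\<Sum>h\<in>B. int (m h k) * h p)" for k p
    have G_margins: "margins r s (G k)" for k
      unfolding G_def using margins_sum[OF B(2)] .
    \<comment> \<open>All tables occurring in layer \<open>k\<close> conform to \<open>X k\<close>,
      so at each position they share one sign; this is the hypothesis of
      \<open>conf_sum\<close>.\<close>
    have same_sign: "(\<forall>h\<in>B. 0 \<le> int (n k h) * h p) \<or> (\<forall>h\<in>B. int (n k h) * h p \<le> 0)"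
      if "p \<in> bordered r s" for k p
    proof (cases "X k p \<ge> 0")
      case True
      have "0 \<le> int (n k h) * h p" if "h \<in> B" for h
        using n(2)[of h k p] \<open>p \<in> bordered r s\<close> that True by (cases "n k h = 0") (auto simp: conf_def)
      then show ?thesis by blast
    next
      case False
      have "int (n k h) * h p \<le> 0" if "h \<in> B" for h
        using n(2)[of h k p] \<open>p \<in> bordered r s\<close> that False
        by (cases "n k h = 0") (auto simp: conf_def mult_nonneg_nonpos)
      then show ?thesis by blast
    qed
    have conf_mult: "conf (int a * z) (int b * z)" if "a \<le> b" for a b :: nat and z :: int
      using that by (cases "z \<ge> 0") (auto simp: conf_def mult_right_mono mult_right_mono_neg mult_nonneg_nonpos)
    have G_conf: "conf (G k p) (X k p)" if "k < l" "p \<in> bordered r s" for k p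
      unfolding G_def n(1)[OF that(2)]
      using m(1) that(1) same_sign[OF that(2)] by (intro conf_sum conf_mult) auto
    define g where "g i j k = G k (i, j)" for i j k
    have gx: "conf (g i j k) (x i j k)" if "i < r" "j < s" "k < l" for i j k
      using G_conf[of k "(i, j)"] that by (simp add: g_def X_def)
    have gw: "conf (\<Sum>i<r. g i j k) (\<Sum>i<r. x i j k)" if "j < s" "k < l" for j k
    proof -
      have "G k (r, j) = (\<Sum>i<r. g i j k)" using G_margins[of k] that by (simp add: margins_def g_def)
      then show ?thesis using G_conf[of k "(r, j)"] that by (simp add: X_def)
    qed
    have gv: "conf (\<Sum>j<s. g i j k) (\<Sum>j<s. x i j k)" if "i < r" "k < l" for i k
    proof -
      have "G k (i, s) = (\<Sum>j<s. g i j k)" using G_margins[of k] that by (simp add: margins_def g_def)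
      then show ?thesis using G_conf[of k "(i, s)"] that by (simp add: X_def)
    qed
    \<comment> \<open>Only these sums run across layers; they are the \<open>Inr\<close> coordinates
      of \<mu>.\<close>
    have gu: "conf (\<Sum>k<l. g i j k) (\<Sum>k<l. x i j k)" if "i < r" "j < s" for i j
    proof -
      have P: "(i, j) \<in> P" using that by (simp add: P_def)
      have "(\<Sum>k<l. g i j k) = (\<Sum>h\<in>B. \<Sum>k<l. int (m h k) * h (i, j))"
        unfolding g_def G_def by (rule sum.swap)
      also have "\<dots> = (\<Sum>h\<in>B. \<mu> (Inl h) * h (i, j))"
        by (intro sum.cong) (auto simp: m_sum simp flip: sum_distrib_right)
      also have "\<dots> = \<mu> (Inr (i, j))" using \<mu>\<Lambda> P by (simp add: \<Lambda>_def)
      finally have "(\<Sum>k<l. g i j k) = \<mu> (Inr (i, j))" .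
      moreover have "\<nu> (Inr (i, j)) = (\<Sum>k<l. x i j k)" using that by (simp add: \<nu>_def X_def)
      ultimately show ?thesis using \<mu>(3)[OF P] by simp
    qed
    have norm: "(\<Sum>i<r. \<Sum>j<s. \<Sum>k<l. \<bar>g i j k\<bar>) \<le> int K"
    proof -
      have "(\<Sum>i<r. \<Sum>j<s. \<Sum>k<l. \<bar>g i j k\<bar>) = (\<Sum>p\<in>P. \<Sum>k<l. \<bar>G k p\<bar>)"
        by (simp add: P_def sum.cartesian_product' g_def)
      also have "\<dots> \<le> (\<Sum>p\<in>P. \<Sum>k<l. \<Sum>h\<in>B. int (m h k) * \<bar>h p\<bar>)"
        unfolding G_def by (intro sum_mono order_trans[OF sum_abs]) (simp add: abs_mult)
      also have "\<dots> = (\<Sum>p\<in>P. \<Sum>h\<in>B. \<Sum>k<l. int (m h k) * \<bar>h p\<bar>)"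
        by (intro sum.cong refl sum.swap)
      also have "\<dots> = (\<Sum>p\<in>P. \<Sum>h\<in>B. \<mu> (Inl h) * \<bar>h p\<bar>)"
        by (intro sum.cong refl) (auto simp: m_sum simp flip: sum_distrib_right)
      also have "\<dots> = (\<Sum>h\<in>B. \<Sum>p\<in>P. \<mu> (Inl h) * \<bar>h p\<bar>)" by (rule sum.swap)
      also have "\<dots> \<le> size \<mu>"
        unfolding size_def sum_distrib_left by (intro sum_mono mult_right_mono) auto
      also have "\<dots> \<le> (\<Sum>\<mu>\<in>C. size \<mu>)"
        using \<mu>(1) C(1) size_nonneg by (intro member_le_sum) auto
      also have "\<dots> \<le> int K" by (simp add: K_def)
      finally show ?thesis .
    qed
    obtain h0 where h0: "h0 \<in> B" "\<mu> (Inl h0) > 0" using \<mu>\<Lambda> by (auto simp: \<Lambda>_def)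
    obtain p0 where p0: "p0 \<in> P" "h0 p0 \<noteq> 0" using B(3) h0(1) by blast
    obtain k1 where k1: "k1 < l" "m h0 k1 > 0"
    proof -
      have "(\<Sum>k<l. m h0 k) \<noteq> 0" using m(2)[OF h0(1)] h0(2) by simp
      then show ?thesis using that by auto
    qed
    \<comment> \<open>The tables in layer \<open>k1\<close> do not cancel at \<open>p0\<close>, so a
      zero sum would make the contribution of \<open>h0\<close> vanish.\<close>
    have "G k1 p0 \<noteq> 0"
    proof
      assume G0: "G k1 p0 = 0"
      have "p0 \<in> bordered r s" using p0(1) by (auto simp: P_def)
      have mn: "conf (int (m h k1) * h p0) (int (n k1 h) * h p0)" if "h \<in> B" for h
        using m(1)[OF that k1(1)] by (rule conf_mult)
      from same_sign[OF \<open>p0 \<in> bordered r s\<close>, of k1]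
      have "(\<forall>h\<in>B. 0 \<le> int (m h k1) * h p0) \<or> (\<forall>h\<in>B. int (m h k1) * h p0 \<le> 0)"
      proof (elim disjE, goal_cases)
        case 1
        then have "\<forall>h\<in>B. 0 \<le> int (m h k1) * h p0" using mn unfolding conf_def by (meson order_trans)
        then show ?case by blast
      next
        case 2
        then have "\<forall>h\<in>B. int (m h k1) * h p0 \<le> 0" using mn unfolding conf_def by (meson order_trans)
        then show ?case by blast
      qed
      from sum_same_sign_eq_0[OF B(1) this G0[unfolded G_def] h0(1)]
      show False using k1(2) p0(2) by simp
    qed
    then have "\<exists>i<r. \<exists>j<s. \<exists>k<l. g i j k \<noteq> 0"
      using p0(1) k1(1) by (auto simp: P_def g_def)
    then show "\<exists>g. (\<exists>i<r. \<exists>j<s. \<exists>k<l. g i j k \<noteq> 0) \<and>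
        (\<Sum>i<r. \<Sum>j<s. \<Sum>k<l. \<bar>g i j k\<bar>) \<le> int K \<and>
        conform3 r s l g x"
      using gx gw gv gu norm by (intro exI[of _ g]) (auto simp: conform3_def)
  qed
qed

section \<open>Penalized objective\<close>

lemma mult_add_less:
  fixes i j :: nat
  assumes "i < a" "j < b"
  shows "i * b + j < a * b"
proof -
  have "i * b + j < Suc i * b" using assms by simp
  also have "\<dots> \<le> a * b" using assms by (intro mult_right_mono) auto
  finally show ?thesis .
qed

lemma mult_add_eq_iff:
  fixes i j :: nat
  assumes "j < b" "j' < b"
  shows "i * b + j = i' * b + j' \<longleftrightarrow> i = i' \<and> j = j'"
proof
  assume "i * b + j = i' * b + j'"
  then have "(i * b + j) div b = (i' * b + j') div b" "(i * b + j) mod b = (i' * b + j') mod b" by simp_all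
  then show "i = i' \<and> j = j'" using assms by simp
qed auto

lemma sum_flatten2:
  fixes f :: "nat \<Rightarrow> 'a :: comm_monoid_add"
  shows "(\<Sum>p<a * b. f p) = (\<Sum>i<a. \<Sum>j<b. f (i * b + j))"
proof -
  have "(\<Sum>p<a * b. f p) = (\<Sum>i<a. sum f {i * b..<i * b + b})"
    by (simp add: sum.nat_group)
  also have "\<dots> = (\<Sum>i<a. \<Sum>j<b. f (i * b + j))"
    by (rule sum.cong[OF refl])
      (use sum.shift_bounds_nat_ivl[of f 0 "i * b" b for i] in \<open>simp add: lessThan_atLeast0 add.commute\<close>)
  finally show ?thesis .
qed

lemma sum_flatten3:
  fixes f :: "nat \<Rightarrow> 'a :: comm_monoid_add"
  shows "(\<Sum>p<a * b * d. f p) = (\<Sum>i<a. \<Sum>j<b. \<Sum>k<d. f ((i * b + j) * d + k))"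
  by (simp add: sum_flatten2)

text \<open>
  Entry \<open>(i, j, k)\<close>, counted from 0, sits at position \<open>(i * s + j) * l + k\<close>; the lines are
  numbered with the \<open>u\<close>-sums first, then the \<open>v\<close>-sums, then the \<open>w\<close>-sums.
\<close>

definition hits :: "nat \<Rightarrow> nat \<Rightarrow> nat \<Rightarrow> nat \<Rightarrow> nat \<Rightarrow> int" where
  "hits r s l p t = of_bool (p div l = t) + of_bool (r * s + p div (s * l) * l + p mod l = t) +
     of_bool (r * s + r * l + p mod (s * l) = t)"

definition line :: "nat \<Rightarrow> nat \<Rightarrow> nat \<Rightarrow> (nat \<Rightarrow> int) \<Rightarrow> nat \<Rightarrow> int" where
  "line r s l x t = (\<Sum>p<r * s * l. hits r s l p t * x p)"

abbreviation nlines :: "nat \<Rightarrow> nat \<Rightarrow> nat \<Rightarrow> nat" where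
  "nlines r s l \<equiv> r * s + r * l + s * l"

lemma hits_flat:
  assumes "i < r" "j < s" "k < l"
  shows "hits r s l ((i * s + j) * l + k) t =
    of_bool (i * s + j = t) + of_bool (r * s + i * l + k = t) + of_bool (r * s + r * l + (j * l + k) = t)"
proof -
  have "j * l + k < s * l" using assms by (intro mult_add_less)
  moreover have "(i * s + j) * l + k = i * (s * l) + (j * l + k)" by (simp add: algebra_simps)
  moreover have "(i * q + t) div q = i \<and> (i * q + t) mod q = t" if "t < q" for q t
    using that by auto
  ultimately have "((i * s + j) * l + k) div (s * l) = i" "((i * s + j) * l + k) mod (s * l) = j * l + k"
    by metis+
  then show ?thesis using assms by (simp add: hits_def)
qed

text \<open>Only positions with matching coordinates survive in the sum; the other two incidence
  conditions fail because the three kinds of lines occupy disjoint ranges of numbers. The same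
  argument gives \<open>line_v\<close> and \<open>line_w\<close>.\<close>

lemma line_u:
  assumes "i < r" "j < s"
  shows "line r s l x (i * s + j) = (\<Sum>k<l. x ((i * s + j) * l + k))"
proof -
  have lt: "i * s + j < r * s" using assms by (rule mult_add_less)
  have "line r s l x (i * s + j) = (\<Sum>i'<r. \<Sum>j'<s. \<Sum>k<l. hits r s l ((i' * s + j') * l + k) (i * s + j) * x ((i' * s + j') * l + k))"
    by (simp add: line_def sum_flatten3)
  also have "\<dots> = (\<Sum>i'<r. \<Sum>j'<s. \<Sum>k<l. if i' = i then if j' = j then x ((i * s + j) * l + k) else 0 else 0)"
    using lt assms by (intro sum.cong refl) (auto simp: hits_flat mult_add_eq_iff)
  also have "\<dots> = (\<Sum>i'<r. if i' = i then \<Sum>j'<s. \<Sum>k<l. if j' = j then x ((i * s + j) * l + k) else 0 else 0)"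
    by (intro sum.cong refl) auto
  finally show ?thesis using assms by (simp, subst sum.swap, simp)
qed

lemma line_v:
  assumes "i < r" "k < l"
  shows "line r s l x (r * s + i * l + k) = (\<Sum>j<s. x ((i * s + j) * l + k))"
proof -
  have lt: "i * l + k < r * l" using assms by (rule mult_add_less)
  have "line r s l x (r * s + i * l + k) = (\<Sum>i'<r. \<Sum>j<s. \<Sum>k'<l. hits r s l ((i' * s + j) * l + k') (r * s + i * l + k) * x ((i' * s + j) * l + k'))"
    by (simp add: line_def sum_flatten3)
  also have "\<dots> = (\<Sum>i'<r. \<Sum>j<s. \<Sum>k'<l. if i' = i then if k' = k then x ((i * s + j) * l + k) else 0 else 0)"
  proof (intro sum.cong refl)
    fix i' j k' assume *: "i' \<in> {..<r}" "j \<in> {..<s}" "k' \<in> {..<l}"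
    then have "i' * s + j < r * s" by (intro mult_add_less) auto
    then show "hits r s l ((i' * s + j) * l + k') (r * s + i * l + k) * x ((i' * s + j) * l + k') =
      (if i' = i then if k' = k then x ((i * s + j) * l + k) else 0 else 0)"
      using lt assms * mult_add_eq_iff[of k l k' i i'] by (auto simp: hits_flat)
  qed
  also have "\<dots> = (\<Sum>i'<r. if i' = i then \<Sum>j<s. \<Sum>k'<l. if k' = k then x ((i * s + j) * l + k) else 0 else 0)"
    by (intro sum.cong refl) auto
  finally show ?thesis using assms by simp
qed

lemma line_w:
  assumes "j < s" "k < l"
  shows "line r s l x (r * s + r * l + (j * l + k)) = (\<Sum>i<r. x ((i * s + j) * l + k))"
proof -
  have "line r s l x (r * s + r * l + (j * l + k)) = (\<Sum>i<r. \<Sum>j'<s. \<Sum>k'<l. hits r s l ((i * s + j') * l + k') (r * s + r * l + (j * l + k)) * x ((i * s + j') * l + k'))"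
    by (simp add: line_def sum_flatten3)
  also have "\<dots> = (\<Sum>i<r. \<Sum>j'<s. \<Sum>k'<l. if j' = j then if k' = k then x ((i * s + j) * l + k) else 0 else 0)"
  proof (intro sum.cong refl)
    fix i j' k' assume *: "i \<in> {..<r}" "j' \<in> {..<s}" "k' \<in> {..<l}"
    then have "i * s + j' < r * s" "i * l + k' < r * l" by (auto intro: mult_add_less)
    then show "hits r s l ((i * s + j') * l + k') (r * s + r * l + (j * l + k)) * x ((i * s + j') * l + k') =
      (if j' = j then if k' = k then x ((i * s + j) * l + k) else 0 else 0)"
      using assms * mult_add_eq_iff[of k l k' j j'] by (auto simp: hits_flat)
  qed
  also have "\<dots> = (\<Sum>i<r. \<Sum>j'<s. if j' = j then \<Sum>k'<l. if k' = k then x ((i * s + j) * l + k) else 0 else 0)"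
    by (intro sum.cong refl) auto
  finally show ?thesis using assms by simp
qed

lemma line_cases:
  assumes "t < nlines r s l"
  obtains (u) i j where "i < r" "j < s" "t = i * s + j"
  | (v) i k where "i < r" "k < l" "t = r * s + i * l + k"
  | (w) j k where "j < s" "k < l" "t = r * s + r * l + (j * l + k)"
proof -
  have *: "\<exists>i j. i < a \<and> j < b \<and> q = i * b + j" if "q < a * b" for q a b :: nat
  proof -
    have "b > 0" using that by (cases b) auto
    moreover have "q div b < a" using that by (simp add: less_mult_imp_div_less)
    ultimately show ?thesis
      by (intro exI[of _ "q div b"] exI[of _ "q mod b"]) auto
  qed
  consider "t < r * s" | "t \<ge> r * s" "t - r * s < r * l" | "t \<ge> r * s + r * l" "t - (r * s + r * l) < s * l"
    using assms by linarith
  then show ?thesis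
  proof cases
    case 1
    then show ?thesis using *[OF 1] u by blast
  next
    case 2
    from *[OF 2(2)] obtain i k where "i < r" "k < l" "t - r * s = i * l + k" by blast
    moreover from this have "t = r * s + i * l + k" using 2(1) by simp
    ultimately show ?thesis using v by blast
  next
    case 3
    from *[OF 3(2)] obtain j k where "j < s" "k < l" "t - (r * s + r * l) = j * l + k" by blast
    moreover from this have "t = r * s + r * l + (j * l + k)" using 3(1) by linarith
    ultimately show ?thesis using w by blast
  qed
qed

lemma line_linear:
  "line r s l (\<lambda>p. x p + y p) t = line r s l x t + line r s l y t"
  "line r s l (\<lambda>p. x p - y p) t = line r s l x t - line r s l y t"
  "line r s l (\<lambda>p. a * x p) t = a * line r s l x t"
  by (simp_all add: line_def algebra_simps sum.distrib sum_subtractf sum_distrib_left)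

lemma line_cong:
  "(\<And>p. p < r * s * l \<Longrightarrow> x p = y p) \<Longrightarrow> line r s l x t = line r s l y t"
  by (simp add: line_def)

definition conform :: "nat \<Rightarrow> nat \<Rightarrow> nat \<Rightarrow> (nat \<Rightarrow> int) \<Rightarrow> (nat \<Rightarrow> int) \<Rightarrow> bool" where
  "conform r s l g x \<longleftrightarrow> (\<forall>p<r * s * l. conf (g p) (x p)) \<and>
     (\<forall>t<nlines r s l. conf (line r s l g t) (line r s l x t))"

lemma conform_trans: "conform r s l x y \<Longrightarrow> conform r s l y z \<Longrightarrow> conform r s l x z"
  using conf_trans unfolding conform_def by blast

lemma conform_diff: "conform r s l g x \<Longrightarrow> conform r s l (\<lambda>p. x p - g p) x"
  by (simp add: conform_def line_linear conf_diff)

text \<open>In each coordinate \<open>g\<close> lies between 0 and \<open>x - g\<close>, hence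
  \<open>2 * g\<close> between 0 and \<open>x\<close>. Used in the contrapositive: if doubling
  \<open>g\<close> destroys conformity to \<open>x\<close>, then \<open>g\<close> does not conform
  to the remainder.\<close>

lemma conform_double:
  assumes "conform r s l g x" "conform r s l g (\<lambda>p. x p - g p)"
  shows "conform r s l (\<lambda>p. 2 * g p) x"
  using assms unfolding conform_def line_linear by (fastforce simp: conf_def)

lemma graver_bound_flat:
  "\<exists>K. \<forall>l d. (\<exists>p<r * s * l. d p \<noteq> 0) \<longrightarrow>
     (\<exists>g. (\<exists>p<r * s * l. g p \<noteq> 0) \<and> (\<Sum>p<r * s * l. \<bar>g p\<bar>) \<le> int K \<and> conform r s l g d)"
proof -
  obtain K where K: "\<And>l (x :: nat \<Rightarrow> nat \<Rightarrow> nat \<Rightarrow> int). (\<exists>i<r. \<exists>j<s. \<exists>k<l. x i j k \<noteq> 0) \<Longrightarrow>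
     (\<exists>g. (\<exists>i<r. \<exists>j<s. \<exists>k<l. g i j k \<noteq> 0) \<and>
        (\<Sum>i<r. \<Sum>j<s. \<Sum>k<l. \<bar>g i j k\<bar>) \<le> int K \<and>
        conform3 r s l g x)"
    using graver_bound[of r s] by blast
  show ?thesis
  proof (intro exI[of _ K] allI impI)
    fix l and d :: "nat \<Rightarrow> int"
    assume d: "\<exists>p<r * s * l. d p \<noteq> 0"
    have pos: "\<exists>i j k. i < r \<and> j < s \<and> k < l \<and> p = (i * s + j) * l + k" if "p < r * s * l" for p
    proof -
      have "l > 0" "s > 0" using that by (auto intro: gr0I)
      moreover have "p div l < r * s" using that by (simp add: less_mult_imp_div_less)
      moreover from this have "p div l div s < r" by (simp add: less_mult_imp_div_less)
      ultimately show ?thesis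
        by (intro exI[of _ "p div l div s"] exI[of _ "p div l mod s"] exI[of _ "p mod l"]) auto
    qed
    have "\<exists>i<r. \<exists>j<s. \<exists>k<l. d ((i * s + j) * l + k) \<noteq> 0"
      using d pos by metis
    from K[OF this] obtain g0 where g0: "\<exists>i<r. \<exists>j<s. \<exists>k<l. g0 i j k \<noteq> 0"
        "(\<Sum>i<r. \<Sum>j<s. \<Sum>k<l. \<bar>g0 i j k\<bar>) \<le> int K"
        "\<forall>i<r. \<forall>j<s. \<forall>k<l. conf (g0 i j k) (d ((i * s + j) * l + k))"
        "\<forall>j<s. \<forall>k<l. conf (\<Sum>i<r. g0 i j k) (\<Sum>i<r. d ((i * s + j) * l + k))"
        "\<forall>i<r. \<forall>k<l. conf (\<Sum>j<s. g0 i j k) (\<Sum>j<s. d ((i * s + j) * l + k))"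
        "\<forall>i<r. \<forall>j<s. conf (\<Sum>k<l. g0 i j k) (\<Sum>k<l. d ((i * s + j) * l + k))"
      unfolding conform3_def by - (erule exE, (erule conjE)+, (rule that; assumption))
    define g where "g p = g0 (p div l div s) (p div l mod s) (p mod l)" for p
    have g_flat: "g ((i * s + j) * l + k) = g0 i j k" if "j < s" "k < l" for i j k
      using that by (simp add: g_def)
    have lt: "(i * s + j) * l + k < r * s * l" if "i < r" "j < s" "k < l" for i j k
      using that by (intro mult_add_less) auto
    have "\<exists>p<r * s * l. g p \<noteq> 0" using g0(1) g_flat lt by metis
    moreover have "(\<Sum>p<r * s * l. \<bar>g p\<bar>) \<le> int K"
      using g0(2) by (simp add: sum_flatten3 g_flat)
    moreover have "conf (g p) (d p)" if "p < r * s * l" for p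
      using pos[OF that] g0(3) g_flat by metis
    moreover have "conf (line r s l g t) (line r s l d t)" if "t < nlines r s l" for t
      using that
    proof (cases t rule: line_cases)
      case (u i j)
      then show ?thesis using g0(6) by (simp add: line_u g_flat)
    next
      case (v i k)
      then show ?thesis using g0(5) by (simp add: line_v g_flat)
    next
      case (w j k)
      then show ?thesis using g0(4) by (simp add: line_w g_flat)
    qed
    ultimately show "\<exists>g. (\<exists>p<r * s * l. g p \<noteq> 0) \<and> (\<Sum>p<r * s * l. \<bar>g p\<bar>) \<le> int K \<and> conform r s l g d"
      by (auto simp: conform_def)
  qed
qed

section \<open>Convexity of the penalized objective\<close>

definition excess :: "nat \<Rightarrow> nat \<Rightarrow> nat \<Rightarrow> (nat \<Rightarrow> int) \<Rightarrow> (nat \<Rightarrow> int) \<Rightarrow> int" where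
  "excess r s l b x = (\<Sum>p<r * s * l. max 0 (- x p)) + (\<Sum>t<nlines r s l. \<bar>b t - line r s l x t\<bar>)"

definition penalized :: "nat \<Rightarrow> nat \<Rightarrow> nat \<Rightarrow> (nat \<Rightarrow> int) \<Rightarrow> (nat \<Rightarrow> int) \<Rightarrow> int \<Rightarrow> (nat \<Rightarrow> int) \<Rightarrow> int" where
  "penalized r s l c b \<beta> x = (\<Sum>p<r * s * l. c p * x p) + \<beta> * excess r s l b x"

lemma penalized_cong:
  assumes "\<And>p. p < r * s * l \<Longrightarrow> x p = y p"
  shows "penalized r s l c b \<beta> x = penalized r s l c b \<beta> y"
  using assms line_cong[of r s l x y] by (simp add: penalized_def excess_def)

text \<open>A convex function \<open>f\<close> of one variable satisfies
  \<open>f (x + g) + f (x + (d - g)) \<le> f (x + d) + f x\<close> for \<open>g\<close> between 0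
  and \<open>d\<close>. This is applied to every entry and every line sum, which is why
  \<open>conform\<close> constrains both.\<close>

lemma excess_superadd:
  assumes "conform r s l g d"
  shows "excess r s l b (\<lambda>p. x p + g p) + excess r s l b (\<lambda>p. x p + (d p - g p)) \<le>
    excess r s l b (\<lambda>p. x p + d p) + excess r s l b x"
proof -
  have "(\<Sum>p<r * s * l. max 0 (- (x p + g p)) + max 0 (- (x p + (d p - g p)))) \<le>
    (\<Sum>p<r * s * l. max 0 (- (x p + d p)) + max 0 (- x p))"
    using assms by (intro sum_mono) (fastforce simp: conform_def conf_def)
  moreover have "(\<Sum>t<nlines r s l. \<bar>b t - line r s l (\<lambda>p. x p + g p) t\<bar> + \<bar>b t - line r s l (\<lambda>p. x p + (d p - g p)) t\<bar>) \<le>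
    (\<Sum>t<nlines r s l. \<bar>b t - line r s l (\<lambda>p. x p + d p) t\<bar> + \<bar>b t - line r s l x t\<bar>)"
    using assms unfolding line_linear by (intro sum_mono) (fastforce simp: conform_def conf_def)
  ultimately show ?thesis by (simp add: excess_def sum.distrib)
qed

lemma penalized_superadd:
  assumes "conform r s l g d" "0 \<le> \<beta>"
  shows "penalized r s l c b \<beta> (\<lambda>p. x p + g p) + penalized r s l c b \<beta> (\<lambda>p. x p + (d p - g p)) \<le>
    penalized r s l c b \<beta> (\<lambda>p. x p + d p) + penalized r s l c b \<beta> x"
proof -
  have "(\<Sum>p<r * s * l. c p * (x p + g p)) + (\<Sum>p<r * s * l. c p * (x p + (d p - g p))) =
    (\<Sum>p<r * s * l. c p * (x p + d p)) + (\<Sum>p<r * s * l. c p * x p)"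
    by (simp add: algebra_simps flip: sum.distrib)
  moreover note mult_left_mono[OF excess_superadd[OF assms(1)] assms(2), of b x, unfolded distrib_left]
  ultimately show ?thesis unfolding penalized_def by linarith
qed

text \<open>
  Subtracting the largest power-of-two multiple of a move that still conforms to \<open>d\<close> excludes this
  pair \<open>(i, a)\<close> for the rest of the decomposition, so no pair is used twice.
\<close>

lemma penalized_gap:
  fixes move :: "'a \<Rightarrow> nat \<Rightarrow> int"
  assumes "finite A" "0 \<le> \<beta>" "0 \<le> \<delta>"
    and move: "\<And>d. \<exists>p<r * s * l. d p \<noteq> 0 \<Longrightarrow> \<exists>a\<in>A. (\<exists>p<r * s * l. move a p \<noteq> 0) \<and> conform r s l (move a) d"
    and best: "\<And>i a. i < L \<Longrightarrow> a \<in> A \<Longrightarrow>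
      penalized r s l c b \<beta> x - \<delta> \<le> penalized r s l c b \<beta> (\<lambda>p. x p + 2 ^ i * move a p)"
    and "\<And>p. p < r * s * l \<Longrightarrow> \<bar>d p\<bar> < 2 ^ L"
  shows "penalized r s l c b \<beta> x - int (L * card A) * \<delta> \<le> penalized r s l c b \<beta> (\<lambda>p. x p + d p)"
proof -
  let ?F = "penalized r s l c b \<beta>" and ?n = "r * s * l"
  \<comment> \<open>The pairs that can still occur in a decomposition of \<open>d\<close>. Their
    number replaces \<open>L * card A\<close> in the claim and is the induction measure.\<close>
  define P where "P d = {(i, a) \<in> {..<L} \<times> A. (\<exists>p<?n. move a p \<noteq> 0) \<and> conform r s l (\<lambda>p. 2 ^ i * move a p) d}" for d
  have finP: "finite (P d)" for d
    by (rule finite_subset[of _ "{..<L} \<times> A"]) (use assms(1) in \<open>auto simp: P_def\<close>)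
  have "?F x - int (card (P d)) * \<delta> \<le> ?F (\<lambda>p. x p + d p)"
    using assms(6)
  proof (induction "card (P d)" arbitrary: d rule: less_induct)
    case less
    show ?case
    proof (cases "\<exists>p<?n. d p \<noteq> 0")
      case False
      then have "?F (\<lambda>p. x p + d p) = ?F x" by (intro penalized_cong) auto
      then show ?thesis using assms(3) by simp
    next
      case True
      from move[OF this] obtain a where a: "a \<in> A" "\<exists>p<?n. move a p \<noteq> 0" "conform r s l (move a) d" by blast
      \<comment> \<open>With \<open>i \<ge> L\<close> a nonzero entry of \<open>move a\<close> would
        be scaled to at least \<open>2 ^ L\<close>, beyond every entry of \<open>d\<close>.\<close>
      have iL: "i < L" if "conform r s l (\<lambda>p. 2 ^ i * move a p) d" for i
      proof (rule ccontr)
        assume "\<not> i < L"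
        then have i: "(2 :: int) ^ L \<le> 2 ^ i" by simp
        obtain p where p: "p < ?n" "move a p \<noteq> 0" using a(2) by blast
        then have "conf (2 ^ i * move a p) (d p)" using that by (simp add: conform_def)
        then have "\<bar>2 ^ i * move a p\<bar> \<le> \<bar>d p\<bar>" by (auto simp: conf_def)
        moreover have "2 ^ i * 1 \<le> 2 ^ i * \<bar>move a p\<bar>" using p(2) by (intro mult_left_mono) auto
        moreover have "\<bar>2 ^ i * move a p\<bar> = 2 ^ i * \<bar>move a p\<bar>" by (simp add: abs_mult)
        ultimately have "2 ^ L \<le> \<bar>d p\<bar>" using i by linarith
        then show False using less.prems[OF p(1)] by simp
      qed
      define I where "I = {i. conform r s l (\<lambda>p. 2 ^ i * move a p) d}"
      have "finite I" by (rule finite_subset[of _ "{..<L}"]) (use iL in \<open>auto simp: I_def\<close>)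
      moreover have "0 \<in> I" using a(3) by (simp add: I_def)
      ultimately obtain i where i: "i \<in> I" "Suc i \<notin> I"
        using Max_in[of I] Max_ge[of I "Suc (Max I)"] by fastforce
      define g where "g = (\<lambda>p. 2 ^ i * move a p)"
      define d' where "d' = (\<lambda>p. d p - g p)"
      have g: "conform r s l g d" using i(1) by (simp add: I_def g_def)
      have d': "conform r s l d' d" using conform_diff[OF g] by (simp add: d'_def)
      have "\<not> conform r s l g d'"
      proof
        assume "conform r s l g d'"
        then have "conform r s l (\<lambda>p. 2 * g p) d" using conform_double[OF g] by (simp add: d'_def)
        then show False using i(2) by (simp add: I_def g_def mult.assoc)
      qed
      then have "(i, a) \<notin> P d'" by (simp add: P_def g_def)
      moreover have in_P: "(i, a) \<in> P d" using a(1,2) g iL by (simp add: P_def g_def)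
      moreover have "P d' \<subseteq> P d" using conform_trans[OF _ d'] by (auto simp: P_def)
      ultimately have card: "card (P d') < card (P d)" using finP by (intro psubset_card_mono) auto
      have "\<bar>d' p\<bar> < 2 ^ L" if "p < ?n" for p
      proof -
        have "conf (d' p) (d p)" using d' that by (simp add: conform_def)
        then show ?thesis using less.prems[OF that] by (auto simp: conf_def)
      qed
      from less.hyps[OF card this] have IH: "?F x - int (card (P d')) * \<delta> \<le> ?F (\<lambda>p. x p + (d p - g p))"
        by (simp add: d'_def)
      \<comment> \<open>\<open>best\<close> limits the gain of the single step \<open>g\<close> to
        \<delta>; superadditivity bounds the gain of \<open>d\<close> by that of \<open>g\<close>
        plus that of the remainder.\<close>
      have "?F x - \<delta> \<le> ?F (\<lambda>p. x p + g p)"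
        using best[OF _ a(1), of i] in_P by (simp add: P_def g_def)
      with IH penalized_superadd[OF g assms(2), of c b x]
      have "?F x - int (Suc (card (P d'))) * \<delta> \<le> ?F (\<lambda>p. x p + d p)" by (simp add: algebra_simps)
      moreover have "int (Suc (card (P d'))) * \<delta> \<le> int (card (P d)) * \<delta>"
        using card assms(3) by (intro mult_right_mono) auto
      ultimately show ?thesis by linarith
    qed
  qed
  moreover have "card (P d) \<le> card ({..<L} \<times> A)"
    using assms(1) by (intro card_mono) (auto simp: P_def)
  then have "int (card (P d)) * \<delta> \<le> int (L * card A) * \<delta>"
    using assms(3) by (intro mult_right_mono) (auto simp: card_cartesian_product simp flip: of_nat_mult)
  ultimately show ?thesis by linarith
qed

section \<open>Moves, convergence and correctness\<close>

text \<open>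
  A move is coded by \<open>K\<close> digits in base \<open>M\<close>: the digit \<open>d\<close> adds \<open>(-1) ^ d\<close> to entry
  \<open>d div 2\<close>.  With \<open>M = 2 * n + 2\<close> the digit \<open>2 * n\<close> changes none of the \<open>n\<close> entries, so that
  moves of norm less than \<open>K\<close> have a code as well.
\<close>

fun move :: "nat \<Rightarrow> nat \<Rightarrow> nat \<Rightarrow> nat \<Rightarrow> int" where
  "move M 0 a p = 0"
| "move M (Suc K) a p = (if p = a mod M div 2 then 1 - 2 * int (a mod M mod 2) else 0) + move M K (a div M) p"

lemma abs_move_le: "\<bar>move M K a p\<bar> \<le> int K"
proof (induction K arbitrary: a)
  case (Suc K)
  have "\<bar>if p = a mod M div 2 then 1 - 2 * int (a mod M mod 2) else 0\<bar> \<le> 1"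
    by (cases "a mod M mod 2 = 0") auto
  with Suc[of "a div M"] show ?case by simp
qed simp

text \<open>Each digit takes one unit off a nonzero entry of \<open>g\<close> and so lowers the norm
  by one; once \<open>g\<close> is zero, the neutral digit fills the remaining places.\<close>

lemma move_onto:
  assumes "(\<Sum>p<n. \<bar>g p\<bar>) \<le> int K" "M = 2 * n + 2"
  shows "\<exists>a<M ^ K. \<forall>p<n. move M K a p = g p"
  using assms(1)
proof (induction K arbitrary: g)
  case 0
  then have "(\<Sum>p<n. \<bar>g p\<bar>) = 0" by (intro antisym sum_nonneg) auto
  then have "\<forall>p<n. g p = 0" by (simp add: sum_nonneg_eq_0_iff)
  then show ?case by simp
next
  case (Suc K)
  have code: "\<exists>a<M ^ Suc K. \<forall>p<n. move M (Suc K) a p = g p"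
    if "d < M" "a' < M ^ K"
      "\<forall>p<n. (if p = d div 2 then 1 - 2 * int (d mod 2) else 0) + move M K a' p = g p" for d a'
  proof (intro exI[of _ "a' * M + d"] conjI)
    have "a' * M + d < M ^ K * M" using that(1,2) by (intro mult_add_less)
    then show "a' * M + d < M ^ Suc K" by (simp add: mult.commute)
    show "\<forall>p<n. move M (Suc K) (a' * M + d) p = g p"
    proof (intro allI impI)
      fix p assume "p < n"
      with that(3) have "(if p = d div 2 then 1 - 2 * int (d mod 2) else 0) + move M K a' p = g p" by blast
      then show "move M (Suc K) (a' * M + d) p = g p" using that(1) by (auto split: if_splits)
    qed
  qed
  show ?case
  proof (cases "\<forall>p<n. g p = 0")
    case True
    then have "(\<Sum>p<n. \<bar>g p\<bar>) \<le> int K" by simp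
    from Suc.IH[OF this] obtain a where a: "a < M ^ K" "\<forall>p<n. move M K a p = g p" by blast
    have "2 * n < M" using assms(2) by simp
    from code[OF this a(1)] a(2) show ?thesis by simp
  next
    case False
    then obtain q where q: "q < n" "g q \<noteq> 0" by blast
    \<comment> \<open>The low bit of the digit: 0 stands for adding 1, 1 for subtracting 1, so the
      rest of entry \<open>q\<close> is closer to 0.\<close>
    define e :: nat where "e = (if g q > 0 then 0 else 1)"
    define g' where "g' = g(q := g q - (1 - 2 * int e))"
    have "\<bar>g' q\<bar> = \<bar>g q\<bar> - 1" using q(2) by (auto simp: g'_def e_def)
    then have "\<bar>g' p\<bar> = \<bar>g p\<bar> - (if p = q then 1 else 0)" for p by (auto simp: g'_def)
    then have "(\<Sum>p<n. \<bar>g' p\<bar>) = (\<Sum>p<n. \<bar>g p\<bar>) - 1"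
      using q(1) by (simp add: sum_subtractf)
    then have "(\<Sum>p<n. \<bar>g' p\<bar>) \<le> int K" using Suc.prems by simp
    from Suc.IH[OF this] obtain a where a: "a < M ^ K" "\<forall>p<n. move M K a p = g' p" by blast
    have "e < 2" by (simp add: e_def)
    then have e: "(2 * q + e) div 2 = q" "(2 * q + e) mod 2 = e" by auto
    have "2 * q + e < M" using assms(2) q(1) by (auto simp: e_def)
    from code[OF this a(1)] a(2) show ?thesis unfolding e by (simp add: g'_def)
  qed
qed

section \<open>Number of improvement rounds\<close>

text \<open>An integer form of \<open>(1 - 1 / N) ^ N \<le> 1 / 2\<close>: with
  \<open>a = N - 1\<close>, the two leading terms of the binomial expansion of
  \<open>(a + 1) ^ N\<close> already give \<open>2 * a ^ N \<le> N ^ N\<close>. After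
  \<open>N * L\<close> rounds a gap that was below \<open>2 ^ L\<close> is below 1, and gaps are
  integers.\<close>

lemma geometric_decrease:
  fixes gap gap0 :: int and N L :: nat
  assumes "N > 0" "L > 0" "0 \<le> gap" "gap0 < 2 ^ L"
    and le: "int N ^ (N * L) * gap \<le> (int N - 1) ^ (N * L) * gap0"
  shows "gap = 0"
proof (rule ccontr)
  assume "gap \<noteq> 0"
  then have "1 \<le> gap" using assms(3) by simp
  then have "int N ^ (N * L) * 1 \<le> int N ^ (N * L) * gap" by (intro mult_left_mono) auto
  with le have *: "int N ^ (N * L) \<le> (int N - 1) ^ (N * L) * gap0" by linarith
  show False
  \<comment> \<open>For \<open>N = 1\<close> the base \<open>a\<close> is 0, whereas the strict
    inequality at the end needs \<open>0 < a\<close>.\<close>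
  proof (cases "N = 1")
    case True
    then show False using * assms(2) by (simp add: power_0_left)
  next
    case False
    define a where "a = int N - 1"
    have a: "a \<ge> 1" "int N = a + 1" using False assms(1) by (auto simp: a_def)
    have pos: "0 < a ^ (N * L)" using a(1) by simp
    have "a ^ N + int N * a ^ (N - 1) \<le> int N ^ N"
    proof -
      have "(\<Sum>k\<in>{N - 1, N}. of_nat (N choose k) * a ^ k * 1 ^ (N - k)) \<le> (\<Sum>k\<le>N. of_nat (N choose k) * a ^ k * 1 ^ (N - k))"
        using a(1) by (intro sum_mono2) auto
      also have "\<dots> = int N ^ N" unfolding a(2) by (simp add: binomial_ring)
      also have "(\<Sum>k\<in>{N - 1, N}. of_nat (N choose k) * a ^ k * 1 ^ (N - k)) = a ^ N + int N * a ^ (N - 1)"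
        using assms(1) binomial_symmetric[of "N - 1" N] by (cases N) auto
      finally show ?thesis .
    qed
    moreover have "a ^ N \<le> int N * a ^ (N - 1)"
    proof -
      have "a ^ N = a * a ^ (N - 1)" using assms(1) by (cases N) auto
      also have "\<dots> \<le> int N * a ^ (N - 1)" using a by (intro mult_right_mono) auto
      finally show ?thesis .
    qed
    ultimately have "2 * a ^ N \<le> int N ^ N" by linarith
    then have "(2 * a ^ N) ^ L \<le> (int N ^ N) ^ L" using a(1) by (intro power_mono) auto
    then have "2 ^ L * a ^ (N * L) \<le> int N ^ (N * L)" by (simp add: power_mult_distrib power_mult)
    moreover have "a ^ (N * L) * gap0 < a ^ (N * L) * 2 ^ L" using pos assms(4) by simp
    ultimately show False using * by (simp add: a_def mult.commute)
  qed
qed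

section \<open>Size of the minimum and of the arrays visited\<close>

text \<open>\<open>S\<close> is one bound for all data; the program uses 2 plus the sum of the
  absolute values of the input. The 2 yields \<open>2 * S \<le> S * S\<close> and
  \<open>4 * S \<le> S * S * S\<close>.\<close>

locale search =
  fixes r s l :: nat and c b :: "nat \<Rightarrow> int" and S :: int
  assumes S2: "2 \<le> S"
    and c_le: "p < r * s * l \<Longrightarrow> \<bar>c p\<bar> \<le> S"
    and b_le: "(\<Sum>t<nlines r s l. \<bar>b t\<bar>) \<le> S"
begin

abbreviation "n \<equiv> r * s * l"
abbreviation "F \<equiv> penalized r s l c b (4 * S * S)"
abbreviation "E \<equiv> excess r s l b"

lemma excess_nonneg: "0 \<le> E x"
  by (simp add: excess_def sum_nonneg)

text \<open>The sum of all entries is the sum of the \<open>u\<close>-lines, hence at most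
  \<open>S\<close> plus the line errors. Passing to absolute values adds twice the negative parts;
  both kinds of error are counted in \<open>E x\<close>.\<close>

lemma norm_le: "(\<Sum>p<n. \<bar>x p\<bar>) \<le> S + 2 * E x"
proof -
  define W where "W = (\<Sum>t<nlines r s l. \<bar>b t - line r s l x t\<bar>)"
  have "(\<Sum>p<n. x p) = (\<Sum>t<r * s. line r s l x t)"
    by (simp add: sum_flatten2 line_u)
  also have "\<dots> \<le> (\<Sum>t<r * s. \<bar>b t\<bar> + \<bar>b t - line r s l x t\<bar>)"
    by (intro sum_mono) linarith
  also have "\<dots> \<le> (\<Sum>t<nlines r s l. \<bar>b t\<bar> + \<bar>b t - line r s l x t\<bar>)"
    by (intro sum_mono2) auto
  also have "\<dots> \<le> S + W" using b_le by (simp add: sum.distrib W_def)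
  finally have "(\<Sum>p<n. x p) \<le> S + W" .
  moreover have "(\<Sum>p<n. \<bar>x p\<bar>) = (\<Sum>p<n. x p + 2 * max 0 (- x p))"
    by (intro sum.cong) auto
  then have "(\<Sum>p<n. \<bar>x p\<bar>) = (\<Sum>p<n. x p) + 2 * (\<Sum>p<n. max 0 (- x p))"
    by (simp add: sum.distrib sum_distrib_left)
  moreover have "0 \<le> W" by (simp add: W_def sum_nonneg)
  ultimately show ?thesis unfolding excess_def W_def[symmetric] by simp
qed

lemma cost_le: "\<bar>\<Sum>p<n. c p * x p\<bar> \<le> S * S + 2 * S * E x"
proof -
  have "\<bar>\<Sum>p<n. c p * x p\<bar> \<le> (\<Sum>p<n. S * \<bar>x p\<bar>)"
    by (intro order_trans[OF sum_abs] sum_mono) (auto simp: abs_mult c_le mult_right_mono)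
  also have "\<dots> \<le> S * (S + 2 * E x)"
    unfolding sum_distrib_left[symmetric] using S2 norm_le by (intro mult_left_mono) auto
  finally show ?thesis by (simp add: algebra_simps)
qed

text \<open>Infeasibility can lower the cost by at most
  \<open>2 * S * E x \<le> S * S * E x\<close>, a quarter of the penalty
  \<open>4 * S * S * E x\<close>.\<close>

lemma F_lower: "3 * (S * S) * E x - S * S \<le> F x"
proof -
  have "2 * S * E x \<le> S * S * E x" using S2 excess_nonneg by (intro mult_right_mono) auto
  then show ?thesis using cost_le[of x] by (simp add: penalized_def)
qed

lemma F_zero: "F (\<lambda>_. 0) \<le> 4 * S * S * S"
proof -
  have "F (\<lambda>_. 0) = 4 * S * S * (\<Sum>t<nlines r s l. \<bar>b t\<bar>)"
    by (simp add: penalized_def excess_def line_def)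
  also have "\<dots> \<le> 4 * S * S * S" using b_le S2 by (intro mult_left_mono) auto
  finally show ?thesis .
qed

lemma S_le_cube: "S * S \<le> S * S * S" "4 * S \<le> S * S * S"
proof -
  show "S * S \<le> S * S * S" using mult_left_mono[of 1 S "S * S"] S2 by simp
  have "4 \<le> S * S" using mult_mono[of 2 S 2 S] S2 by simp
  then show "4 * S \<le> S * S * S" using S2 by (intro mult_right_mono) auto
qed

text \<open>\<open>F_lower\<close> and \<open>F_zero\<close> give \<open>E x \<le> 2 * S\<close>,
  and \<open>norm_le\<close> turns this into \<open>S + 2 * (2 * S)\<close>. The search never
  increases \<open>F\<close>, so this controls every array that it reaches.\<close>

lemma entries_le:
  assumes "F x \<le> F (\<lambda>_. 0)" "p < n"
  shows "\<bar>x p\<bar> \<le> 5 * S"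
proof -
  have "4 * S * S * S = 4 * (S * S * S)" by simp
  then have "3 * (S * S) * E x \<le> 6 * (S * S * S)"
    using F_lower[of x] assms(1) F_zero S_le_cube S2 by linarith
  then have "S * S * (3 * E x) \<le> S * S * (6 * S)" by (simp add: algebra_simps)
  then have "E x \<le> 2 * S" using S2 by simp
  moreover have "\<bar>x p\<bar> \<le> (\<Sum>p<n. \<bar>x p\<bar>)" using assms(2) by (intro member_le_sum) auto
  ultimately show ?thesis using norm_le[of x] by linarith
qed

text \<open>\<open>F\<close> has integer values and is bounded below by
  \<open>- (S * S)\<close>.\<close>

lemma minimizer_exists: "\<exists>x. \<forall>y. F x \<le> F y"
proof -
  have lower: "0 \<le> F x + S * S" for x
  proof -
    have "0 \<le> 3 * (S * S) * E x" using excess_nonneg by simp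
    then show ?thesis using F_lower[of x] by linarith
  qed
  obtain x where x: "nat (F x + S * S) \<le> nat (F y + S * S)" for y
    using ex_has_least_nat[of "\<lambda>_. True" _ "\<lambda>x. nat (F x + S * S)"] by blast
  have "F x \<le> F y" for y using x[of y] lower[of x] lower[of y] by linarith
  then show ?thesis by blast
qed

definition "opt = (THE v. \<exists>x. F x = v \<and> (\<forall>y. v \<le> F y))"

lemma opt: "\<exists>x. F x = opt" "opt \<le> F y"
proof -
  have "\<exists>!v. \<exists>x. F x = v \<and> (\<forall>y. v \<le> F y)"
    using minimizer_exists by (metis antisym)
  then have "\<exists>x. F x = opt \<and> (\<forall>y. opt \<le> F y)" unfolding opt_def by (rule theI')
  then show "\<exists>x. F x = opt" "opt \<le> F y" by blast+
qed

lemma gap_zero_bound: "F (\<lambda>_. 0) - opt < 8 * S * S * S"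
proof -
  obtain x where "F x = opt" using opt(1) by blast
  moreover have "0 \<le> 3 * (S * S) * E x" using excess_nonneg by simp
  ultimately have "- (S * S) \<le> opt" using F_lower[of x] by linarith
  then show ?thesis using F_zero S_le_cube S2 by linarith
qed

text \<open>By \<open>penalized_gap\<close> with \<open>\<delta> = F x - v\<close> and
  \<open>d\<close> the difference to a minimizer, \<open>N\<close> times the best gain covers the
  whole gap, where \<open>N = M ^ K * L\<close> counts the pairs of code and scale. The conclusion
  is this inequality rearranged.\<close>

lemma best_move_gap:
  assumes K: "\<And>d. \<exists>p<n. d p \<noteq> 0 \<Longrightarrow>
       \<exists>g. (\<exists>p<n. g p \<noteq> 0) \<and> (\<Sum>p<n. \<bar>g p\<bar>) \<le> int K \<and> conform r s l g d"
    and M: "M = 2 * n + 2" and L: "8 * S * S * S < 2 ^ L"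
    and x: "F x \<le> F (\<lambda>_. 0)" and v: "v \<le> F x"
    and best: "\<And>i a. i < L \<Longrightarrow> a < M ^ K \<Longrightarrow> v \<le> F (\<lambda>p. x p + 2 ^ i * move M K a p)"
  shows "int (M ^ K * L) * (v - opt) \<le> (int (M ^ K * L) - 1) * (F x - opt)"
proof -
  obtain z where z: "F z = opt" using opt(1) by blast
  define d where "d p = z p - x p" for p
  have "F x - int (L * card {..<M ^ K}) * (F x - v) \<le> F (\<lambda>p. x p + d p)"
  proof (rule penalized_gap[where move = "move M K"])
    show "\<exists>a\<in>{..<M ^ K}. (\<exists>p<n. move M K a p \<noteq> 0) \<and> conform r s l (move M K a) d"
      if nonzero: "\<exists>p<n. d p \<noteq> 0" for d
    proof -
      obtain g where g: "\<exists>p<n. g p \<noteq> 0" "(\<Sum>p<n. \<bar>g p\<bar>) \<le> int K" "conform r s l g d"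
        using K[OF nonzero] by blast
      obtain a where a: "a < M ^ K" "\<And>p. p < n \<Longrightarrow> move M K a p = g p"
        using move_onto[OF g(2) M] by blast
      have "conform r s l (move M K a) d"
        using g(3) a(2) line_cong[of r s l "move M K a" g] by (simp add: conform_def)
      moreover have "\<exists>p<n. move M K a p \<noteq> 0" using g(1) a(2) by auto
      ultimately show ?thesis using a(1) by blast
    qed
    \<comment> \<open>Both arrays have entries of absolute value at most \<open>5 * S\<close>, and
      \<open>10 * S < 8 * S * S * S < 2 ^ L\<close>.\<close>
    show "\<bar>d p\<bar> < 2 ^ L" if "p < n" for p
    proof -
      have "\<bar>z p\<bar> \<le> 5 * S" using entries_le[of z p] that opt(2) z by simp
      moreover have "8 * S * S * S = 8 * (S * S * S)" by simp
      ultimately show ?thesis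
        using entries_le[OF x that] S_le_cube(2) S2 L unfolding d_def by linarith
    qed
  qed (use v best in \<open>auto\<close>)
  moreover have "F (\<lambda>p. x p + d p) = opt" using z by (simp add: d_def)
  ultimately show ?thesis by (simp add: algebra_simps)
qed

text \<open>By \<open>cost_le\<close> an array without excess has value at most
  \<open>S * S\<close>; by \<open>F_lower\<close> one with excess at least 1 has value at least
  \<open>2 * (S * S)\<close>.\<close>

lemma optimal_value_le: "opt \<le> S * S \<longleftrightarrow> (\<exists>x. E x = 0)"
proof
  assume "opt \<le> S * S"
  moreover obtain x where "F x = opt" using opt(1) by blast
  ultimately have "S * S * (3 * E x) \<le> S * S * 2" using F_lower[of x] by simp
  then have "3 * E x \<le> 2" using S2 by simp
  then show "\<exists>x. E x = 0" using excess_nonneg[of x] by (intro exI[of _ x]) linarith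
next
  assume "\<exists>x. E x = 0"
  then obtain x where x: "E x = 0" by blast
  then show "opt \<le> S * S" using cost_le[of x] opt(2)[of x] by (simp add: penalized_def)
qed

lemma excess_of_optimal: "F x = opt \<Longrightarrow> opt \<le> S * S \<Longrightarrow> E x = 0"
proof -
  assume "F x = opt" "opt \<le> S * S"
  then have "S * S * (3 * E x) \<le> S * S * 2" using F_lower[of x] by simp
  then have "3 * E x \<le> 2" using S2 by simp
  then show ?thesis using excess_nonneg[of x] by linarith
qed

end

section \<open>From the encoded instance to flat arrays and back\<close>

lemma concat_map_upt:
  "concat (map (\<lambda>i. map (f i) [0..<b]) [0..<a]) = map (\<lambda>q. f (q div b) (q mod b)) [0..<a * b]"
proof (induction a)
  case (Suc a)
  have "[0..<Suc a * b] = [0..<a * b] @ map (\<lambda>j. a * b + j) [0..<b]"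
    using upt_add_eq_append[of 0 "a * b" b] map_add_upt[of "a * b" b] by (simp add: add.commute)
  then show ?case using Suc.IH by simp
qed simp

lemma entries2_eq: "entries2 a b f = map (\<lambda>q. f (Suc (q div b)) (Suc (q mod b))) [0..<a * b]"
proof -
  have "entries2 a b f = concat (map (\<lambda>i. map (\<lambda>j. f (Suc i) (Suc j)) [0..<b]) [0..<a])"
    unfolding entries2_def by (simp add: comp_def flip: map_Suc_upt del: upt_Suc)
  then show ?thesis by (simp add: concat_map_upt)
qed

lemma entries3_eq:
  "entries3 a b d f = map (\<lambda>q. f (Suc (q div d div b)) (Suc (q div d mod b)) (Suc (q mod d))) [0..<a * b * d]"
proof -
  have "entries3 a b d f = concat (map (\<lambda>i. entries2 b d (f i)) (map Suc [0..<a]))"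
    by (simp add: entries3_def entries2_def map_Suc_upt)
  also have "\<dots> = concat (map (\<lambda>i. map (\<lambda>q. f (Suc i) (Suc (q div d)) (Suc (q mod d))) [0..<b * d]) [0..<a])"
    by (simp add: entries2_eq comp_def)
  also have "\<dots> = map (\<lambda>q. f (Suc (q div (b * d))) (Suc (q mod (b * d) div d)) (Suc (q mod (b * d) mod d))) [0..<a * (b * d)]"
    by (simp add: concat_map_upt)
  also have "\<dots> = map (\<lambda>q. f (Suc (q div d div b)) (Suc (q div d mod b)) (Suc (q mod d))) [0..<a * b * d]"
  proof (rule map_cong)
    fix q
    have "q div (b * d) = q div d div b" by (metis div_mult2_eq mult.commute)
    moreover have "q mod (b * d) div d = q div d mod b"
    proof -
      have "q mod (d * b) = d * (q div d mod b) + q mod d" by (rule mod_mult2_eq)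
      then show ?thesis by (cases "d = 0") (auto simp: mult.commute)
    qed
    moreover have "q mod (b * d) mod d = q mod d" by (simp add: mod_mod_cancel)
    ultimately show "f (Suc (q div (b * d))) (Suc (q mod (b * d) div d)) (Suc (q mod (b * d) mod d)) =
      f (Suc (q div d div b)) (Suc (q div d mod b)) (Suc (q mod d))" by simp
  qed (simp add: mult.assoc)
  finally show ?thesis .
qed

lemma length_encode_input: "length (encode_input r s l c u v w) = 1 + r * s * l + nlines r s l"
  by (simp add: encode_input_def input_data_def entries2_eq entries3_eq)

lemma nth_encode_input_0: "encode_input r s l c u v w ! 0 = int l"
  by (simp add: encode_input_def)

lemma nth_encode_input_c:
  assumes "i < r" "j < s" "k < l"
  shows "encode_input r s l c u v w ! (1 + ((i * s + j) * l + k)) = c (Suc i) (Suc j) (Suc k)"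
proof -
  have "(i * s + j) * l + k < r * s * l" using assms by (intro mult_add_less) auto
  then show ?thesis using assms
    by (simp add: encode_input_def input_data_def entries3_eq nth_append)
qed

text \<open>The lines are numbered in the order in which \<open>u\<close>, \<open>v\<close>,
  \<open>w\<close> appear in the input, so the tail of the input is the right-hand side
  \<open>b\<close> without rearrangement.\<close>

lemma nth_encode_input_lines:
  assumes "\<And>t. e t = encode_input r s l c u v w ! (1 + r * s * l + t)"
  shows "i < r \<Longrightarrow> j < s \<Longrightarrow> e (i * s + j) = u (Suc i) (Suc j)"
    and "i < r \<Longrightarrow> k < l \<Longrightarrow> e (r * s + i * l + k) = v (Suc i) (Suc k)"
    and "j < s \<Longrightarrow> k < l \<Longrightarrow> e (r * s + r * l + (j * l + k)) = w (Suc j) (Suc k)"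
proof -
  have e: "e t = (entries2 r s u @ entries2 r l v @ entries2 s l w) ! t" for t
    by (simp add: assms encode_input_def input_data_def entries3_eq nth_append)
  show "e (i * s + j) = u (Suc i) (Suc j)" if "i < r" "j < s"
    using mult_add_less[OF that] that by (simp add: e entries2_eq nth_append)
  show "e (r * s + i * l + k) = v (Suc i) (Suc k)" if "i < r" "k < l"
    using mult_add_less[OF that] that by (simp add: e entries2_eq nth_append)
  show "e (r * s + r * l + (j * l + k)) = w (Suc j) (Suc k)" if "j < s" "k < l"
    using mult_add_less[OF that] that by (simp add: e entries2_eq nth_append)
qed

definition flat :: "nat \<Rightarrow> nat \<Rightarrow> (nat \<Rightarrow> nat \<Rightarrow> nat \<Rightarrow> nat) \<Rightarrow> nat \<Rightarrow> int" where
  "flat s l y p = int (y (Suc (p div l div s)) (Suc (p div l mod s)) (Suc (p mod l)))"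

text \<open>\<open>nat\<close> sends negative entries to 0, so this inverts \<open>flat\<close> on
  nonnegative arrays, in particular on those without excess.\<close>

definition unflat :: "nat \<Rightarrow> nat \<Rightarrow> (nat \<Rightarrow> int) \<Rightarrow> nat \<Rightarrow> nat \<Rightarrow> nat \<Rightarrow> nat" where
  "unflat s l x i j k = nat (x (((i - 1) * s + (j - 1)) * l + (k - 1)))"

lemma flat_unflat: "0 \<le> x p \<Longrightarrow> flat s l (unflat s l x) p = x p"
  by (simp add: flat_def unflat_def)

lemma flat_at: "j < s \<Longrightarrow> k < l \<Longrightarrow> flat s l y ((i * s + j) * l + k) = int (y (Suc i) (Suc j) (Suc k))"
  by (simp add: flat_def)

lemma objective_flat:
  assumes "\<And>p. c' p = encode_input r s l c u v w ! (1 + p)"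
  shows "objective r s l c y = (\<Sum>p<r * s * l. c' p * flat s l y p)"
  using nth_encode_input_c[of _ r _ s _ l c u v w]
  by (simp add: objective_def sum_flatten3 flat_at assms sum.atLeast1_atMost_eq)

lemma Ball_1_atMost: "(\<forall>i\<in>{1..m}. P i) \<longleftrightarrow> (\<forall>i<m. P (Suc i))"
proof -
  have "{1..m} = Suc ` {..<m}" by (simp add: image_Suc_lessThan)
  then show ?thesis by auto
qed

text \<open>Entries of \<open>y\<close> are natural numbers, so the excess of its flat form consists
  of line errors alone.\<close>

lemma feasible_flat_iff:
  assumes "\<And>t. b t = encode_input r s l c u v w ! (1 + r * s * l + t)"
  shows "feasible r s l u v w y \<longleftrightarrow> excess r s l b (flat s l y) = 0"
proof -
  note b = nth_encode_input_lines[OF assms]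
  have "excess r s l b (flat s l y) = 0 \<longleftrightarrow> (\<forall>t<nlines r s l. b t = line r s l (flat s l y) t)"
  proof -
    have "excess r s l b (flat s l y) = (\<Sum>t<nlines r s l. \<bar>b t - line r s l (flat s l y) t\<bar>)"
      by (simp add: excess_def flat_def)
    then show ?thesis by (auto simp: sum_nonneg_eq_0_iff)
  qed
  also have "\<dots> \<longleftrightarrow> feasible r s l u v w y"
  proof
    assume *: "\<forall>t<nlines r s l. b t = line r s l (flat s l y) t"
    have "(\<Sum>k<l. int (y (Suc i) (Suc j) (Suc k))) = u (Suc i) (Suc j)" if "i < r" "j < s" for i j
      using *[rule_format, of "i * s + j"] mult_add_less[OF that] that by (simp add: b(1) line_u flat_at)
    moreover have "(\<Sum>j<s. int (y (Suc i) (Suc j) (Suc k))) = v (Suc i) (Suc k)" if "i < r" "k < l" for i k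
      using *[rule_format, of "r * s + i * l + k"] mult_add_less[OF that] that by (simp add: b(2) line_v flat_at)
    moreover have "(\<Sum>i<r. int (y (Suc i) (Suc j) (Suc k))) = w (Suc j) (Suc k)" if "j < s" "k < l" for j k
      using *[rule_format, of "r * s + r * l + (j * l + k)"] mult_add_less[OF that] that
      by (simp add: b(3) line_w flat_at)
    ultimately show "feasible r s l u v w y"
      unfolding feasible_def Ball_1_atMost by (simp add: sum.atLeast1_atMost_eq)
  next
    assume *: "feasible r s l u v w y"
    have f: "(\<Sum>k<l. int (y (Suc i) (Suc j) (Suc k))) = u (Suc i) (Suc j)" if "i < r" "j < s" for i j
      using * that unfolding feasible_def Ball_1_atMost by (simp add: sum.atLeast1_atMost_eq)
    have g: "(\<Sum>j<s. int (y (Suc i) (Suc j) (Suc k))) = v (Suc i) (Suc k)" if "i < r" "k < l" for i k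
      using * that unfolding feasible_def Ball_1_atMost by (simp add: sum.atLeast1_atMost_eq)
    have h: "(\<Sum>i<r. int (y (Suc i) (Suc j) (Suc k))) = w (Suc j) (Suc k)" if "j < s" "k < l" for j k
      using * that unfolding feasible_def Ball_1_atMost by (simp add: sum.atLeast1_atMost_eq)
    show "\<forall>t<nlines r s l. b t = line r s l (flat s l y) t"
    proof (intro allI impI)
      fix t assume "t < nlines r s l"
      then show "b t = line r s l (flat s l y) t"
      proof (cases t rule: line_cases)
        case (u i j)
        then show ?thesis using f by (simp add: b(1) line_u flat_at)
      next
        case (v i k)
        then show ?thesis using g by (simp add: b(2) line_v flat_at)
      next
        case (w j k)
        then show ?thesis using h by (simp add: b(3) line_w flat_at)
      qed
    qed
  qed
  finally show ?thesis by simp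
qed

lemma excess_eq_0_unflat:
  assumes "excess r s l b x = 0" "p < r * s * l"
  shows "flat s l (unflat s l x) p = x p"
proof -
  have "0 \<le> (\<Sum>p<r * s * l. max 0 (- x p))" "0 \<le> (\<Sum>t<nlines r s l. \<bar>b t - line r s l x t\<bar>)"
    by (auto intro: sum_nonneg)
  then have "(\<Sum>p<r * s * l. max 0 (- x p)) = 0" using assms(1) unfolding excess_def by linarith
  then have "max 0 (- x p) = 0" using assms(2) by (subst (asm) sum_nonneg_eq_0_iff) auto
  then show ?thesis by (intro flat_unflat) simp
qed

lemma encode_optimal_unflat:
  assumes "excess r s l b x = 0"
  shows "encode_outcome r s l (Optimal (unflat s l x)) = 2 # map x [0..<r * s * l]"
proof -
  have "map int (entries3 r s l (unflat s l x)) = map (flat s l (unflat s l x)) [0..<r * s * l]"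
    by (simp add: entries3_eq flat_def comp_def)
  also have "\<dots> = map x [0..<r * s * l]"
    using excess_eq_0_unflat[OF assms] by (intro map_cong) auto
  finally show ?thesis by simp
qed

text \<open>On feasible arrays \<open>F\<close> is the objective, and a minimizer of
  \<open>F\<close> with value at most \<open>S * S\<close> has no excess; it is therefore feasible
  and beats all feasible arrays.\<close>

lemma (in search) correct_outcome_opt:
  assumes c: "\<And>p. c p = encode_input r s l c0 u v w ! (1 + p)"
    and b: "\<And>t. b t = encode_input r s l c0 u v w ! (1 + r * s * l + t)"
  shows "\<not> opt \<le> S * S \<Longrightarrow> correct_outcome r s l c0 u v w Infeasible"
    and "opt \<le> S * S \<Longrightarrow> F x = opt \<Longrightarrow> correct_outcome r s l c0 u v w (Optimal (unflat s l x))"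
proof -
  assume "\<not> opt \<le> S * S"
  then show "correct_outcome r s l c0 u v w Infeasible"
    unfolding optimal_value_le using feasible_flat_iff[OF b] by auto
next
  assume opt_le: "opt \<le> S * S" and x: "F x = opt"
  have E: "E x = 0" using excess_of_optimal x opt_le by simp
  have val: "F (flat s l y) = objective r s l c0 y" if "feasible r s l u v w y" for y
    using that feasible_flat_iff[OF b] objective_flat[OF c] by (simp add: penalized_def)
  have same: "flat s l (unflat s l x) p = x p" if "p < n" for p
    using excess_eq_0_unflat[OF E that] .
  have Fx: "F (flat s l (unflat s l x)) = F x"
    using same by (rule penalized_cong)
  have "E (flat s l (unflat s l x)) = 0"
    using excess_of_optimal x opt_le Fx by simp
  then have feas: "feasible r s l u v w (unflat s l x)" using feasible_flat_iff[OF b] by simp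
  moreover have "objective r s l c0 (unflat s l x) \<le> objective r s l c0 y" if "feasible r s l u v w y" for y
    using val[OF feas] val[OF that] Fx x opt(2)[of "flat s l y"] by simp
  ultimately show "correct_outcome r s l c0 u v w (Optimal (unflat s l x))" by simp
qed

section \<open>Unit-cost executions\<close>

text \<open>Bit length in units of \<open>b\<close>: with all cells below \<open>2 ^ b\<close>, the
  value of \<open>e\<close> is below \<open>2 ^ (b * asize e)\<close>. Constants are counted in
  unary, which is affordable because they are fixed with the program.\<close>

fun asize :: "aexp \<Rightarrow> nat" where
  "asize (N n) = Suc (nat \<bar>n\<bar>)"
| "asize (Get a e) = Suc (asize e)"
| "asize (Plus e f) = asize e + asize f"
| "asize (Minus e f) = asize e + asize f"
| "asize (Times e f) = asize e + asize f"
| "asize (Div e f) = asize e + asize f"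

text \<open>\<open>b * aweight e\<close> bounds the cost of evaluating \<open>e\<close>. The factors
  2 absorb the sign bit in \<open>bit_size\<close>.\<close>

fun aweight :: "aexp \<Rightarrow> nat" where
  "aweight (N n) = 2 * asize (N n)"
| "aweight (Get a e) = aweight e + 2 * asize e + 2"
| "aweight (Plus e f) = aweight e + aweight f + 2 * asize e + 2 * asize f"
| "aweight (Minus e f) = aweight e + aweight f + 2 * asize e + 2 * asize f"
| "aweight (Times e f) = aweight e + aweight f + 2 * asize e + 2 * asize f"
| "aweight (Div e f) = aweight e + aweight f + 2 * asize e + 2 * asize f"

fun bweight :: "bexp \<Rightarrow> nat" where
  "bweight (Less e f) = aweight e + aweight f + 2 * asize e + 2 * asize f"
| "bweight (BNot t) = 1 + bweight t"
| "bweight (BAnd t t') = 1 + bweight t + bweight t'"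

text \<open>\<open>b * weight p\<close> bounds the cost of any single step of \<open>p\<close>; sums
  instead of maxima over the subprograms keep the estimates linear.\<close>

fun weight :: "com \<Rightarrow> nat" where
  "weight Skip = 1"
| "weight (Assign a e f) = aweight e + aweight f + 2 * asize e + 2 * asize f"
| "weight (Seq p q) = weight p + weight q"
| "weight (Cond t p q) = 1 + bweight t + weight p + weight q"
| "weight (While t p) = 1 + bweight t + weight p"

definition bounded :: "nat \<Rightarrow> state \<Rightarrow> bool" where
  "bounded b \<sigma> \<longleftrightarrow> (\<forall>a i. \<bar>\<sigma> a i\<bar> < 2 ^ b)"

lemma asize_pos: "0 < asize e"
  by (induction e) auto

lemma bit_size_le:
  assumes "\<bar>z\<bar> < 2 ^ k" "0 < k"
  shows "bit_size z \<le> 2 * k"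
proof -
  have "nat \<bar>z\<bar> < 2 ^ k" using assms(1) by (simp add: nat_less_iff)
  then have "floorlog 2 (nat \<bar>z\<bar>) \<le> k" by (intro floorlog_leI) auto
  then show ?thesis using assms(2) by (simp add: bit_size_def)
qed

lemma abs_aval_less:
  assumes "bounded b \<sigma>" "0 < b"
  shows "\<bar>aval e \<sigma>\<bar> < 2 ^ (b * asize e)"
proof -
  \<comment> \<open>\<open>X + Y \<le> X * Y\<close> for \<open>X, Y \<ge> 2\<close>, so a sum needs
    no more room than a product.\<close>
  have product: "(2 :: int) ^ (b * asize e) + 2 ^ (b * asize f) \<le> 2 ^ (b * (asize e + asize f))" for e f
  proof -
    have "b * asize e \<noteq> 0" "b * asize f \<noteq> 0" using assms(2) asize_pos[of e] asize_pos[of f] by auto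
    then have "(2 :: int) ^ 1 \<le> 2 ^ (b * asize e)" "(2 :: int) ^ 1 \<le> 2 ^ (b * asize f)"
      by (intro power_increasing; simp)+
    then have "0 \<le> ((2 :: int) ^ (b * asize e) - 2) * 2 ^ (b * asize f) + 2 ^ (b * asize e) * (2 ^ (b * asize f) - 2)"
      by (intro add_nonneg_nonneg mult_nonneg_nonneg) auto
    then show ?thesis by (simp add: algebra_simps power_add)
  qed
  show ?thesis
proof (induction e)
  case (N n)
  have "\<bar>n\<bar> < 2 ^ nat \<bar>n\<bar>" using of_nat_less_two_power[of "nat \<bar>n\<bar>", where 'a = int] by simp
  also have "(2 :: int) ^ nat \<bar>n\<bar> \<le> 2 ^ (b * Suc (nat \<bar>n\<bar>))"
    using assms(2) by (intro power_increasing) (cases b; simp)+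
  finally show ?case by simp
next
  case (Get a e)
  have "\<bar>aval (Get a e) \<sigma>\<bar> < 2 ^ b" using assms(1) by (simp add: bounded_def)
  also have "(2 :: int) ^ b \<le> 2 ^ (b * asize (Get a e))" by (intro power_increasing) auto
  finally show ?case .
next
  case (Plus e f)
  then show ?case using product[of e f] by simp
next
  case (Minus e f)
  then show ?case using product[of e f] by simp
next
  case (Times e f)
  then show ?case
    by (simp add: abs_mult algebra_simps power_add) (intro mult_strict_mono'; simp)
next
  case (Div e f)
  have pos: "\<bar>x div y\<bar> \<le> \<bar>x\<bar>" if "0 < y" for x y :: int
  proof (cases "0 \<le> x")
    case True
    then show ?thesis using zdiv_mono2[of x 1 y] pos_imp_zdiv_nonneg_iff[of y x] that by simp
  next
    case False
    then show ?thesis using zdiv_mono2_neg[of x 1 y] div_neg_pos_less0[of x y] that by simp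
  qed
  have "\<bar>x div y\<bar> \<le> \<bar>x\<bar>" for x y :: int
    using pos[of y x] pos[of "- y" "- x"] by (cases y "0 :: int" rule: linorder_cases) auto
  then have "\<bar>aval (Div e f) \<sigma>\<bar> \<le> \<bar>aval e \<sigma>\<bar>" by simp
  also have "\<dots> < 2 ^ (b * asize e)" by (rule Div.IH(1))
  also have "(2 :: int) ^ (b * asize e) \<le> 2 ^ (b * asize (Div e f))" by (intro power_increasing) auto
  finally show ?case .
qed
qed

lemma bit_size_aval_le:
  assumes "bounded b \<sigma>" "0 < b"
  shows "bit_size (aval e \<sigma>) \<le> b * (2 * asize e)"
  using bit_size_le[OF abs_aval_less[OF assms, of e]] assms(2) asize_pos[of e] by simp

lemma acost_le:
  assumes "bounded b \<sigma>" "0 < b"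
  shows "acost e \<sigma> \<le> b * aweight e"
proof (induction e)
  case (N n)
  show ?case using bit_size_aval_le[OF assms, of "N n"] by simp
next
  case (Get a e)
  have "bit_size (\<sigma> a (aval e \<sigma>)) \<le> 2 * b" using assms by (intro bit_size_le) (auto simp: bounded_def)
  with Get bit_size_aval_le[OF assms, of e] show ?case by (simp add: algebra_simps)
next
  case (Plus e f)
  with bit_size_aval_le[OF assms, of e] bit_size_aval_le[OF assms, of f] show ?case by (simp add: algebra_simps)
next
  case (Minus e f)
  with bit_size_aval_le[OF assms, of e] bit_size_aval_le[OF assms, of f] show ?case by (simp add: algebra_simps)
next
  case (Times e f)
  with bit_size_aval_le[OF assms, of e] bit_size_aval_le[OF assms, of f] show ?case by (simp add: algebra_simps)
next
  case (Div e f)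
  with bit_size_aval_le[OF assms, of e] bit_size_aval_le[OF assms, of f] show ?case by (simp add: algebra_simps)
qed

lemma bcost_le:
  assumes "bounded b \<sigma>" "0 < b"
  shows "bcost t \<sigma> \<le> b * bweight t"
proof (induction t)
  case (Less e f)
  show ?case
    using bit_size_aval_le[OF assms, of e] bit_size_aval_le[OF assms, of f]
      acost_le[OF assms, of e] acost_le[OF assms, of f] by (simp add: algebra_simps)
qed (use assms(2) in \<open>simp_all add: algebra_simps\<close>)

text \<open>
  The logarithmic cost of an execution is at most its number of steps times \<open>b\<close> times a constant
  of the program, provided that all values stay below \<open>2 ^ b\<close>.  The relation below therefore
  counts steps and bounds the assigned values.
\<close>

inductive nexec :: "nat \<Rightarrow> com \<Rightarrow> state \<Rightarrow> nat \<Rightarrow> state \<Rightarrow> bool" for b where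
  Skip: "nexec b Skip \<sigma> 1 \<sigma>"
| Assign: "\<bar>aval f \<sigma>\<bar> < 2 ^ b \<Longrightarrow> nexec b (Assign a e f) \<sigma> 1 (\<sigma>(a := (\<sigma> a)(aval e \<sigma> := aval f \<sigma>)))"
| Seq: "nexec b p \<sigma>1 k1 \<sigma>2 \<Longrightarrow> nexec b q \<sigma>2 k2 \<sigma>3 \<Longrightarrow> nexec b (Seq p q) \<sigma>1 (k1 + k2) \<sigma>3"
| CondTrue: "bval t \<sigma> \<Longrightarrow> nexec b p \<sigma> k \<sigma>' \<Longrightarrow> nexec b (Cond t p q) \<sigma> (1 + k) \<sigma>'"
| CondFalse: "\<not> bval t \<sigma> \<Longrightarrow> nexec b q \<sigma> k \<sigma>' \<Longrightarrow> nexec b (Cond t p q) \<sigma> (1 + k) \<sigma>'"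
| WhileFalse: "\<not> bval t \<sigma> \<Longrightarrow> nexec b (While t p) \<sigma> 1 \<sigma>"
| WhileTrue: "bval t \<sigma>1 \<Longrightarrow> nexec b p \<sigma>1 k1 \<sigma>2 \<Longrightarrow> nexec b (While t p) \<sigma>2 k2 \<sigma>3 \<Longrightarrow>
    nexec b (While t p) \<sigma>1 (1 + k1 + k2) \<sigma>3"

text \<open>\<open>nexec\<close> admits only assignments of values below \<open>2 ^ b\<close>, so
  boundedness persists and all steps can be charged the same amount.\<close>

lemma nexec_exec:
  assumes "nexec b p \<sigma> k \<sigma>'" "bounded b \<sigma>" "0 < b"
  shows "bounded b \<sigma>' \<and> (\<exists>t \<le> k * (b * weight p). exec p \<sigma> t \<sigma>')"
  using assms(1,2)
proof (induction rule: nexec.induct)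
  case (Skip \<sigma>)
  then show ?case using assms(3) by (auto intro: exec.Skip exI[of _ 1])
next
  case (Assign f \<sigma> a e)
  have "bounded b (\<sigma>(a := (\<sigma> a)(aval e \<sigma> := aval f \<sigma>)))"
    using Assign by (auto simp: bounded_def)
  moreover have "acost e \<sigma> + acost f \<sigma> + bit_size (aval e \<sigma>) + bit_size (aval f \<sigma>) \<le> 1 * (b * weight (Assign a e f))"
    using acost_le[OF Assign(2) assms(3), of e] acost_le[OF Assign(2) assms(3), of f]
      bit_size_aval_le[OF Assign(2) assms(3), of e] bit_size_aval_le[OF Assign(2) assms(3), of f]
    by (simp add: algebra_simps)
  ultimately show ?case using exec.Assign by blast
next
  case (Seq p \<sigma>1 k1 \<sigma>2 q k2 \<sigma>3)
  then obtain t1 t2 where t: "t1 \<le> k1 * (b * weight p)" "exec p \<sigma>1 t1 \<sigma>2"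
    "t2 \<le> k2 * (b * weight q)" "exec q \<sigma>2 t2 \<sigma>3" by blast
  have "t1 + t2 \<le> (k1 + k2) * (b * weight (Seq p q))"
    using t(1,3) by (simp add: algebra_simps)
  then show ?case using exec.Seq[OF t(2,4)] Seq by blast
next
  case (CondTrue t \<sigma> p k \<sigma>' q)
  then obtain u where u: "u \<le> k * (b * weight p)" "exec p \<sigma> u \<sigma>'" by blast
  have "1 + bcost t \<sigma> + u \<le> (1 + k) * (b * weight (Cond t p q))"
    using u(1) bcost_le[OF CondTrue.prems assms(3), of t] assms(3) by (simp add: algebra_simps)
  then show ?case using exec.CondTrue[OF CondTrue.hyps(1) u(2)] CondTrue by blast
next
  case (CondFalse t \<sigma> q k \<sigma>' p)
  then obtain u where u: "u \<le> k * (b * weight q)" "exec q \<sigma> u \<sigma>'" by blast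
  have "1 + bcost t \<sigma> + u \<le> (1 + k) * (b * weight (Cond t p q))"
    using u(1) bcost_le[OF CondFalse.prems assms(3), of t] assms(3) by (simp add: algebra_simps)
  then show ?case using exec.CondFalse[OF CondFalse.hyps(1) u(2)] CondFalse by blast
next
  case (WhileFalse t \<sigma> p)
  have "1 + bcost t \<sigma> \<le> 1 * (b * weight (While t p))"
    using bcost_le[OF WhileFalse.prems assms(3), of t] assms(3) by (simp add: algebra_simps)
  then show ?case using exec.WhileFalse[OF WhileFalse.hyps] WhileFalse by blast
next
  case (WhileTrue t \<sigma>1 p k1 \<sigma>2 k2 \<sigma>3)
  then obtain u v where u: "u \<le> k1 * (b * weight p)" "exec p \<sigma>1 u \<sigma>2"
    "v \<le> k2 * (b * weight (While t p))" "exec (While t p) \<sigma>2 v \<sigma>3" by blast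
  have "1 + bcost t \<sigma>1 + u + v \<le> (1 + k1 + k2) * (b * weight (While t p))"
    using u(1,3) bcost_le[OF WhileTrue.prems assms(3), of t] assms(3) by (simp add: algebra_simps)
  then show ?case using exec.WhileTrue[OF WhileTrue.hyps(1) u(2,4)] WhileTrue by blast
qed

section \<open>Proof rules with step budgets and frames\<close>

fun mods :: "com \<Rightarrow> vname set" where
  "mods Skip = {}"
| "mods (Assign a e f) = {a}"
| "mods (Seq p q) = mods p \<union> mods q"
| "mods (Cond t p q) = mods p \<union> mods q"
| "mods (While t p) = mods p"

fun avars :: "aexp \<Rightarrow> vname set" where
  "avars (N n) = {}"
| "avars (Get a e) = insert a (avars e)"
| "avars (Plus e f) = avars e \<union> avars f"
| "avars (Minus e f) = avars e \<union> avars f"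
| "avars (Times e f) = avars e \<union> avars f"
| "avars (Div e f) = avars e \<union> avars f"

lemma nexec_frame: "nexec b p \<sigma> k \<sigma>' \<Longrightarrow> a \<notin> mods p \<Longrightarrow> \<sigma>' a = \<sigma> a"
  by (induction rule: nexec.induct) auto

lemma aval_cong: "(\<And>a. a \<in> avars e \<Longrightarrow> \<sigma> a = \<tau> a) \<Longrightarrow> aval e \<sigma> = aval e \<tau>"
  by (induction e) auto

text \<open>A Hoare-style total correctness statement with a budget of \<open>k\<close>
  steps.\<close>

definition runs :: "nat \<Rightarrow> com \<Rightarrow> state \<Rightarrow> nat \<Rightarrow> (state \<Rightarrow> bool) \<Rightarrow> bool" where
  "runs b p \<sigma> k R \<longleftrightarrow> (\<exists>k' \<sigma>'. nexec b p \<sigma> k' \<sigma>' \<and> k' \<le> k \<and> R \<sigma>')"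

definition agree :: "vname set \<Rightarrow> state \<Rightarrow> state \<Rightarrow> bool" where
  "agree A \<sigma> \<tau> \<longleftrightarrow> (\<forall>a. a \<notin> A \<longrightarrow> \<tau> a = \<sigma> a)"

lemma agreeD: "agree A \<sigma> \<tau> \<Longrightarrow> a \<notin> A \<Longrightarrow> \<tau> a = \<sigma> a"
  by (simp add: agree_def)

text \<open>Besides weakening, the rule hands out the frame: \<open>agree\<close> supplies the
  unmodified variables, so postconditions need to mention only what changes.\<close>

lemma runs_conseq:
  assumes "runs b p \<sigma> k R" "k \<le> k'" "\<And>\<tau>. R \<tau> \<Longrightarrow> agree (mods p) \<sigma> \<tau> \<Longrightarrow> R' \<tau>"
  shows "runs b p \<sigma> k' R'"
proof -
  obtain j \<tau> where j: "nexec b p \<sigma> j \<tau>" "j \<le> k" "R \<tau>" using assms(1) by (auto simp: runs_def)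
  have "agree (mods p) \<sigma> \<tau>" using nexec_frame[OF j(1)] by (auto simp: agree_def)
  then show ?thesis using j assms(2,3) unfolding runs_def by (meson le_trans)
qed

lemma runs_Skip: "0 < k \<Longrightarrow> R \<sigma> \<Longrightarrow> runs b Skip \<sigma> k R"
  unfolding runs_def using nexec.Skip by fastforce

lemma runs_Assign:
  "0 < k \<Longrightarrow> \<bar>aval f \<sigma>\<bar> < 2 ^ b \<Longrightarrow> R (\<sigma>(a := (\<sigma> a)(aval e \<sigma> := aval f \<sigma>))) \<Longrightarrow> runs b (Assign a e f) \<sigma> k R"
  unfolding runs_def using nexec.Assign by fastforce

lemma runs_Seq:
  assumes "runs b p \<sigma> k1 Q" "\<And>\<tau>. Q \<tau> \<Longrightarrow> agree (mods p) \<sigma> \<tau> \<Longrightarrow> runs b q \<tau> k2 R" "k1 + k2 \<le> k"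
  shows "runs b (Seq p q) \<sigma> k R"
proof -
  obtain j \<tau> where j: "nexec b p \<sigma> j \<tau>" "j \<le> k1" "Q \<tau>" using assms(1) by (auto simp: runs_def)
  have "agree (mods p) \<sigma> \<tau>" using nexec_frame[OF j(1)] by (auto simp: agree_def)
  from assms(2)[OF j(3) this] obtain j' \<tau>' where j': "nexec b q \<tau> j' \<tau>'" "j' \<le> k2" "R \<tau>'"
    by (auto simp: runs_def)
  have "j + j' \<le> k" using j(2) j'(2) assms(3) by simp
  then show ?thesis using nexec.Seq[OF j(1) j'(1)] j'(3) unfolding runs_def by blast
qed

lemma runs_Assign_Seq:
  assumes "0 < k" "\<bar>aval f \<sigma>\<bar> < 2 ^ b" "runs b q (\<sigma>(a := (\<sigma> a)(aval e \<sigma> := aval f \<sigma>))) (k - 1) R"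
  shows "runs b (Seq (Assign a e f) q) \<sigma> k R"
  by (rule runs_Seq[of _ _ _ 1 "\<lambda>\<tau>. \<tau> = \<sigma>(a := (\<sigma> a)(aval e \<sigma> := aval f \<sigma>))" _ "k - 1"])
    (use assms in \<open>auto intro: runs_Assign\<close>)

text \<open>Address and value are free variables, so that facts about them can be plugged in instead
  of simplifying \<open>aval\<close> inside the goal.\<close>

lemma runs_Assign_val:
  "aval e \<sigma> = i \<Longrightarrow> aval f \<sigma> = v \<Longrightarrow> \<bar>v\<bar> < 2 ^ b \<Longrightarrow> 0 < k \<Longrightarrow> R (\<sigma>(a := (\<sigma> a)(i := v))) \<Longrightarrow>
    runs b (Assign a e f) \<sigma> k R"
  using runs_Assign by blast

lemma runs_Assign_Seq_val:
  "aval e \<sigma> = i \<Longrightarrow> aval f \<sigma> = v \<Longrightarrow> \<bar>v\<bar> < 2 ^ b \<Longrightarrow> 0 < k \<Longrightarrow>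
    runs b q (\<sigma>(a := (\<sigma> a)(i := v))) (k - 1) R \<Longrightarrow> runs b (Seq (Assign a e f) q) \<sigma> k R"
  using runs_Assign_Seq by blast

lemma runs_Cond:
  assumes "0 < k" "bval t \<sigma> \<Longrightarrow> runs b p \<sigma> (k - 1) R" "\<not> bval t \<sigma> \<Longrightarrow> runs b q \<sigma> (k - 1) R"
  shows "runs b (Cond t p q) \<sigma> k R"
proof (cases "bval t \<sigma>")
  case True
  from assms(2)[OF this] obtain j \<tau> where j: "nexec b p \<sigma> j \<tau>" "j \<le> k - 1" "R \<tau>" by (auto simp: runs_def)
  have "1 + j \<le> k" using j(2) assms(1) by simp
  then show ?thesis using nexec.CondTrue[OF True j(1), of q] j(3) unfolding runs_def by blast
next
  case False
  from assms(3)[OF this] obtain j \<tau> where j: "nexec b q \<sigma> j \<tau>" "j \<le> k - 1" "R \<tau>" by (auto simp: runs_def)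
  have "1 + j \<le> k" using j(2) assms(1) by simp
  then show ?thesis using nexec.CondFalse[OF False j(1), of p] j(3) unfolding runs_def by blast
qed

lemma runs_While:
  assumes "\<And>j \<tau>. j < m \<Longrightarrow> I j \<tau> \<Longrightarrow> bval t \<tau> \<and> runs b p \<tau> k (I (Suc j))"
    and "\<And>\<tau>. I m \<tau> \<Longrightarrow> \<not> bval t \<tau>" and "I 0 \<sigma>"
  shows "runs b (While t p) \<sigma> (1 + m * (1 + k)) (I m)"
proof -
  have "runs b (While t p) \<tau> (1 + (m - j) * (1 + k)) (I m)" if "j \<le> m" "I j \<tau>" for j \<tau>
    using that
  proof (induction j arbitrary: \<tau> rule: inc_induct)
    case base
    have "nexec b (While t p) \<tau> 1 \<tau>" by (intro nexec.WhileFalse assms(2) base)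
    then show ?case using base unfolding runs_def by (intro exI[of _ 1] exI[of _ \<tau>]) simp
  next
    case (step j)
    from assms(1)[OF step.hyps(2) step.prems] obtain k' \<tau>' where
      1: "bval t \<tau>" "nexec b p \<tau> k' \<tau>'" "k' \<le> k" "I (Suc j) \<tau>'" by (auto simp: runs_def)
    from step.IH[OF 1(4)] obtain k'' \<tau>'' where
      2: "nexec b (While t p) \<tau>' k'' \<tau>''" "k'' \<le> 1 + (m - Suc j) * (1 + k)" "I m \<tau>''" by (auto simp: runs_def)
    have "m - j = Suc (m - Suc j)" using step.hyps by simp
    then have "1 + k' + k'' \<le> 1 + (m - j) * (1 + k)" using 1(3) 2(2) by simp
    then show ?case using nexec.WhileTrue[OF 1(1,2) 2(1)] 2(3) unfolding runs_def by blast
  qed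
  from this[OF le0 assms(3)] show ?thesis by simp
qed

abbreviation V :: "vname \<Rightarrow> aexp" where
  "V a \<equiv> Get a (N 0)"

abbreviation Set :: "vname \<Rightarrow> aexp \<Rightarrow> com" where
  "Set a f \<equiv> Assign a (N 0) f"

definition For :: "vname \<Rightarrow> aexp \<Rightarrow> com \<Rightarrow> com" where
  "For i e p = Seq (Set i (N 0)) (While (Less (V i) e) (Seq p (Set i (Plus (V i) (N 1)))))"

lemma mods_For [simp]: "mods (For i e p) = insert i (mods p)"
  by (simp add: For_def)

text \<open>The bound \<open>e\<close> is evaluated anew in every round, so its variables must not
  be modified; \<open>ins\<close> allows the counter to be incremented without disturbing the
  invariant. The budget consists of one step each for initialization and final test, and of two more
  than the body per round.\<close>

lemma runs_For:
  assumes i: "i \<notin> mods p" and e: "avars e \<inter> insert i (mods p) = {}"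
    and m: "aval e \<sigma> = int m" "int m < 2 ^ b"
    and init: "I 0 \<sigma>" and ins: "\<And>j \<tau> v. I j (\<tau>(i := v)) = I j \<tau>"
    and body: "\<And>j \<tau>. j < m \<Longrightarrow> I j \<tau> \<Longrightarrow> \<tau> i 0 = int j \<Longrightarrow> agree (insert i (mods p)) \<sigma> \<tau> \<Longrightarrow>
      runs b p \<tau> k (I (Suc j))"
  shows "runs b (For i e p) \<sigma> (2 + m * (k + 2)) (I m)"
proof -
  define J where "J j \<tau> \<longleftrightarrow> I j \<tau> \<and> \<tau> i 0 = int j \<and> agree (insert i (mods p)) \<sigma> \<tau>" for j \<tau>
  have e_m: "aval e \<tau> = int m" if "agree (insert i (mods p)) \<sigma> \<tau>" for \<tau>
  proof -
    have "\<tau> a = \<sigma> a" if "a \<in> avars e" for a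
      using \<open>agree _ \<sigma> \<tau>\<close> that e unfolding agree_def by blast
    then show ?thesis using aval_cong[of e \<tau> \<sigma>] m(1) by simp
  qed
  have "runs b (While (Less (V i) e) (Seq p (Set i (Plus (V i) (N 1))))) (\<sigma>(i := (\<sigma> i)(0 := 0)))
    (1 + m * (1 + (k + 1))) (J m)"
  proof (rule runs_While)
    fix j \<tau> assume j: "j < m" and "J j \<tau>"
    then have J: "I j \<tau>" "\<tau> i 0 = int j" "agree (insert i (mods p)) \<sigma> \<tau>" by (auto simp: J_def)
    have "runs b (Seq p (Set i (Plus (V i) (N 1)))) \<tau> (k + 1) (J (Suc j))"
    proof (rule runs_Seq[OF body[OF j J]])
      fix \<tau>' assume \<tau>': "I (Suc j) \<tau>'" "agree (mods p) \<tau> \<tau>'"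
      then have \<tau>'_i: "\<tau>' i 0 = int j" using i J(2) by (simp add: agree_def)
      then have val: "aval (Plus (V i) (N 1)) \<tau>' = int j + 1" by simp
      show "runs b (Set i (Plus (V i) (N 1))) \<tau>' 1 (J (Suc j))"
      proof (rule runs_Assign)
        show "\<bar>aval (Plus (V i) (N 1)) \<tau>'\<bar> < 2 ^ b" unfolding val using j m(2) by linarith
      qed (use \<tau>' \<tau>'_i J(3) in \<open>auto simp: J_def ins agree_def\<close>)
    qed simp
    then show "bval (Less (V i) e) \<tau> \<and> runs b (Seq p (Set i (Plus (V i) (N 1)))) \<tau> (k + 1) (J (Suc j))"
      using J(2) e_m[OF J(3)] j by simp
  next
    fix \<tau> assume "J m \<tau>"
    then show "\<not> bval (Less (V i) e) \<tau>" using e_m by (auto simp: J_def)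
  next
    show "J 0 (\<sigma>(i := (\<sigma> i)(0 := 0)))" using init by (simp add: J_def ins agree_def)
  qed
  then have "runs b (While (Less (V i) e) (Seq p (Set i (Plus (V i) (N 1))))) (\<sigma>(i := (\<sigma> i)(0 := 0)))
    (1 + m * (1 + (k + 1))) (I m)"
    by (rule runs_conseq) (auto simp: J_def)
  then show ?thesis unfolding For_def by (intro runs_Assign_Seq) (simp_all add: algebra_simps)
qed

section \<open>Applying a coded move\<close>

abbreviation eL :: aexp where
  "eL \<equiv> Get ''in'' (N 0)"

definition eN :: "nat \<Rightarrow> nat \<Rightarrow> aexp" where
  "eN r s = Times (N (int (r * s))) eL"

definition eT :: "nat \<Rightarrow> nat \<Rightarrow> aexp" where
  "eT r s = Plus (N (int (r * s))) (Times (N (int (r + s))) eL)"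

definition eM :: "nat \<Rightarrow> nat \<Rightarrow> aexp" where
  "eM r s = Plus (Times (N 2) (eN r s)) (N 2)"

text \<open>The exponent is a constant of the program, so the power is unrolled into an
  expression.\<close>

fun ePow :: "nat \<Rightarrow> nat \<Rightarrow> nat \<Rightarrow> aexp" where
  "ePow r s 0 = N 1"
| "ePow r s (Suc K) = Times (eM r s) (ePow r s K)"

definition eMod :: "aexp \<Rightarrow> aexp \<Rightarrow> aexp" where
  "eMod e d = Minus e (Times (Div e d) d)"

text \<open>\<open>eB\<close> is the penalty coefficient of \<open>F\<close>. \<open>eD\<close>,
  below, exceeds both the initial gap and \<open>F\<close> at every array visited; it determines
  \<open>L\<close> and is the starting value in the search for the best move.\<close>

abbreviation eB :: aexp where
  "eB \<equiv> Times (Times (N 4) (V ''S'')) (V ''S'')"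

abbreviation eD :: aexp where
  "eD \<equiv> Times (Times (Times (N 8) (V ''S'')) (V ''S'')) (V ''S'')"

lemma aval_eN [simp]: "\<sigma> ''in'' 0 = int l \<Longrightarrow> aval (eN r s) \<sigma> = int (r * s * l)"
  by (simp add: eN_def)

lemma aval_eT [simp]: "\<sigma> ''in'' 0 = int l \<Longrightarrow> aval (eT r s) \<sigma> = int (nlines r s l)"
  by (simp add: eT_def algebra_simps)

lemma aval_eM [simp]: "\<sigma> ''in'' 0 = int l \<Longrightarrow> aval (eM r s) \<sigma> = int (2 * (r * s * l) + 2)"
  by (simp add: eM_def)

lemma aval_ePow [simp]: "\<sigma> ''in'' 0 = int l \<Longrightarrow> aval (ePow r s K) \<sigma> = int ((2 * (r * s * l) + 2) ^ K)"
  by (induction K) (simp_all add: algebra_simps)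

lemma aval_eMod [simp]: "aval (eMod e d) \<sigma> = aval e \<sigma> mod aval d \<sigma>"
  by (simp add: eMod_def minus_div_mult_eq_mod)

lemma avars_exps [simp]:
  "avars (eN r s) = {''in''}" "avars (eT r s) = {''in''}" "avars (eM r s) = {''in''}"
  "avars (eMod e d) = avars e \<union> avars d"
  by (auto simp: eN_def eT_def eM_def eMod_def)

lemma avars_ePow: "avars (ePow r s K) \<subseteq> {''in''}"
  by (induction K) auto

text \<open>
  The cell after the last entry absorbs the digits that change no entry; it is reset first so
  that its content stays bounded.
\<close>

definition Move :: "nat \<Rightarrow> nat \<Rightarrow> nat \<Rightarrow> vname \<Rightarrow> vname \<Rightarrow> vname \<Rightarrow> com" where
  "Move r s K arr lam code =
    Seq (Assign arr (Plus (N 1) (eN r s)) (N 0))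
    (Seq (Set ''u'' (V code))
    (For ''j'' (N (int K))
      (Seq (Set ''e'' (eMod (V ''u'') (eM r s)))
      (Seq (Set ''u'' (Div (V ''u'') (eM r s)))
      (Assign arr (Plus (N 1) (Div (V ''e'') (N 2)))
        (Plus (Get arr (Plus (N 1) (Div (V ''e'') (N 2))))
          (Times (V lam) (Minus (N 1) (Times (N 2) (eMod (V ''e'') (N 2)))))))))))"

lemma mods_Move [simp]: "mods (Move r s K arr lam code) = {arr, ''u'', ''e'', ''j''}"
  by (auto simp: Move_def)

text \<open>Invariant: the array plus \<theta> times the move still coded in \<open>''u''\<close>
  equals the target. A round changes one cell by \<bar>\<theta>\<bar>, which bounds all intermediate
  values.\<close>

lemma runs_Move:
  fixes r s l :: nat
  defines "n \<equiv> r * s * l" and "M \<equiv> 2 * (r * s * l) + 2"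
  assumes arr: "arr \<notin> {''in'', ''u'', ''e'', ''j'', lam, code}"
    and lam: "lam \<notin> {''u'', ''e'', ''j''}" and code: "code \<notin> {''u'', ''e'', ''j''}"
    and in0: "\<sigma> ''in'' 0 = int l" and \<theta>: "\<sigma> lam 0 = \<theta>" and a: "\<sigma> code 0 = int a" "int a < 2 ^ b"
    and M: "int M < 2 ^ b" and K: "int K < 2 ^ b"
    and bd: "\<And>p. p < n \<Longrightarrow> \<bar>\<sigma> arr (1 + int p)\<bar> + int K * \<bar>\<theta>\<bar> < 2 ^ b" "int K * \<bar>\<theta>\<bar> < 2 ^ b"
  shows "runs b (Move r s K arr lam code) \<sigma> (4 + 5 * K)
    (\<lambda>\<tau>. \<forall>p<n. \<tau> arr (1 + int p) = \<sigma> arr (1 + int p) + \<theta> * move M K a p)"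
proof -
  \<comment> \<open>Cell \<open>n\<close> has been reset and therefore starts from 0.\<close>
  define X where "X p = (if p < n then \<sigma> arr (1 + int p) else 0)" for p
  have X: "\<bar>X p\<bar> + int K * \<bar>\<theta>\<bar> < 2 ^ b" for p using bd by (simp add: X_def)
  define I where "I j \<tau> \<longleftrightarrow> (\<exists>a'. \<tau> ''u'' 0 = int a' \<and> a' \<le> a \<and>
    (\<forall>p\<le>n. \<tau> arr (1 + int p) + \<theta> * move M (K - j) a' p = X p + \<theta> * move M K a p \<and>
            \<bar>\<tau> arr (1 + int p)\<bar> \<le> \<bar>X p\<bar> + int j * \<bar>\<theta>\<bar>))" for j and \<tau> :: state
  define p where "p = Seq (Set ''e'' (eMod (V ''u'') (eM r s)))
      (Seq (Set ''u'' (Div (V ''u'') (eM r s)))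
      (Assign arr (Plus (N 1) (Div (V ''e'') (N 2)))
        (Plus (Get arr (Plus (N 1) (Div (V ''e'') (N 2))))
          (Times (V lam) (Minus (N 1) (Times (N 2) (eMod (V ''e'') (N 2))))))))"
  have mods_p: "mods p = {arr, ''u'', ''e''}" by (auto simp: p_def)
  define \<sigma>' where "\<sigma>' = \<sigma>(arr := (\<sigma> arr)(1 + int n := 0), ''u'' := (\<sigma> ''u'')(0 := int a))"
  have loop: "runs b (For ''j'' (N (int K)) p) \<sigma>' (2 + K * (3 + 2)) (I K)"
  proof (rule runs_For)
    show "''j'' \<notin> mods p" using arr by (auto simp: p_def)
    show "I 0 \<sigma>'" using arr unfolding I_def by (intro exI[of _ a]) (auto simp: \<sigma>'_def X_def)
    show "I j (\<tau>(''j'' := v)) = I j \<tau>" for j \<tau> v using arr by (auto simp: I_def)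
    fix j \<tau>
    assume j: "j < K" and Ij: "I j \<tau>" and "\<tau> ''j'' 0 = int j"
      and agr: "agree (insert ''j'' (mods p)) \<sigma>' \<tau>"
    from Ij obtain a' where a'12: "\<tau> ''u'' 0 = int a'" "a' \<le> a" and
      a'34: "\<forall>p\<le>n. \<tau> arr (1 + int p) + \<theta> * move M (K - j) a' p = X p + \<theta> * move M K a p \<and>
        \<bar>\<tau> arr (1 + int p)\<bar> \<le> \<bar>X p\<bar> + int j * \<bar>\<theta>\<bar>"
      unfolding I_def by (elim exE conjE) (rule that; assumption)
    have a': "\<tau> ''u'' 0 = int a'" "a' \<le> a"
      "\<And>p. p \<le> n \<Longrightarrow> \<tau> arr (1 + int p) + \<theta> * move M (K - j) a' p = X p + \<theta> * move M K a p"
      "\<And>p. p \<le> n \<Longrightarrow> \<bar>\<tau> arr (1 + int p)\<bar> \<le> \<bar>X p\<bar> + int j * \<bar>\<theta>\<bar>"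
      using a'12 a'34 by simp_all
    have \<tau>: "\<tau> ''in'' 0 = int l" "\<tau> lam 0 = \<theta>"
      using agreeD[OF agr, of "''in''"] agreeD[OF agr, of lam] arr lam in0 \<theta>
      by (auto simp: mods_p \<sigma>'_def)
    define d where "d = a' mod M"
    define q where "q = d div 2"
    define \<epsilon> :: int where "\<epsilon> = 1 - 2 * int (d mod 2)"
    have "d < M" by (simp add: d_def M_def)
    then have q: "q \<le> n" by (simp add: q_def M_def n_def)
    have \<epsilon>: "\<bar>\<epsilon>\<bar> = 1" unfolding \<epsilon>_def by (cases "d mod 2 = 0") auto
    have M_eq: "aval (eM r s) \<tau>' = int M" if "\<tau>' ''in'' 0 = int l" for \<tau>'
      using that by (simp add: M_def)
    have digits: "int a' mod int M = int d" "int a' div int M = int (a' div M)"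
      "int d div 2 = int q" "int d mod 2 = int (d mod 2)"
      by (simp_all add: d_def q_def zmod_int zdiv_int)
    define v where "v = \<tau> arr (1 + int q) + \<theta> * \<epsilon>"
    have v: "\<bar>v\<bar> \<le> \<bar>X q\<bar> + int (Suc j) * \<bar>\<theta>\<bar>"
    proof -
      have "\<bar>v\<bar> \<le> \<bar>\<tau> arr (1 + int q)\<bar> + \<bar>\<theta> * \<epsilon>\<bar>" unfolding v_def by linarith
      then show ?thesis using a'(4)[OF q] \<epsilon> by (simp add: abs_mult algebra_simps)
    qed
    have "int (Suc j) * \<bar>\<theta>\<bar> \<le> int K * \<bar>\<theta>\<bar>" using j by (intro mult_right_mono) auto
    then have v_less: "\<bar>v\<bar> < 2 ^ b" using v X[of q] by linarith
    have K_j: "K - j = Suc (K - Suc j)" using j by simp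
    define \<tau>1 where "\<tau>1 = \<tau>(''e'' := (\<tau> ''e'')(0 := int d))"
    define \<tau>2 where "\<tau>2 = \<tau>1(''u'' := (\<tau> ''u'')(0 := int (a' div M)))"
    define \<tau>3 where "\<tau>3 = \<tau>2(arr := (\<tau> arr)(1 + int q := v))"
    have I3: "I (Suc j) \<tau>3"
      unfolding I_def
    proof (intro exI[of _ "a' div M"] conjI allI impI)
      show "\<tau>3 ''u'' 0 = int (a' div M)" using arr by (auto simp: \<tau>3_def \<tau>2_def)
      show "a' div M \<le> a" using a'(2) div_le_dividend[of a' M] by linarith
      fix p' assume p': "p' \<le> n"
      have \<tau>3: "\<tau>3 arr (1 + int p') = (if p' = q then v else \<tau> arr (1 + int p'))"
        by (simp add: \<tau>3_def)
      show "\<tau>3 arr (1 + int p') + \<theta> * move M (K - Suc j) (a' div M) p' = X p' + \<theta> * move M K a p'"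
        using a'(3)[OF p', unfolded K_j] \<tau>3
        by (auto simp: v_def \<epsilon>_def d_def q_def algebra_simps split: if_splits)
      show "\<bar>\<tau>3 arr (1 + int p')\<bar> \<le> \<bar>X p'\<bar> + int (Suc j) * \<bar>\<theta>\<bar>"
      proof (cases "p' = q")
        case False
        have "int (Suc j) * \<bar>\<theta>\<bar> = int j * \<bar>\<theta>\<bar> + \<bar>\<theta>\<bar>" by (simp add: algebra_simps)
        moreover have "\<tau>3 arr (1 + int p') = \<tau> arr (1 + int p')" using \<tau>3 False by simp
        ultimately show ?thesis using a'(4)[OF p'] abs_ge_zero[of \<theta>] by linarith
      qed (use v \<tau>3 in simp)
    qed
    have a3: "aval (Plus (N 1) (Div (V ''e'') (N 2))) \<tau>2 = 1 + int q"
      by (simp add: \<tau>2_def \<tau>1_def digits)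
    have f3: "aval (Plus (Get arr (Plus (N 1) (Div (V ''e'') (N 2))))
          (Times (V lam) (Minus (N 1) (Times (N 2) (eMod (V ''e'') (N 2)))))) \<tau>2 = v"
      using arr lam \<tau>(2) by (auto simp: \<tau>2_def \<tau>1_def digits v_def \<epsilon>_def)
    have f2: "aval (Div (V ''u'') (eM r s)) \<tau>1 = int (a' div M)"
      using \<tau>(1) by (simp add: \<tau>1_def a'(1) M_eq digits del: aval_eM)
    have f1: "aval (eMod (V ''u'') (eM r s)) \<tau> = int d"
      using \<tau>(1) by (simp add: a'(1) M_eq digits del: aval_eM)
    have b1: "\<bar>int d\<bar> < 2 ^ b" using \<open>d < M\<close> M by linarith
    have b2: "\<bar>int (a' div M)\<bar> < 2 ^ b"
      using a(2) a'(2) div_le_dividend[of a' M] by linarith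
    have upd: "\<tau>1 ''u'' = \<tau> ''u''" "\<tau>2 arr = \<tau> arr" using arr by (auto simp: \<tau>2_def \<tau>1_def)
    have "runs b (Assign arr (Plus (N 1) (Div (V ''e'') (N 2)))
        (Plus (Get arr (Plus (N 1) (Div (V ''e'') (N 2))))
          (Times (V lam) (Minus (N 1) (Times (N 2) (eMod (V ''e'') (N 2))))))) \<tau>2 1 (I (Suc j))"
      by (rule runs_Assign_val[OF a3 f3 v_less]) (use I3 in \<open>simp_all add: \<tau>3_def upd\<close>)
    then have "runs b (Seq (Set ''u'' (Div (V ''u'') (eM r s)))
      (Assign arr (Plus (N 1) (Div (V ''e'') (N 2)))
        (Plus (Get arr (Plus (N 1) (Div (V ''e'') (N 2))))
          (Times (V lam) (Minus (N 1) (Times (N 2) (eMod (V ''e'') (N 2)))))))) \<tau>1 2 (I (Suc j))"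
      by (intro runs_Assign_Seq_val[OF aval.simps(1) f2 b2]) (simp_all add: \<tau>2_def upd)
    then show "runs b p \<tau> 3 (I (Suc j))"
      unfolding p_def by (intro runs_Assign_Seq_val[OF aval.simps(1) f1 b1]) (simp_all add: \<tau>1_def)
  qed (use K in auto)
  then have "runs b (For ''j'' (N (int K)) p) \<sigma>' (2 + K * (3 + 2))
      (\<lambda>\<tau>. \<forall>p<n. \<tau> arr (1 + int p) = \<sigma> arr (1 + int p) + \<theta> * move M K a p)"
    by (rule runs_conseq) (auto simp: I_def X_def)
  then show ?thesis
    unfolding Move_def p_def[symmetric] using arr code in0 a
    by (intro runs_Assign_Seq) (auto simp: \<sigma>'_def n_def algebra_simps)
qed

section \<open>Evaluating the objective\<close>

abbreviation cells :: "vname \<Rightarrow> state \<Rightarrow> nat \<Rightarrow> int" where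
  "cells a \<sigma> \<equiv> \<lambda>p. \<sigma> a (1 + int p)"

abbreviation pos :: "vname \<Rightarrow> aexp" where
  "pos p \<equiv> Plus (N 1) (V p)"

definition Copy :: "nat \<Rightarrow> nat \<Rightarrow> com" where
  "Copy r s = For ''p'' (eN r s) (Assign ''y'' (pos ''p'') (Get ''out'' (pos ''p'')))"

lemma mods_Copy [simp]: "mods (Copy r s) = {''p'', ''y''}"
  by (auto simp: Copy_def)

lemma runs_Copy:
  assumes "\<sigma> ''in'' 0 = int l" "int (r * s * l) < 2 ^ b"
    and "\<And>p. p < r * s * l \<Longrightarrow> \<bar>\<sigma> ''out'' (1 + int p)\<bar> < 2 ^ b"
  shows "runs b (Copy r s) \<sigma> (2 + r * s * l * 3)
    (\<lambda>\<tau>. \<forall>p<r * s * l. \<tau> ''y'' (1 + int p) = \<sigma> ''out'' (1 + int p))"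
proof -
  have "runs b (Copy r s) \<sigma> (2 + r * s * l * (1 + 2))
    ((\<lambda>j \<tau>. \<forall>p<j. \<tau> ''y'' (1 + int p) = \<sigma> ''out'' (1 + int p)) (r * s * l))"
    unfolding Copy_def
  proof (rule runs_For)
    fix j \<tau>
    assume j: "j < r * s * l" and I: "\<forall>p<j. \<tau> ''y'' (1 + int p) = \<sigma> ''out'' (1 + int p)"
      and p: "\<tau> ''p'' 0 = int j"
      and agr: "agree (insert ''p'' (mods (Assign ''y'' (pos ''p'') (Get ''out'' (pos ''p''))))) \<sigma> \<tau>"
    have "\<tau> ''out'' = \<sigma> ''out''" using agreeD[OF agr] by simp
    then show "runs b (Assign ''y'' (pos ''p'') (Get ''out'' (pos ''p''))) \<tau> 1
        (\<lambda>\<tau>. \<forall>p<Suc j. \<tau> ''y'' (1 + int p) = \<sigma> ''out'' (1 + int p))"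
      using I p assms(3)[OF j] by (intro runs_Assign) (auto simp: less_Suc_eq)
  qed (use assms(1,2) in \<open>auto simp: eN_def\<close>)
  then show ?thesis by (rule runs_conseq) auto
qed

definition Subtract :: "aexp \<Rightarrow> com" where
  "Subtract e = Assign ''z'' e (Minus (Get ''z'' e) (V ''q''))"

text \<open>One pass over the entries: each is subtracted from the residuals in \<open>''z''\<close>
  of the three lines through it, addressed by the formulas in \<open>hits\<close>, so that no line
  needs a summation loop of its own.\<close>

definition Accumulate :: "nat \<Rightarrow> nat \<Rightarrow> com" where
  "Accumulate r s =
    Seq (Set ''q'' (Get ''y'' (pos ''p'')))
    (Seq (Subtract (Div (V ''p'') eL))
    (Seq (Subtract (Plus (Plus (N (int (r * s))) (Times (Div (V ''p'') (Times (N (int s)) eL)) eL)) (eMod (V ''p'') eL)))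
    (Seq (Subtract (Plus (Plus (N (int (r * s))) (Times (N (int r)) eL)) (eMod (V ''p'') (Times (N (int s)) eL))))
    (Seq (Set ''f'' (Plus (V ''f'') (Times (Get ''in'' (pos ''p'')) (V ''q''))))
    (Cond (Less (V ''q'') (N 0)) (Set ''f'' (Minus (V ''f'') (Times eB (V ''q'')))) Skip)))))"

definition Penalize :: com where
  "Penalize = Cond (Less (Get ''z'' (V ''t'')) (N 0))
    (Set ''f'' (Minus (V ''f'') (Times eB (Get ''z'' (V ''t'')))))
    (Set ''f'' (Plus (V ''f'') (Times eB (Get ''z'' (V ''t'')))))"

definition Load :: "nat \<Rightarrow> nat \<Rightarrow> com" where
  "Load r s = Assign ''z'' (V ''t'') (Get ''in'' (Plus (Plus (N 1) (eN r s)) (V ''t'')))"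

definition Eval :: "nat \<Rightarrow> nat \<Rightarrow> com" where
  "Eval r s =
    Seq (For ''t'' (eT r s) (Load r s))
    (Seq (Set ''f'' (N 0))
    (Seq (For ''p'' (eN r s) (Accumulate r s))
    (For ''t'' (eT r s) Penalize)))"

lemma mods_Eval_parts [simp]:
  "mods (Accumulate r s) = {''q'', ''z'', ''f''}" "mods Penalize = {''f''}" "mods (Load r s) = {''z''}"
  by (auto simp: Accumulate_def Subtract_def Penalize_def Load_def)

lemma mods_Eval [simp]: "mods (Eval r s) = {''t'', ''z'', ''f'', ''p'', ''q''}"
  by (auto simp: Eval_def)

lemma hits_bound: "0 \<le> hits r s l p t" "hits r s l p t \<le> 3"
  by (simp_all add: hits_def)

lemma Subtract_step:
  assumes "aval e \<tau> = int i" "\<tau> ''q'' 0 = y" "\<bar>\<tau> ''z'' (int i) - y\<bar> < 2 ^ b"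
    and "runs b p (\<tau>(''z'' := (\<tau> ''z'')(int i := \<tau> ''z'' (int i) - y))) (k - 1) R" "0 < k"
  shows "runs b (Seq (Subtract e) p) \<tau> k R"
  unfolding Subtract_def using assms by (intro runs_Assign_Seq_val) auto

text \<open>\<open>Y\<close> bounds the entries of the arrays to be evaluated, \<open>b'\<close> the
  bit length of all values. \<open>z_less\<close> covers the residuals, with each entry counted up
  to three times as in \<open>hits_bound\<close>; \<open>f_less\<close> covers all partial values of
  \<open>F\<close>.\<close>

locale sized = search +
  fixes K L b' :: nat and Y :: int
  assumes l_pos: "0 < l" and Y: "0 \<le> Y"
    and len_less: "int (1 + n + nlines r s l) < 2 ^ b'"
    and z_less: "S + 3 * int n * Y < 2 ^ b'"
    and f_less: "int n * (S * Y + 4 * S * S * Y) + int (nlines r s l) * (4 * S * S * (S + 3 * int n * Y)) < 2 ^ b'"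
begin

definition input_at :: "state \<Rightarrow> bool" where
  "input_at \<sigma> \<longleftrightarrow> \<sigma> ''in'' 0 = int l \<and> (\<forall>p<n. \<sigma> ''in'' (1 + int p) = c p) \<and>
    (\<forall>t<nlines r s l. \<sigma> ''in'' (1 + int n + int t) = b t) \<and> \<sigma> ''S'' 0 = S"

lemma input_at_agree: "input_at \<sigma> \<Longrightarrow> agree A \<sigma> \<tau> \<Longrightarrow> ''in'' \<notin> A \<Longrightarrow> ''S'' \<notin> A \<Longrightarrow> input_at \<tau>"
  by (simp add: input_at_def agree_def)

lemma b_abs_le: "t < nlines r s l \<Longrightarrow> \<bar>b t\<bar> \<le> S"
  using member_le_sum[of t "{..<nlines r s l}" "\<lambda>t. \<bar>b t\<bar>"] b_le by simp

text \<open>\<open>e = 0\<close> and \<open>e = 1\<close> describe a summand before and after the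
  penalty of a negative entry is added; \<open>''f''\<close> takes both values.\<close>

lemma term_bound:
  assumes "p < n" "\<bar>y\<bar> \<le> Y" "e = 0 \<or> e = 1"
  shows "\<bar>c p * y + e * (4 * S * S * max 0 (- y))\<bar> \<le> S * Y + 4 * S * S * Y"
proof -
  have "\<bar>c p * y\<bar> \<le> S * Y"
    using c_le[OF assms(1)] assms(2) S2 unfolding abs_mult by (intro mult_mono) auto
  moreover have "0 \<le> e * (4 * S * S * max 0 (- y)) \<and> e * (4 * S * S * max 0 (- y)) \<le> 4 * S * S * Y"
    using assms(2,3) Y S2 by (elim disjE) (auto intro!: mult_left_mono)
  ultimately show ?thesis by linarith
qed

lemma b_S_less: "S < 2 ^ b'"
proof -
  have "0 \<le> 3 * int n * Y" using Y by simp
  then show ?thesis using z_less by linarith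
qed

lemma counts_less: "int n < 2 ^ b'" "int (nlines r s l) < 2 ^ b'"
  using len_less by linarith+

lemma runs_Load:
  assumes "input_at \<sigma>"
  shows "runs b' (For ''t'' (eT r s) (Load r s)) \<sigma> (2 + nlines r s l * 3)
    (\<lambda>\<tau>. \<forall>t<nlines r s l. \<tau> ''z'' (int t) = b t)"
proof -
  have "runs b' (For ''t'' (eT r s) (Load r s)) \<sigma> (2 + nlines r s l * (1 + 2))
    ((\<lambda>j \<tau>. \<forall>t<j. \<tau> ''z'' (int t) = b t) (nlines r s l))"
  proof (rule runs_For)
    fix j \<tau>
    assume j: "j < nlines r s l" and I: "\<forall>t<j. \<tau> ''z'' (int t) = b t" and t: "\<tau> ''t'' 0 = int j"
      and agr: "agree (insert ''t'' (mods (Load r s))) \<sigma> \<tau>"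
    have inp: "input_at \<tau>" using input_at_agree[OF assms agr] by simp
    have "aval (Get ''in'' (Plus (Plus (N 1) (eN r s)) (V ''t''))) \<tau> = b j"
      using inp j t unfolding input_at_def by simp
    moreover have "\<bar>b j\<bar> < 2 ^ b'" using b_abs_le[OF j] b_S_less by linarith
    moreover have "aval (V ''t'') \<tau> = int j" using t by simp
    ultimately show "runs b' (Load r s) \<tau> 1 (\<lambda>\<tau>. \<forall>t<Suc j. \<tau> ''z'' (int t) = b t)"
      unfolding Load_def using I by (intro runs_Assign_val) (auto simp: less_Suc_eq)
  qed (use assms counts_less in \<open>auto simp: input_at_def\<close>)
  then show ?thesis by (rule runs_conseq) auto
qed

lemma runs_Accumulate:
  assumes inp: "input_at \<sigma>" and z: "\<forall>t<nlines r s l. \<sigma> ''z'' (int t) = b t" and f: "\<sigma> ''f'' 0 = 0"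
    and y: "\<And>p. p < n \<Longrightarrow> \<bar>\<sigma> ''y'' (1 + int p)\<bar> \<le> Y"
  shows "runs b' (For ''p'' (eN r s) (Accumulate r s)) \<sigma> (2 + n * 9)
    (\<lambda>\<tau>. (\<forall>t<nlines r s l. \<tau> ''z'' (int t) = b t - line r s l (cells ''y'' \<sigma>) t) \<and>
      \<tau> ''f'' 0 = (\<Sum>p<n. c p * \<sigma> ''y'' (1 + int p) + 4 * S * S * max 0 (- \<sigma> ''y'' (1 + int p))))"
proof -
  define x where "x p = \<sigma> ''y'' (1 + int p)" for p
  define I where "I j \<tau> \<longleftrightarrow> (\<forall>t<nlines r s l. \<tau> ''z'' (int t) = b t - (\<Sum>p<j. hits r s l p t * x p)) \<and>
    \<tau> ''f'' 0 = (\<Sum>p<j. c p * x p + 4 * S * S * max 0 (- x p))" for j and \<tau> :: state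
  have x: "\<bar>x p\<bar> \<le> Y" if "p < n" for p using y[OF that] by (simp add: x_def)
  have "runs b' (For ''p'' (eN r s) (Accumulate r s)) \<sigma> (2 + n * (7 + 2)) (I n)"
  proof (rule runs_For)
    fix j \<tau>
    assume j: "j < n" and Ij: "I j \<tau>" and p: "\<tau> ''p'' 0 = int j"
      and agr: "agree (insert ''p'' (mods (Accumulate r s))) \<sigma> \<tau>"
    have inp': "input_at \<tau>" using input_at_agree[OF inp agr] by simp
    have yj: "\<tau> ''y'' (1 + int j) = x j" using agreeD[OF agr, of "''y''"] by (simp add: x_def)
    have in0: "\<tau> ''in'' 0 = int l" and inj: "\<tau> ''in'' (1 + int j) = c j" and S: "\<tau> ''S'' 0 = S"
      using inp' j by (simp_all add: input_at_def)
    define f0 where "f0 = (\<Sum>p<j. c p * x p + 4 * S * S * max 0 (- x p))"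
    have f0: "\<tau> ''f'' 0 = f0" using Ij by (simp add: I_def f0_def)
    have zt: "\<tau> ''z'' (int t) = b t - (\<Sum>p<j. hits r s l p t * x p)" if "t < nlines r s l" for t
      using Ij that by (simp add: I_def)
    have jn: "int (Suc j) \<le> int n" using j by (simp only: of_nat_le_iff Suc_le_eq)
    \<comment> \<open>The slack \<open>3 * Y\<close> is for the three subtractions of this round,
      whose intermediate results must fit as well.\<close>
    have zb: "\<bar>\<tau> ''z'' (int t)\<bar> + 3 * Y \<le> S + 3 * int n * Y" if "t < nlines r s l" for t
    proof -
      have "\<bar>\<Sum>p<j. hits r s l p t * x p\<bar> \<le> (\<Sum>p<j. 3 * Y)"
        using j x hits_bound[of r s l _ t] Y
        by (intro order_trans[OF sum_abs] sum_mono) (auto simp: abs_mult intro!: mult_mono)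
      then have "\<bar>\<Sum>p<j. hits r s l p t * x p\<bar> \<le> int j * (3 * Y)" by simp
      moreover have "int (Suc j) * (3 * Y) \<le> int n * (3 * Y)" using jn Y by (intro mult_right_mono) auto
      ultimately show ?thesis using zt[OF that] b_abs_le[OF that] by (simp add: algebra_simps)
    qed
    have xj: "\<bar>x j\<bar> \<le> Y" using x[OF j] .
    have C: "\<bar>c p * x p + e * (4 * S * S * max 0 (- x p))\<bar> \<le> S * Y + 4 * S * S * Y"
      if "p < n" "e = 0 \<or> e = 1" for p e
      using term_bound[OF that(1) x[OF that(1)] that(2)] .
    have f_bound: "\<bar>f0 + (c j * x j + e * (4 * S * S * max 0 (- x j)))\<bar> < 2 ^ b'" if "e = 0 \<or> e = 1" for e
    proof -
      have "\<bar>f0\<bar> \<le> (\<Sum>p<j. S * Y + 4 * S * S * Y)"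
        unfolding f0_def using C[where e = 1] j by (intro order_trans[OF sum_abs] sum_mono) auto
      then have "\<bar>f0\<bar> \<le> int j * (S * Y + 4 * S * S * Y)" by simp
      moreover have "int (Suc j) * (S * Y + 4 * S * S * Y) \<le> int n * (S * Y + 4 * S * S * Y)"
        using jn Y S2 by (intro mult_right_mono) auto
      moreover have "int (Suc j) * (S * Y + 4 * S * S * Y) = int j * (S * Y + 4 * S * S * Y) + (S * Y + 4 * S * S * Y)"
        by (simp add: algebra_simps)
      moreover have "0 \<le> int (nlines r s l) * (4 * S * S * (S + 3 * int n * Y))"
        using Y S2 by simp
      ultimately show ?thesis using C[OF j that] f_less by linarith
    qed
    \<comment> \<open>The three lines through position \<open>j\<close>. The updates are tracked
      with \<open>of_bool\<close>, without assuming that these numbers differ.\<close>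
    define ia where "ia = j div l"
    define ib where "ib = r * s + j div (s * l) * l + j mod l"
    define ic where "ic = r * s + r * l + j mod (s * l)"
    have "0 < s" "0 < r" using j by (auto intro: gr0I)
    then have sl: "0 < s * l" using l_pos by simp
    have ia: "ia < nlines r s l" using j by (simp add: ia_def less_mult_imp_div_less trans_less_add1)
    have "j div (s * l) < r" using j by (simp add: less_mult_imp_div_less mult.assoc)
    then have "j div (s * l) * l + j mod l < r * l" using l_pos by (intro mult_add_less) auto
    then have ib: "ib < nlines r s l" by (simp add: ib_def)
    have ic: "ic < nlines r s l" using sl by (simp add: ic_def)
    define \<tau>1 where "\<tau>1 = \<tau>(''q'' := (\<tau> ''q'')(0 := x j))"
    define \<tau>2 where "\<tau>2 = \<tau>1(''z'' := (\<tau>1 ''z'')(int ia := \<tau>1 ''z'' (int ia) - x j))"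
    define \<tau>3 where "\<tau>3 = \<tau>2(''z'' := (\<tau>2 ''z'')(int ib := \<tau>2 ''z'' (int ib) - x j))"
    define \<tau>4 where "\<tau>4 = \<tau>3(''z'' := (\<tau>3 ''z'')(int ic := \<tau>3 ''z'' (int ic) - x j))"
    define \<tau>5 where "\<tau>5 = \<tau>4(''f'' := (\<tau>4 ''f'')(0 := f0 + c j * x j))"
    have q: "\<tau>1 ''q'' 0 = x j" "\<tau>2 ''q'' 0 = x j" "\<tau>3 ''q'' 0 = x j" "\<tau>4 ''q'' 0 = x j" "\<tau>5 ''q'' 0 = x j"
      by (simp_all add: \<tau>1_def \<tau>2_def \<tau>3_def \<tau>4_def \<tau>5_def)
    have same: "\<tau>1 ''p'' 0 = int j" "\<tau>2 ''p'' 0 = int j" "\<tau>3 ''p'' 0 = int j" "\<tau>4 ''p'' 0 = int j"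
      "\<tau>1 ''in'' = \<tau> ''in''" "\<tau>2 ''in'' = \<tau> ''in''" "\<tau>3 ''in'' = \<tau> ''in''" "\<tau>4 ''in'' = \<tau> ''in''"
      "\<tau>5 ''S'' 0 = S" "\<tau>4 ''f'' 0 = f0" "\<tau>5 ''f'' 0 = f0 + c j * x j"
      using p S f0 by (simp_all add: \<tau>1_def \<tau>2_def \<tau>3_def \<tau>4_def \<tau>5_def)
    have z1: "\<tau>1 ''z'' i = \<tau> ''z'' i" for i by (simp add: \<tau>1_def)
    have z2: "\<tau>2 ''z'' (int i) = \<tau> ''z'' (int i) - of_bool (ia = i) * x j" for i by (simp add: \<tau>2_def z1)
    have z3: "\<tau>3 ''z'' (int i) = \<tau> ''z'' (int i) - (of_bool (ia = i) + of_bool (ib = i)) * x j" for i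
      by (simp add: \<tau>3_def z2 algebra_simps)
    have z4: "\<tau>4 ''z'' (int i) = \<tau> ''z'' (int i) - hits r s l j i * x j" for i
    proof -
      have "hits r s l j i = of_bool (ia = i) + of_bool (ib = i) + of_bool (ic = i)"
        by (simp add: hits_def ia_def ib_def ic_def)
      then show ?thesis by (simp add: \<tau>4_def z3 algebra_simps)
    qed
    have e1: "aval (Div (V ''p'') eL) \<tau>1 = int ia"
      by (simp add: same in0 ia_def zdiv_int)
    have e2: "aval (Plus (Plus (N (int (r * s))) (Times (Div (V ''p'') (Times (N (int s)) eL)) eL)) (eMod (V ''p'') eL)) \<tau>2 = int ib"
      by (simp add: same in0 ib_def zdiv_int zmod_int)
    have e3: "aval (Plus (Plus (N (int (r * s))) (Times (N (int r)) eL)) (eMod (V ''p'') (Times (N (int s)) eL))) \<tau>3 = int ic"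
      by (simp add: same in0 ic_def zmod_int)
    have once: "\<bar>of_bool A * x j\<bar> \<le> Y" for A using xj Y by simp
    have bound1: "\<bar>\<tau>1 ''z'' (int ia) - x j\<bar> < 2 ^ b'"
      using zb[OF ia] xj z_less unfolding z1 by linarith
    have bound2: "\<bar>\<tau>2 ''z'' (int ib) - x j\<bar> < 2 ^ b'"
      using zb[OF ib] xj z_less once[of "ia = ib"] unfolding z2 by linarith
    have bound3: "\<bar>\<tau>3 ''z'' (int ic) - x j\<bar> < 2 ^ b'"
      using zb[OF ic] xj z_less once[of "ia = ic"] once[of "ib = ic"] unfolding z3 distrib_right by linarith
    have I5: "I (Suc j) \<tau>'" if "\<tau>' ''z'' = \<tau>4 ''z''" "\<tau>' ''f'' 0 = f0 + (c j * x j + 4 * S * S * max 0 (- x j))" for \<tau>'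
      unfolding I_def using that z4 zt by (simp add: f0_def)
    let ?p5 = "Cond (Less (V ''q'') (N 0)) (Set ''f'' (Minus (V ''f'') (Times eB (V ''q'')))) Skip"
    let ?p4 = "Seq (Set ''f'' (Plus (V ''f'') (Times (Get ''in'' (pos ''p'')) (V ''q'')))) ?p5"
    let ?p3 = "Seq (Subtract (Plus (Plus (N (int (r * s))) (Times (N (int r)) eL)) (eMod (V ''p'') (Times (N (int s)) eL)))) ?p4"
    let ?p2 = "Seq (Subtract (Plus (Plus (N (int (r * s))) (Times (Div (V ''p'') (Times (N (int s)) eL)) eL)) (eMod (V ''p'') eL))) ?p3"
    let ?p1 = "Seq (Subtract (Div (V ''p'') eL)) ?p2"
    have r5: "runs b' ?p5 \<tau>5 2 (I (Suc j))"
    proof (rule runs_Cond)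
      assume "bval (Less (V ''q'') (N 0)) \<tau>5"
      then have neg: "x j < 0" by (simp add: q)
      have val: "aval (Minus (V ''f'') (Times eB (V ''q''))) \<tau>5 = f0 + (c j * x j + 4 * S * S * max 0 (- x j))"
        using neg by (simp add: q same)
      show "runs b' (Set ''f'' (Minus (V ''f'') (Times eB (V ''q'')))) \<tau>5 (2 - 1) (I (Suc j))"
        using f_bound[of 1] by (intro runs_Assign_val[OF aval.simps(1) val] I5) (simp_all add: \<tau>5_def)
    next
      assume "\<not> bval (Less (V ''q'') (N 0)) \<tau>5"
      then have "0 \<le> x j" by (simp add: q)
      then show "runs b' Skip \<tau>5 (2 - 1) (I (Suc j))"
        by (intro runs_Skip I5) (auto simp: \<tau>5_def)
    qed simp
    have "runs b' ?p4 \<tau>4 3 (I (Suc j))"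
      using f_bound[of 0] r5
      by (intro runs_Assign_Seq_val[OF aval.simps(1), where v = "f0 + c j * x j"]) (simp_all add: q same inj \<tau>5_def)
    then have "runs b' ?p3 \<tau>3 4 (I (Suc j))"
      by - (rule Subtract_step[OF e3 q(3) bound3], simp_all add: \<tau>4_def)
    then have "runs b' ?p2 \<tau>2 5 (I (Suc j))"
      by - (rule Subtract_step[OF e2 q(2) bound2], simp_all add: \<tau>3_def)
    then have "runs b' ?p1 \<tau>1 6 (I (Suc j))"
      by - (rule Subtract_step[OF e1 q(1) bound1], simp_all add: \<tau>2_def)
    moreover have "\<bar>x j\<bar> < 2 ^ b'"
      using zb[OF ia] xj z_less by linarith
    ultimately show "runs b' (Accumulate r s) \<tau> 7 (I (Suc j))"
      unfolding Accumulate_def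
      by (intro runs_Assign_Seq_val[OF aval.simps(1), where v = "x j"]) (simp_all add: p yj \<tau>1_def)
  next
    show "I 0 \<sigma>" using z f by (simp add: I_def)
  qed (use inp counts_less in \<open>auto simp: I_def input_at_def\<close>)
  then show ?thesis
    by (rule runs_conseq) (auto simp: I_def line_def x_def)
qed

lemma runs_Penalize:
  assumes inp: "input_at \<sigma>" and f: "\<bar>\<sigma> ''f'' 0\<bar> \<le> int n * (S * Y + 4 * S * S * Y)"
    and z: "\<And>t. t < nlines r s l \<Longrightarrow> \<bar>\<sigma> ''z'' (int t)\<bar> \<le> S + 3 * int n * Y"
  shows "runs b' (For ''t'' (eT r s) Penalize) \<sigma> (2 + nlines r s l * 4)
    (\<lambda>\<tau>. \<tau> ''f'' 0 = \<sigma> ''f'' 0 + 4 * S * S * (\<Sum>t<nlines r s l. \<bar>\<sigma> ''z'' (int t)\<bar>))"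
proof -
  define I where "I j \<tau> \<longleftrightarrow> \<tau> ''f'' 0 = \<sigma> ''f'' 0 + 4 * S * S * (\<Sum>t<j. \<bar>\<sigma> ''z'' (int t)\<bar>)"
    for j and \<tau> :: state
  have "runs b' (For ''t'' (eT r s) Penalize) \<sigma> (2 + nlines r s l * (2 + 2)) (I (nlines r s l))"
  proof (rule runs_For)
    fix j \<tau>
    assume j: "j < nlines r s l" and Ij: "I j \<tau>" and t: "\<tau> ''t'' 0 = int j"
      and agr: "agree (insert ''t'' (mods Penalize)) \<sigma> \<tau>"
    have S: "\<tau> ''S'' 0 = S" and zj: "\<tau> ''z'' = \<sigma> ''z''"
      using agreeD[OF agr] inp by (simp_all add: input_at_def)
    define v where "v = \<sigma> ''f'' 0 + 4 * S * S * (\<Sum>t<Suc j. \<bar>\<sigma> ''z'' (int t)\<bar>)"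
    have v_eq: "v = \<tau> ''f'' 0 + 4 * S * S * \<bar>\<sigma> ''z'' (int j)\<bar>"
      using Ij by (simp add: v_def I_def algebra_simps)
    have v: "\<bar>v\<bar> < 2 ^ b'"
    proof -
      let ?Z = "S + 3 * int n * Y"
      have "(\<Sum>t<Suc j. \<bar>\<sigma> ''z'' (int t)\<bar>) \<le> (\<Sum>t<nlines r s l. ?Z)"
        using j z by (intro order_trans[OF sum_mono2[of "{..<nlines r s l}" "{..<Suc j}"] sum_mono]) auto
      then have "4 * S * S * (\<Sum>t<Suc j. \<bar>\<sigma> ''z'' (int t)\<bar>) \<le> 4 * S * S * (int (nlines r s l) * ?Z)"
        using S2 by (intro mult_left_mono) auto
      moreover have "4 * S * S * (int (nlines r s l) * ?Z) = int (nlines r s l) * (4 * S * S * ?Z)" by simp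
      moreover have "0 \<le> 4 * S * S * (\<Sum>t<Suc j. \<bar>\<sigma> ''z'' (int t)\<bar>)"
        using S2 by (intro mult_nonneg_nonneg sum_nonneg) auto
      ultimately show ?thesis using f f_less unfolding v_def by linarith
    qed
    show "runs b' Penalize \<tau> 2 (I (Suc j))"
      unfolding Penalize_def
    proof (rule runs_Cond)
      assume "bval (Less (Get ''z'' (V ''t'')) (N 0)) \<tau>"
      then have "\<sigma> ''z'' (int j) < 0" by (simp add: t zj)
      then have "aval (Minus (V ''f'') (Times eB (Get ''z'' (V ''t'')))) \<tau> = v"
        by (simp add: v_eq t zj S)
      then show "runs b' (Set ''f'' (Minus (V ''f'') (Times eB (Get ''z'' (V ''t''))))) \<tau> (2 - 1) (I (Suc j))"
        using v by (intro runs_Assign_val[OF aval.simps(1)]) (auto simp: I_def v_def)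
    next
      assume "\<not> bval (Less (Get ''z'' (V ''t'')) (N 0)) \<tau>"
      then have "0 \<le> \<sigma> ''z'' (int j)" by (simp add: t zj)
      then have "aval (Plus (V ''f'') (Times eB (Get ''z'' (V ''t'')))) \<tau> = v"
        by (simp add: v_eq t zj S)
      then show "runs b' (Set ''f'' (Plus (V ''f'') (Times eB (Get ''z'' (V ''t''))))) \<tau> (2 - 1) (I (Suc j))"
        using v by (intro runs_Assign_val[OF aval.simps(1)]) (auto simp: I_def v_def)
    qed simp
  next
    show "I 0 \<sigma>" by (simp add: I_def)
  qed (use inp counts_less in \<open>auto simp: I_def input_at_def\<close>)
  then show ?thesis by (rule runs_conseq) (auto simp: I_def)
qed

lemma runs_Eval:
  assumes inp: "input_at \<sigma>" and y: "\<And>p. p < n \<Longrightarrow> \<bar>\<sigma> ''y'' (1 + int p)\<bar> \<le> Y"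
  shows "runs b' (Eval r s) \<sigma> (7 + nlines r s l * 7 + n * 9) (\<lambda>\<tau>. \<tau> ''f'' 0 = F (cells ''y'' \<sigma>))"
proof -
  define x where "x p = \<sigma> ''y'' (1 + int p)" for p
  have x: "\<bar>x p\<bar> \<le> Y" if "p < n" for p using y[OF that] by (simp add: x_def)
  have Z: "\<bar>b t - line r s l x t\<bar> \<le> S + 3 * int n * Y" if "t < nlines r s l" for t
  proof -
    have "\<bar>line r s l x t\<bar> \<le> (\<Sum>p<n. 3 * Y)"
      unfolding line_def using x hits_bound[of r s l _ t] Y
      by (intro order_trans[OF sum_abs] sum_mono) (auto simp: abs_mult intro!: mult_mono)
    then show ?thesis using b_abs_le[OF that] by simp
  qed
  have Fb: "\<bar>\<Sum>p<n. c p * x p + 4 * S * S * max 0 (- x p)\<bar> \<le> int n * (S * Y + 4 * S * S * Y)"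
  proof -
    have "\<bar>c p * x p + 4 * S * S * max 0 (- x p)\<bar> \<le> S * Y + 4 * S * S * Y" if "p < n" for p
      using term_bound[OF that x[OF that], of 1] by simp
    then have "(\<Sum>p<n. \<bar>c p * x p + 4 * S * S * max 0 (- x p)\<bar>) \<le> (\<Sum>p<n. S * Y + 4 * S * S * Y)"
      by (intro sum_mono) auto
    then show ?thesis by (intro order_trans[OF sum_abs]) simp
  qed
  show ?thesis
    unfolding Eval_def
  proof (rule runs_Seq[OF runs_Load[OF inp]])
    fix \<tau>1 assume \<tau>1: "\<forall>t<nlines r s l. \<tau>1 ''z'' (int t) = b t"
      and agr1: "agree (mods (For ''t'' (eT r s) (Load r s))) \<sigma> \<tau>1"
    define \<tau>2 where "\<tau>2 = \<tau>1(''f'' := (\<tau>1 ''f'')(0 := 0))"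
    have agr2: "agree {''t'', ''z'', ''f''} \<sigma> \<tau>2" using agr1 by (simp add: agree_def \<tau>2_def)
    have inp2: "input_at \<tau>2" using input_at_agree[OF inp agr2] by simp
    have y2: "\<tau>2 ''y'' = \<sigma> ''y''" using agreeD[OF agr2] by simp
    have "runs b' (For ''p'' (eN r s) (Accumulate r s)) \<tau>2 (2 + n * 9)
      (\<lambda>\<tau>. (\<forall>t<nlines r s l. \<tau> ''z'' (int t) = b t - line r s l x t) \<and>
        \<tau> ''f'' 0 = (\<Sum>p<n. c p * x p + 4 * S * S * max 0 (- x p)))"
      unfolding x_def y2[symmetric]
      by (rule runs_Accumulate) (use inp2 \<tau>1 y y2 in \<open>auto simp: \<tau>2_def\<close>)
    then have "runs b' (Seq (For ''p'' (eN r s) (Accumulate r s)) (For ''t'' (eT r s) Penalize)) \<tau>2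
      (4 + nlines r s l * 4 + n * 9) (\<lambda>\<tau>. \<tau> ''f'' 0 = F x)"
    proof (rule runs_Seq)
      fix \<tau>3 assume \<tau>3: "(\<forall>t<nlines r s l. \<tau>3 ''z'' (int t) = b t - line r s l x t) \<and>
        \<tau>3 ''f'' 0 = (\<Sum>p<n. c p * x p + 4 * S * S * max 0 (- x p))"
        and agr3: "agree (mods (For ''p'' (eN r s) (Accumulate r s))) \<tau>2 \<tau>3"
      have "input_at \<tau>3" using input_at_agree[OF inp2 agr3] by simp
      from runs_Penalize[OF this]
      have "runs b' (For ''t'' (eT r s) Penalize) \<tau>3 (2 + nlines r s l * 4)
        (\<lambda>\<tau>. \<tau> ''f'' 0 = \<tau>3 ''f'' 0 + 4 * S * S * (\<Sum>t<nlines r s l. \<bar>\<tau>3 ''z'' (int t)\<bar>))"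
        using \<tau>3 Fb Z by simp
      moreover have "\<tau>3 ''f'' 0 + 4 * S * S * (\<Sum>t<nlines r s l. \<bar>\<tau>3 ''z'' (int t)\<bar>) = F x"
        using \<tau>3 by (simp add: penalized_def excess_def sum.distrib sum_distrib_left distrib_left mult.assoc)
      ultimately show "runs b' (For ''t'' (eT r s) Penalize) \<tau>3 (2 + nlines r s l * 4) (\<lambda>\<tau>. \<tau> ''f'' 0 = F x)"
        by simp
    qed simp
    note * = this[unfolded \<tau>2_def]
    show "runs b' (Seq (Set ''f'' (N 0)) (Seq (For ''p'' (eN r s) (Accumulate r s)) (For ''t'' (eT r s) Penalize))) \<tau>1
      (5 + nlines r s l * 4 + n * 9) (\<lambda>\<tau>. \<tau> ''f'' 0 = F (cells ''y'' \<sigma>))"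
      by (rule runs_Assign_Seq_val[OF aval.simps(1) aval.simps(1)], simp, simp, rule runs_conseq[OF *])
        (simp_all add: x_def[abs_def])
  qed simp
qed

end

section \<open>Local search\<close>

text \<open>
  The current array occupies the cells \<open>1, \<dots>, n\<close> of \<open>''out''\<close>; the variables \<open>''fb''\<close>,
  \<open>''bl''\<close> and \<open>''bc''\<close> hold the value, the scale and the code of the best move seen so far.
\<close>

definition Candidate :: "nat \<Rightarrow> nat \<Rightarrow> nat \<Rightarrow> com" where
  "Candidate r s K =
    Seq (Copy r s)
    (Seq (Move r s K ''y'' ''lam'' ''code'')
    (Seq (Eval r s)
    (Cond (Less (V ''f'') (V ''fb''))
      (Seq (Set ''fb'' (V ''f'')) (Seq (Set ''bl'' (V ''lam'')) (Set ''bc'' (V ''code''))))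
      Skip)))"

text \<open>The starting value \<open>eD\<close> of \<open>''fb''\<close> lies above the value of
  the current array, so trying the zero move already replaces it, and \<open>''bl''\<close>,
  \<open>''bc''\<close> describe a genuine move when it is applied.\<close>

definition Improve :: "nat \<Rightarrow> nat \<Rightarrow> nat \<Rightarrow> com" where
  "Improve r s K =
    Seq (Set ''fb'' eD)
    (Seq (Set ''bl'' (N 0))
    (Seq (Set ''lam'' (N 1))
    (Seq (For ''i'' (V ''L'')
      (Seq (For ''code'' (ePow r s K) (Candidate r s K)) (Set ''lam'' (Times (N 2) (V ''lam'')))))
    (Move r s K ''out'' ''bl'' ''bc''))))"

text \<open>With \<open>N = M ^ K * L\<close> pairs of code and scale,
  \<open>geometric_decrease\<close> asks for \<open>N * L\<close> rounds.\<close>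

definition Search :: "nat \<Rightarrow> nat \<Rightarrow> nat \<Rightarrow> com" where
  "Search r s K = For ''step'' (Times (ePow r s K) (Times (V ''L'') (V ''L''))) (Improve r s K)"

lemma mods_search [simp]:
  "mods (Candidate r s K) = {''p'', ''y'', ''u'', ''e'', ''j'', ''t'', ''z'', ''f'', ''q'', ''fb'', ''bl'', ''bc''}"
  "mods (Improve r s K) = {''p'', ''y'', ''u'', ''e'', ''j'', ''t'', ''z'', ''f'', ''q'', ''fb'', ''bl'', ''bc'',
     ''lam'', ''i'', ''code'', ''out''}"
  by (auto simp: Candidate_def Improve_def)

text \<open>\<open>Y\<close> allows for a current entry of at most \<open>5 * S\<close>, changed by
  at most \<open>K\<close> units at a scale up to \<open>2 ^ L\<close>. \<open>L\<close> is both the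
  number of scales and a bound on the bit length of the initial gap.\<close>

locale runnable = sized +
  assumes Y_eq: "Y = 5 * S + int K * 2 ^ L" and Y_less: "Y < 2 ^ b'"
    and L: "8 * S * S * S < 2 ^ L" and L_less: "(2 :: int) ^ L < 2 ^ b'"
    and M_less: "int (2 * n + 2) < 2 ^ b'" and K_less: "int K < 2 ^ b'"
    and Q_less: "int ((2 * n + 2) ^ K * (L * L)) < 2 ^ b'"
    and graver: "\<And>d. \<exists>p<n. d p \<noteq> 0 \<Longrightarrow>
       \<exists>g. (\<exists>p<n. g p \<noteq> 0) \<and> (\<Sum>p<n. \<bar>g p\<bar>) \<le> int K \<and> conform r s l g d"
begin

abbreviation "M \<equiv> 2 * n + 2"
abbreviation "Q \<equiv> M ^ K"
abbreviation "candidate_steps \<equiv> 17 + 12 * n + 5 * K + 7 * nlines r s l"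
abbreviation "sweep_steps \<equiv> L * (5 + Q * (19 + 12 * n + 5 * K + 7 * nlines r s l))"

definition moved :: "(nat \<Rightarrow> int) \<Rightarrow> nat \<Rightarrow> nat \<Rightarrow> int" where
  "moved x i a = F (\<lambda>p. x p + 2 ^ i * move M K a p)"

lemma L_pos: "0 < L"
proof (rule gr0I)
  assume "L = 0"
  then have "8 * S * S * S < 1" using L by simp
  moreover have "8 * S * S * S = 8 * (S * S * S)" by simp
  ultimately show False using S_le_cube S2 by linarith
qed

lemma b'_pos: "0 < b'"
  using b_S_less S2 by (intro gr0I) simp

lemma Q_bound: "a \<le> Q \<Longrightarrow> int a < 2 ^ b'"
proof -
  assume "a \<le> Q"
  also have "Q = Q * (1 * 1)" by simp
  also have "\<dots> \<le> Q * (L * L)" using L_pos by (intro mult_le_mono) auto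
  finally have "int a \<le> int (Q * (L * L))" by (rule of_nat_mono)
  then show ?thesis using Q_less by linarith
qed

lemma L_bound: "int L < 2 ^ b'"
  using of_nat_less_two_power[of L, where 'a = int] L_less by linarith

lemma scale_le: "i \<le> L \<Longrightarrow> int K * 2 ^ i \<le> int K * 2 ^ L"
  by (intro mult_left_mono power_increasing) auto

lemma moved_entry_le:
  assumes "\<bar>x p\<bar> \<le> 5 * S" "i \<le> L"
  shows "\<bar>x p + 2 ^ i * move M K a p\<bar> \<le> Y"
proof -
  have "\<bar>2 ^ i * move M K a p\<bar> \<le> 2 ^ i * int K"
    using abs_move_le[of M K a p] unfolding abs_mult by (intro mult_mono) auto
  then show ?thesis using scale_le[OF assms(2)] assms(1) unfolding Y_eq by (simp add: mult.commute)
qed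

lemma D_less: "8 * S * S * S < 2 ^ b'"
  using L L_less by linarith

text \<open>Together with the starting value from above, this bounds everything stored in
  \<open>''fb''\<close>.\<close>

lemma F_ge: "- (8 * S * S * S) \<le> F x"
proof -
  have "0 \<le> 3 * (S * S) * E x" using excess_nonneg by simp
  moreover have "8 * S * S * S = 8 * (S * S * S)" by simp
  ultimately show ?thesis using F_lower[of x] S_le_cube S2 by linarith
qed

lemma runs_Candidate:
  assumes inp: "input_at \<sigma>" and x: "\<And>p. p < n \<Longrightarrow> \<bar>\<sigma> ''out'' (1 + int p)\<bar> \<le> 5 * S"
    and i: "i < L" "\<sigma> ''lam'' 0 = 2 ^ i" and a: "a < Q" "\<sigma> ''code'' 0 = int a"
    and fb: "\<sigma> ''fb'' 0 \<le> 8 * S * S * S"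
  shows "runs b' (Candidate r s K) \<sigma> (candidate_steps)
    (\<lambda>\<tau>. if moved (cells ''out'' \<sigma>) i a < \<sigma> ''fb'' 0
      then \<tau> ''fb'' 0 = moved (cells ''out'' \<sigma>) i a \<and> \<tau> ''bl'' 0 = 2 ^ i \<and> \<tau> ''bc'' 0 = int a
      else \<tau> ''fb'' 0 = \<sigma> ''fb'' 0 \<and> \<tau> ''bl'' 0 = \<sigma> ''bl'' 0 \<and> \<tau> ''bc'' 0 = \<sigma> ''bc'' 0)" (is "runs b' _ _ _ ?R")
proof -
  define x where "x p = \<sigma> ''out'' (1 + int p)" for p
  have x5: "\<bar>x p\<bar> \<le> 5 * S" if "p < n" for p using assms(2)[OF that] by (simp add: x_def)
  have K0: "0 \<le> int K * 2 ^ L" by simp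
  have in0: "\<sigma> ''in'' 0 = int l" using inp by (simp add: input_at_def)
  have iL: "i \<le> L" using i(1) by simp
  have a_less: "\<bar>int a\<bar> < 2 ^ b'" using Q_bound[of a] a(1) by simp
  have i_less: "\<bar>(2 :: int) ^ i\<bar> < 2 ^ b'"
    using L_less power_increasing[OF iL, of "2 :: int"] by simp
  have copy: "runs b' (Copy r s) \<sigma> (2 + n * 3) (\<lambda>\<tau>. \<forall>p<n. \<tau> ''y'' (1 + int p) = x p)"
    unfolding x_def
  proof (rule runs_Copy[where l = l])
    show "\<sigma> ''in'' 0 = int l" "int n < 2 ^ b'" using in0 counts_less by simp_all
    fix p assume "p < n"
    then show "\<bar>\<sigma> ''out'' (1 + int p)\<bar> < 2 ^ b'"
      using x5[of p] Y_less K0 unfolding Y_eq x_def by linarith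
  qed
  let ?store = "Cond (Less (V ''f'') (V ''fb''))
    (Seq (Set ''fb'' (V ''f'')) (Seq (Set ''bl'' (V ''lam'')) (Set ''bc'' (V ''code'')))) Skip"
  show ?thesis
    unfolding Candidate_def
  proof (rule runs_Seq[OF copy])
    fix \<tau>1 assume y1: "\<forall>p<n. \<tau>1 ''y'' (1 + int p) = x p" and agr1: "agree (mods (Copy r s)) \<sigma> \<tau>1"
    have s1: "\<tau>1 ''in'' 0 = int l" "\<tau>1 ''lam'' 0 = 2 ^ i" "\<tau>1 ''code'' 0 = int a"
      using agreeD[OF agr1] in0 i a by simp_all
    have mv: "runs b' (Move r s K ''y'' ''lam'' ''code'') \<tau>1 (4 + 5 * K)
        (\<lambda>\<tau>. \<forall>p<n. \<tau> ''y'' (1 + int p) = \<tau>1 ''y'' (1 + int p) + 2 ^ i * move M K a p)"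
    proof (rule runs_Move[where r = r and s = s and l = l])
      show "\<tau>1 ''in'' 0 = int l" "\<tau>1 ''lam'' 0 = 2 ^ i" "\<tau>1 ''code'' 0 = int a" by (fact s1)+
      show "int M < 2 ^ b'" "int K < 2 ^ b'" by (fact M_less, fact K_less)
      show "int a < 2 ^ b'" using a_less by simp
      have le: "int K * \<bar>2 ^ i\<bar> \<le> int K * 2 ^ L" using scale_le[OF iL] by simp
      show "int K * \<bar>2 ^ i\<bar> < 2 ^ b'" using le Y_less S2 unfolding Y_eq by linarith
      fix p assume "p < n"
      then show "\<bar>\<tau>1 ''y'' (1 + int p)\<bar> + int K * \<bar>2 ^ i\<bar> < 2 ^ b'"
        using le x5[of p] Y_less y1 unfolding Y_eq by auto
    qed auto
    show "runs b' (Seq (Move r s K ''y'' ''lam'' ''code'') (Seq (Eval r s)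
        ?store)) \<tau>1 (15 + 9 * n + 5 * K + 7 * nlines r s l) ?R"
    proof (rule runs_Seq[OF mv])
      fix \<tau>2 assume y2: "\<forall>p<n. \<tau>2 ''y'' (1 + int p) = \<tau>1 ''y'' (1 + int p) + 2 ^ i * move M K a p"
        and agr2: "agree (mods (Move r s K ''y'' ''lam'' ''code'')) \<tau>1 \<tau>2"
      have y: "\<tau>2 ''y'' (1 + int p) = x p + 2 ^ i * move M K a p" if "p < n" for p
        using y1 y2 that by simp
      have inp2: "input_at \<tau>2" using input_at_agree[OF input_at_agree[OF inp agr1] agr2] by simp
      have F2: "F (cells ''y'' \<tau>2) = moved x i a"
        unfolding moved_def by (rule penalized_cong[OF y])
      have ev: "runs b' (Eval r s) \<tau>2 (7 + nlines r s l * 7 + n * 9) (\<lambda>\<tau>. \<tau> ''f'' 0 = moved x i a)"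
        unfolding F2[symmetric]
        by (rule runs_Eval[OF inp2]) (use y moved_entry_le[OF x5 iL] in simp)
      show "runs b' (Seq (Eval r s) ?store) \<tau>2 (11 + 9 * n + 7 * nlines r s l) ?R"
      proof (rule runs_Seq[OF ev])
        fix \<tau>3 assume f: "\<tau>3 ''f'' 0 = moved x i a" and agr3: "agree (mods (Eval r s)) \<tau>2 \<tau>3"
        have s3: "\<tau>3 ''lam'' 0 = 2 ^ i" "\<tau>3 ''code'' 0 = int a" "\<tau>3 ''fb'' = \<sigma> ''fb''" "\<tau>3 ''bl'' = \<sigma> ''bl''" "\<tau>3 ''bc'' = \<sigma> ''bc''"
          using agreeD[OF agr3] agreeD[OF agr2] agreeD[OF agr1] i(2) a(2) by simp_all
        show "runs b' ?store \<tau>3 4 ?R"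
        proof (rule runs_Cond)
          assume "bval (Less (V ''f'') (V ''fb'')) \<tau>3"
          then have less: "moved x i a < \<sigma> ''fb'' 0" by (simp add: f s3)
          then have "\<bar>moved x i a\<bar> < 2 ^ b'"
            using fb F_ge[of "\<lambda>p. x p + 2 ^ i * move M K a p"] D_less unfolding moved_def by linarith
          then show "runs b' (Seq (Set ''fb'' (V ''f'')) (Seq (Set ''bl'' (V ''lam'')) (Set ''bc'' (V ''code'')))) \<tau>3 (4 - 1) ?R"
            using less a_less i_less
            by (intro runs_Assign_Seq runs_Assign) (simp_all add: f s3 x_def[abs_def])
        next
          assume "\<not> bval (Less (V ''f'') (V ''fb'')) \<tau>3"
          then show "runs b' Skip \<tau>3 (4 - 1) ?R"
            by (intro runs_Skip) (simp_all add: f s3 x_def[abs_def])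
        qed simp
      qed simp
    qed simp
  qed simp
qed

text \<open>Invariant of both search loops; the disjunct with \<open>8 * S * S * S\<close> covers
  the time before the first improvement.\<close>

definition best_of :: "(nat \<Rightarrow> int) \<Rightarrow> (nat \<times> nat) set \<Rightarrow> state \<Rightarrow> bool" where
  "best_of x A \<tau> \<longleftrightarrow> (\<forall>(i, a)\<in>A. \<tau> ''fb'' 0 \<le> moved x i a) \<and> \<tau> ''fb'' 0 \<le> 8 * S * S * S \<and>
    (\<tau> ''fb'' 0 = 8 * S * S * S \<or>
     (\<exists>i<L. \<exists>a<Q. \<tau> ''fb'' 0 = moved x i a \<and> \<tau> ''bl'' 0 = 2 ^ i \<and> \<tau> ''bc'' 0 = int a))"

lemma best_of_upd:
  "v \<notin> {''fb'', ''bl'', ''bc''} \<Longrightarrow> best_of x A (\<tau>(v := w)) = best_of x A \<tau>"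
  by (auto simp: best_of_def)

lemma runs_codes:
  assumes inp: "input_at \<sigma>" and x: "\<And>p. p < n \<Longrightarrow> \<bar>x p\<bar> \<le> 5 * S"
    and x_eq: "\<And>p. \<sigma> ''out'' (1 + int p) = x p"
    and i: "i < L" "\<sigma> ''lam'' 0 = 2 ^ i" and best: "best_of x ({..<i} \<times> {..<Q}) \<sigma>"
  shows "runs b' (For ''code'' (ePow r s K) (Candidate r s K)) \<sigma>
    (2 + Q * (2 + candidate_steps)) (best_of x ({..<Suc i} \<times> {..<Q}))"
proof -
  \<comment> \<open>Pairs are processed lexicographically: all codes at the scales below
    \<open>i\<close>, then the codes below \<open>a\<close> at scale \<open>i\<close>.\<close>
  define J where "J a = best_of x ({..<i} \<times> {..<Q} \<union> {i} \<times> {..<a})" for a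
  have "runs b' (For ''code'' (ePow r s K) (Candidate r s K)) \<sigma>
    (2 + Q * ((candidate_steps) + 2)) (J Q)"
  proof (rule runs_For)
    show "avars (ePow r s K) \<inter> insert ''code'' (mods (Candidate r s K)) = {}"
      using avars_ePow[of r s K] by auto
    show "aval (ePow r s K) \<sigma> = int Q" using inp by (simp add: input_at_def)
    show "int Q < 2 ^ b'" by (rule Q_bound) simp
    show "J 0 \<sigma>" using best by (simp add: J_def)
    show "J a (\<tau>(''code'' := v)) = J a \<tau>" for a \<tau> v by (simp add: J_def best_of_upd)
    fix a \<tau>
    assume a: "a < Q" and Ja: "J a \<tau>" and code: "\<tau> ''code'' 0 = int a"
      and agr: "agree (insert ''code'' (mods (Candidate r s K))) \<sigma> \<tau>"
    have inp': "input_at \<tau>" using input_at_agree[OF inp agr] by simp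
    have s: "\<tau> ''out'' = \<sigma> ''out''" "\<tau> ''lam'' 0 = 2 ^ i" using agreeD[OF agr] i by simp_all
    then have x\<tau>: "(cells ''out'' \<tau>) = x" using x_eq by auto
    have "runs b' (Candidate r s K) \<tau> (candidate_steps)
      (\<lambda>\<tau>'. if moved x i a < \<tau> ''fb'' 0
        then \<tau>' ''fb'' 0 = moved x i a \<and> \<tau>' ''bl'' 0 = 2 ^ i \<and> \<tau>' ''bc'' 0 = int a
        else \<tau>' ''fb'' 0 = \<tau> ''fb'' 0 \<and> \<tau>' ''bl'' 0 = \<tau> ''bl'' 0 \<and> \<tau>' ''bc'' 0 = \<tau> ''bc'' 0)"
      unfolding x\<tau>[symmetric]
      by (rule runs_Candidate[OF inp' _ i(1) s(2) a code])
        (use x x_eq s Ja in \<open>auto simp: J_def best_of_def\<close>)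
    then show "runs b' (Candidate r s K) \<tau> (candidate_steps) (J (Suc a))"
    proof (rule runs_conseq)
      fix \<tau>' :: state assume \<tau>': "if moved x i a < \<tau> ''fb'' 0
        then \<tau>' ''fb'' 0 = moved x i a \<and> \<tau>' ''bl'' 0 = 2 ^ i \<and> \<tau>' ''bc'' 0 = int a
        else \<tau>' ''fb'' 0 = \<tau> ''fb'' 0 \<and> \<tau>' ''bl'' 0 = \<tau> ''bl'' 0 \<and> \<tau>' ''bc'' 0 = \<tau> ''bc'' 0"
      have old: "\<And>i' a'. (i', a') \<in> {..<i} \<times> {..<Q} \<union> {i} \<times> {..<a} \<Longrightarrow> \<tau> ''fb'' 0 \<le> moved x i' a'"
        using Ja unfolding J_def best_of_def by blast
      have le: "\<tau>' ''fb'' 0 \<le> \<tau> ''fb'' 0" "\<tau>' ''fb'' 0 \<le> moved x i a" using \<tau>' by (auto split: if_splits)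
      have "\<tau>' ''fb'' 0 \<le> moved x i' a'" if "(i', a') \<in> {..<i} \<times> {..<Q} \<union> {i} \<times> {..<Suc a}" for i' a'
      proof (cases "i' = i \<and> a' = a")
        case False
        then have "(i', a') \<in> {..<i} \<times> {..<Q} \<union> {i} \<times> {..<a}" using that by auto
        from old[OF this] le(1) show ?thesis by linarith
      qed (use le(2) in simp)
      moreover have "\<tau>' ''fb'' 0 \<le> 8 * S * S * S" using le(1) Ja unfolding J_def best_of_def by linarith
      moreover have "\<tau>' ''fb'' 0 = 8 * S * S * S \<or>
          (\<exists>i<L. \<exists>a<Q. \<tau>' ''fb'' 0 = moved x i a \<and> \<tau>' ''bl'' 0 = 2 ^ i \<and> \<tau>' ''bc'' 0 = int a)"
      proof (cases "moved x i a < \<tau> ''fb'' 0")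
        case True
        then show ?thesis using \<tau>' i(1) a by auto
      next
        case False
        then show ?thesis using \<tau>' Ja unfolding J_def best_of_def by simp
      qed
      ultimately show "J (Suc a) \<tau>'" unfolding J_def best_of_def by blast
    qed simp
  qed simp
  then have *: "runs b' (For ''code'' (ePow r s K) (Candidate r s K)) \<sigma>
    (2 + Q * ((candidate_steps) + 2)) (J Q)" .
  have eq: "{..<i} \<times> {..<Q} \<union> {i} \<times> {..<Q} = {..<Suc i} \<times> {..<Q}" by auto
  show ?thesis by (rule runs_conseq[OF *[unfolded J_def eq]]) simp_all
qed

lemma runs_Improve:
  assumes inp: "input_at \<sigma>" and L\<sigma>: "\<sigma> ''L'' 0 = int L"
    and x_eq: "\<And>p. \<sigma> ''out'' (1 + int p) = x p" and Fx: "F x \<le> F (\<lambda>_. 0)"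
  shows "runs b' (Improve r s K) \<sigma>
    (9 + 5 * K + sweep_steps)
    (\<lambda>\<tau>. F (cells ''out'' \<tau>) = \<tau> ''fb'' 0 \<and> \<tau> ''fb'' 0 \<le> F x \<and>
       (\<forall>i<L. \<forall>a<Q. \<tau> ''fb'' 0 \<le> F (\<lambda>p. x p + 2 ^ i * move M K a p)))" (is "runs b' _ _ _ ?R")
proof -
  have x5: "\<bar>x p\<bar> \<le> 5 * S" if "p < n" for p using entries_le[OF Fx that] .
  define k where "k = 2 + Q * (2 + candidate_steps)"
  let ?body = "Seq (For ''code'' (ePow r s K) (Candidate r s K)) (Set ''lam'' (Times (N 2) (V ''lam'')))"
  define loop where "loop = For ''i'' (V ''L'')
      ?body"
  define \<sigma>1 where "\<sigma>1 = \<sigma>(''fb'' := (\<sigma> ''fb'')(0 := 8 * S * S * S))"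
  define \<sigma>2 where "\<sigma>2 = \<sigma>1(''bl'' := (\<sigma>1 ''bl'')(0 := 0))"
  define \<sigma>' where "\<sigma>' = \<sigma>2(''lam'' := (\<sigma>2 ''lam'')(0 := 1))"
  define J where "J i \<tau> \<longleftrightarrow> best_of x ({..<i} \<times> {..<Q}) \<tau> \<and> \<tau> ''lam'' 0 = 2 ^ i" for i \<tau>
  have agr': "agree {''fb'', ''bl'', ''lam''} \<sigma> \<sigma>'" by (simp add: agree_def \<sigma>'_def \<sigma>2_def \<sigma>1_def)
  have inp': "input_at \<sigma>'" using input_at_agree[OF inp agr'] by simp
  have out': "\<sigma>' ''out'' = \<sigma> ''out''" "\<sigma>' ''L'' = \<sigma> ''L''" using agreeD[OF agr'] by simp_all
  have "runs b' loop \<sigma>' (2 + L * ((k + 1) + 2)) (J L)"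
    unfolding loop_def
  proof (rule runs_For)
    show "aval (V ''L'') \<sigma>' = int L" using L\<sigma> out' by simp
    show "int L < 2 ^ b'" by (rule L_bound)
    show "J 0 \<sigma>'" by (simp add: J_def best_of_def \<sigma>'_def \<sigma>2_def \<sigma>1_def)
    show "J i (\<tau>(''i'' := v)) = J i \<tau>" for i \<tau> v by (simp add: J_def best_of_upd)
    fix i \<tau>
    assume i: "i < L" and Ji: "J i \<tau>" and agr: "agree (insert ''i'' (mods ?body)) \<sigma>' \<tau>"
    have inp\<tau>: "input_at \<tau>" using input_at_agree[OF inp' agr] by simp
    have out\<tau>: "\<tau> ''out'' = \<sigma> ''out''" using agreeD[OF agr] out' by simp
    have "runs b' (For ''code'' (ePow r s K) (Candidate r s K)) \<tau> k (best_of x ({..<Suc i} \<times> {..<Q}))"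
      unfolding k_def by (rule runs_codes[OF inp\<tau> x5]) (use i Ji out\<tau> x_eq in \<open>auto simp: J_def\<close>)
    then show "runs b' ?body \<tau> (k + 1) (J (Suc i))"
    proof (rule runs_Seq)
      fix \<tau>1 assume best: "best_of x ({..<Suc i} \<times> {..<Q}) \<tau>1"
        and agr1: "agree (mods (For ''code'' (ePow r s K) (Candidate r s K))) \<tau> \<tau>1"
      have val: "aval (Times (N 2) (V ''lam'')) \<tau>1 = 2 ^ Suc i"
        using agreeD[OF agr1, of "''lam''"] Ji by (simp add: J_def)
      \<comment> \<open>The last round leaves \<open>2 ^ L\<close> in \<open>''lam''\<close>, a
        scale that is not tried but has to fit.\<close>
      have "(2 :: int) ^ Suc i \<le> 2 ^ L" using i by (intro power_increasing) auto
      moreover have "\<bar>(2 :: int) ^ Suc i\<bar> = 2 ^ Suc i" by simp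
      ultimately have "\<bar>(2 :: int) ^ Suc i\<bar> < 2 ^ b'" using L_less by linarith
      then show "runs b' (Set ''lam'' (Times (N 2) (V ''lam''))) \<tau>1 1 (J (Suc i))"
        by (intro runs_Assign_val[OF aval.simps(1) val]) (use best in \<open>simp_all add: J_def best_of_upd\<close>)
    qed simp
  qed simp_all
  then have "runs b' (Seq loop (Move r s K ''out'' ''bl'' ''bc'')) \<sigma>' (6 + 5 * K + L * (3 + k)) ?R"
  proof (rule runs_Seq)
    fix \<tau> assume "J L \<tau>" and agr: "agree (mods loop) \<sigma>' \<tau>"
    then have best: "best_of x ({..<L} \<times> {..<Q}) \<tau>" by (simp add: J_def)
    have out\<tau>: "\<tau> ''out'' = \<sigma> ''out''" "\<tau> ''in'' = \<sigma>' ''in''" using agreeD[OF agr] out' by (simp_all add: loop_def)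
    have all: "\<tau> ''fb'' 0 \<le> moved x i a" if "i < L" "a < Q" for i a
      using best that unfolding best_of_def by auto
    \<comment> \<open>A code of the zero move. Having tried it, \<open>''fb''\<close> is at most
      \<open>F x\<close>, below its starting value, so some pair has been recorded.\<close>
    obtain a0 where a0: "a0 < Q" "\<forall>p<n. move M K a0 p = 0"
      using move_onto[where n = n and g = "\<lambda>_. 0" and K = K and M = M] by auto
    have "moved x 0 a0 = F x" unfolding moved_def using a0(2) by (intro penalized_cong) auto
    then have fb_x: "\<tau> ''fb'' 0 \<le> F x" using all[OF L_pos a0(1)] by simp
    have "8 * S * S * S = 8 * (S * S * S)" "4 * S * S * S = 4 * (S * S * S)" by simp_all
    then have "F x < 8 * S * S * S" using Fx F_zero S_le_cube S2 by linarith
    then obtain i a where ia: "i < L" "a < Q" "\<tau> ''fb'' 0 = moved x i a" "\<tau> ''bl'' 0 = 2 ^ i" "\<tau> ''bc'' 0 = int a"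
      using best fb_x unfolding best_of_def by auto
    have in0: "\<tau> ''in'' 0 = int l" using inp' out\<tau> by (simp add: input_at_def)
    have iL: "i \<le> L" using ia(1) by simp
    have "runs b' (Move r s K ''out'' ''bl'' ''bc'') \<tau> (4 + 5 * K)
        (\<lambda>\<tau>'. \<forall>p<n. \<tau>' ''out'' (1 + int p) = \<tau> ''out'' (1 + int p) + 2 ^ i * move M K a p)"
    proof (rule runs_Move[where r = r and s = s and l = l])
      show "\<tau> ''in'' 0 = int l" "\<tau> ''bl'' 0 = 2 ^ i" "\<tau> ''bc'' 0 = int a" by (fact in0, fact ia(4), fact ia(5))
      show "int M < 2 ^ b'" "int K < 2 ^ b'" by (fact M_less, fact K_less)
      show "int a < 2 ^ b'" using Q_bound[of a] ia(2) by simp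
      have le: "int K * \<bar>2 ^ i\<bar> \<le> int K * 2 ^ L" using scale_le[OF iL] by simp
      show "int K * \<bar>2 ^ i\<bar> < 2 ^ b'" using le Y_less S2 unfolding Y_eq by linarith
      fix p assume "p < n"
      then show "\<bar>\<tau> ''out'' (1 + int p)\<bar> + int K * \<bar>2 ^ i\<bar> < 2 ^ b'"
        using le x5[of p] Y_less out\<tau>(1) x_eq unfolding Y_eq by auto
    qed auto
    then show "runs b' (Move r s K ''out'' ''bl'' ''bc'') \<tau> (4 + 5 * K) ?R"
    proof (rule runs_conseq)
      fix \<tau>' assume \<tau>': "\<forall>p<n. \<tau>' ''out'' (1 + int p) = \<tau> ''out'' (1 + int p) + 2 ^ i * move M K a p"
        and agr': "agree (mods (Move r s K ''out'' ''bl'' ''bc'')) \<tau> \<tau>'"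
      have fb: "\<tau>' ''fb'' = \<tau> ''fb''" using agreeD[OF agr'] by simp
      have "F (cells ''out'' \<tau>') = moved x i a"
        unfolding moved_def by (rule penalized_cong) (use \<tau>' out\<tau>(1) x_eq in simp)
      then show "?R \<tau>'" using fb fb_x all ia(3) by (simp add: moved_def)
    qed simp
  qed (simp add: algebra_simps)
  note * = this[unfolded \<sigma>'_def \<sigma>2_def \<sigma>1_def]
  have S\<sigma>: "\<sigma> ''S'' 0 = S" using inp by (simp add: input_at_def)
  have v: "aval eD \<sigma> = 8 * S * S * S" by (simp add: S\<sigma>)
  have v': "\<bar>8 * S * S * S\<bar> < 2 ^ b'" using D_less S2 by simp
  show ?thesis
    unfolding Improve_def loop_def[symmetric]
    by (rule runs_Assign_Seq_val[OF aval.simps(1) v v'], simp,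
        rule runs_Assign_Seq_val[OF aval.simps(1) aval.simps(1)], simp, simp,
        rule runs_Assign_Seq_val[OF aval.simps(1) aval.simps(1)], simp add: b'_pos, simp,
        rule runs_conseq[OF *]) (simp_all add: k_def algebra_simps)
qed

lemma runs_Search:
  assumes inp: "input_at \<sigma>" and L\<sigma>: "\<sigma> ''L'' 0 = int L" and out: "\<And>p. \<sigma> ''out'' (1 + int p) = 0"
  shows "runs b' (Search r s K) \<sigma>
    (2 + Q * (L * L) * (11 + 5 * K + sweep_steps))
    (\<lambda>\<tau>. F (cells ''out'' \<tau>) = opt \<and> \<tau> ''fb'' 0 = opt)"
proof -
  define N where "N = Q * L"
  \<comment> \<open>The first conjunct keeps all entries within \<open>5 * S\<close>; the second is
    the geometric decrease, cleared of denominators. \<open>''fb''\<close> carries the current value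
    only after the first round, hence \<open>0 < j\<close>.\<close>
  define J where "J j \<tau> \<longleftrightarrow> F (cells ''out'' \<tau>) \<le> F (\<lambda>_. 0) \<and>
    int N ^ j * (F (cells ''out'' \<tau>) - opt) \<le> (int N - 1) ^ j * (F (\<lambda>_. 0) - opt) \<and>
    (0 < j \<longrightarrow> \<tau> ''fb'' 0 = F (cells ''out'' \<tau>))" for j and \<tau> :: state
  have N_pos: "0 < N" using L_pos by (simp add: N_def)
  have "runs b' (Search r s K) \<sigma>
    (2 + (Q * (L * L)) * ((9 + 5 * K + sweep_steps) + 2)) (J (Q * (L * L)))"
    unfolding Search_def
  proof (rule runs_For)
    show "avars (Times (ePow r s K) (Times (V ''L'') (V ''L''))) \<inter> insert ''step'' (mods (Improve r s K)) = {}"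
      using avars_ePow[of r s K] by auto
    show "aval (Times (ePow r s K) (Times (V ''L'') (V ''L''))) \<sigma> = int (Q * (L * L))"
      using inp L\<sigma> by (simp add: input_at_def)
    show "int (Q * (L * L)) < 2 ^ b'" by (rule Q_less)
    show "J 0 \<sigma>" using out by (simp add: J_def)
    show "J j (\<tau>(''step'' := v)) = J j \<tau>" for j \<tau> v by (simp add: J_def)
    fix j \<tau>
    assume Jj: "J j \<tau>" and agr: "agree (insert ''step'' (mods (Improve r s K))) \<sigma> \<tau>"
    have inp\<tau>: "input_at \<tau>" using input_at_agree[OF inp agr] by simp
    have L\<tau>: "\<tau> ''L'' 0 = int L" using agreeD[OF agr] L\<sigma> by simp
    define x where "x = (cells ''out'' \<tau>)"
    have Fx: "F x \<le> F (\<lambda>_. 0)" using Jj by (simp add: J_def x_def)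
    have "runs b' (Improve r s K) \<tau>
      (9 + 5 * K + sweep_steps)
      (\<lambda>\<tau>. F (cells ''out'' \<tau>) = \<tau> ''fb'' 0 \<and> \<tau> ''fb'' 0 \<le> F x \<and>
         (\<forall>i<L. \<forall>a<Q. \<tau> ''fb'' 0 \<le> F (\<lambda>p. x p + 2 ^ i * move M K a p)))"
      by (rule runs_Improve[OF inp\<tau> L\<tau> _ Fx]) (simp add: x_def)
    then show "runs b' (Improve r s K) \<tau>
      (9 + 5 * K + sweep_steps) (J (Suc j))"
    proof (rule runs_conseq)
      fix \<tau>' assume \<tau>': "F (cells ''out'' \<tau>') = \<tau>' ''fb'' 0 \<and> \<tau>' ''fb'' 0 \<le> F x \<and>
         (\<forall>i<L. \<forall>a<Q. \<tau>' ''fb'' 0 \<le> F (\<lambda>p. x p + 2 ^ i * move M K a p))"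
      define v where "v = \<tau>' ''fb'' 0"
      have gap: "int N * (v - opt) \<le> (int N - 1) * (F x - opt)"
        unfolding N_def by (rule best_move_gap[OF graver refl L Fx]) (use \<tau>' in \<open>auto simp: v_def\<close>)
      have "int N ^ Suc j * (v - opt) = int N ^ j * (int N * (v - opt))" by simp
      also have "\<dots> \<le> int N ^ j * ((int N - 1) * (F x - opt))" using gap by (intro mult_left_mono) auto
      also have "\<dots> = (int N - 1) * (int N ^ j * (F x - opt))" by simp
      also have "\<dots> \<le> (int N - 1) * ((int N - 1) ^ j * (F (\<lambda>_. 0) - opt))"
        using Jj N_pos by (intro mult_left_mono) (auto simp: J_def x_def)
      finally have "int N ^ Suc j * (v - opt) \<le> (int N - 1) ^ Suc j * (F (\<lambda>_. 0) - opt)" by (simp add: mult.assoc)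
      then show "J (Suc j) \<tau>'" using \<tau>' Fx unfolding J_def v_def by simp
    qed simp
  qed simp
  then show ?thesis
  proof (rule runs_conseq)
    fix \<tau> assume J: "J (Q * (L * L)) \<tau>"
    have e: "Q * (L * L) = N * L" by (simp add: N_def)
    have "0 < Q * (L * L)" using L_pos by simp
    then have fb: "\<tau> ''fb'' 0 = F (cells ''out'' \<tau>)" using J unfolding J_def by blast
    have "F (cells ''out'' \<tau>) - opt = 0"
    proof (rule geometric_decrease[OF N_pos L_pos])
      show "F (\<lambda>_. 0) - opt < 2 ^ L" using gap_zero_bound L by linarith
      show "0 \<le> F (cells ''out'' \<tau>) - opt" using opt(2) by simp
      show "int N ^ (N * L) * (F (cells ''out'' \<tau>) - opt) \<le> (int N - 1) ^ (N * L) * (F (\<lambda>_. 0) - opt)"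
        using J unfolding e J_def by blast
    qed
    then show "F (cells ''out'' \<tau>) = opt \<and> \<tau> ''fb'' 0 = opt" using fb by simp
  qed simp
qed

end

section \<open>The whole program\<close>

definition AbsSum :: com where
  "AbsSum = For ''q'' (V ''inlen'')
    (Cond (Less (Get ''in'' (V ''q'')) (N 0))
      (Set ''S'' (Minus (V ''S'') (Get ''in'' (V ''q''))))
      (Set ''S'' (Plus (V ''S'') (Get ''in'' (V ''q'')))))"

text \<open>Doubling finds the least admissible \<open>L\<close>; minimality is what keeps
  \<open>L\<close> linear in the input size.\<close>

definition Bits :: com where
  "Bits = Seq (Set ''w'' (N 1))
    (While (BNot (Less eD (V ''w'')))
      (Seq (Set ''w'' (Times (N 2) (V ''w''))) (Set ''L'' (Plus (V ''L'') (N 1)))))"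

text \<open>The entries already occupy cells 1 to \<open>n\<close> in the order of the encoding, so
  only the tag in cell 0 and the length are written.\<close>

definition Output :: "nat \<Rightarrow> nat \<Rightarrow> com" where
  "Output r s = Cond (Less (Times (V ''S'') (V ''S'')) (V ''fb''))
    (Seq (Assign ''out'' (N 0) (N 0)) (Set ''outlen'' (N 1)))
    (Seq (Assign ''out'' (N 0) (N 2)) (Set ''outlen'' (Plus (N 1) (eN r s))))"

definition Solve :: "nat \<Rightarrow> nat \<Rightarrow> nat \<Rightarrow> com" where
  "Solve r s K = Seq (Set ''S'' (N 2)) (Seq AbsSum (Seq Bits (Seq (Search r s K) (Output r s))))"

lemma mods_setup [simp]: "mods AbsSum = {''q'', ''S''}" "mods Bits = {''w'', ''L''}"
  by (auto simp: AbsSum_def Bits_def)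

lemma runs_AbsSum:
  assumes "\<sigma> ''inlen'' 0 = int m" "int m < 2 ^ b"
    and "\<sigma> ''S'' 0 = 2" "2 + (\<Sum>q<m. \<bar>\<sigma> ''in'' (int q)\<bar>) < 2 ^ b"
  shows "runs b AbsSum \<sigma> (2 + m * 4) (\<lambda>\<tau>. \<tau> ''S'' 0 = 2 + (\<Sum>q<m. \<bar>\<sigma> ''in'' (int q)\<bar>))"
proof -
  let ?body = "Cond (Less (Get ''in'' (V ''q'')) (N 0))
    (Set ''S'' (Minus (V ''S'') (Get ''in'' (V ''q''))))
    (Set ''S'' (Plus (V ''S'') (Get ''in'' (V ''q''))))"
  define s where "s j = 2 + (\<Sum>q<j. \<bar>\<sigma> ''in'' (int q)\<bar>)" for j
  have "runs b AbsSum \<sigma> (2 + m * (2 + 2)) ((\<lambda>j \<tau>. \<tau> ''S'' 0 = s j) m)"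
    unfolding AbsSum_def
  proof (rule runs_For)
    fix j \<tau>
    assume j: "j < m" and Sj: "\<tau> ''S'' 0 = s j" and q: "\<tau> ''q'' 0 = int j"
      and agr: "agree (insert ''q'' (mods ?body)) \<sigma> \<tau>"
    have inq: "\<tau> ''in'' = \<sigma> ''in''" using agreeD[OF agr] by simp
    have "s (Suc j) \<le> s m" unfolding s_def using j by (intro add_left_mono sum_mono2) auto
    moreover have "0 \<le> s (Suc j)" unfolding s_def by (intro add_nonneg_nonneg sum_nonneg) auto
    ultimately have bd: "\<bar>s (Suc j)\<bar> < 2 ^ b" using assms(4) unfolding s_def by linarith
    have step: "s (Suc j) = s j + \<bar>\<sigma> ''in'' (int j)\<bar>" by (simp add: s_def)
    show "runs b ?body \<tau> 2 (\<lambda>\<tau>. \<tau> ''S'' 0 = s (Suc j))"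
    proof (rule runs_Cond)
      assume "bval (Less (Get ''in'' (V ''q'')) (N 0)) \<tau>"
      then have "aval (Minus (V ''S'') (Get ''in'' (V ''q''))) \<tau> = s (Suc j)"
        by (simp add: Sj q inq step)
      then show "runs b (Set ''S'' (Minus (V ''S'') (Get ''in'' (V ''q'')))) \<tau> (2 - 1) (\<lambda>\<tau>. \<tau> ''S'' 0 = s (Suc j))"
        by (rule runs_Assign_val[OF aval.simps(1) _ bd]) simp_all
    next
      assume "\<not> bval (Less (Get ''in'' (V ''q'')) (N 0)) \<tau>"
      then have "aval (Plus (V ''S'') (Get ''in'' (V ''q''))) \<tau> = s (Suc j)"
        by (simp add: Sj q inq step)
      then show "runs b (Set ''S'' (Plus (V ''S'') (Get ''in'' (V ''q'')))) \<tau> (2 - 1) (\<lambda>\<tau>. \<tau> ''S'' 0 = s (Suc j))"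
        by (rule runs_Assign_val[OF aval.simps(1) _ bd]) simp_all
    qed simp
  qed (use assms in \<open>auto simp: s_def\<close>)
  then show ?thesis by (rule runs_conseq) (auto simp: s_def)
qed

lemma runs_Bits:
  assumes S: "\<sigma> ''S'' 0 = S" and L0: "\<sigma> ''L'' 0 = 0"
    and L: "8 * S * S * S < 2 ^ L" "\<And>j. j < L \<Longrightarrow> \<not> 8 * S * S * S < 2 ^ j"
    and b: "(2 :: int) ^ L < 2 ^ b"
  shows "runs b Bits \<sigma> (2 + L * 3) (\<lambda>\<tau>. \<tau> ''L'' 0 = int L)"
proof -
  define I where "I j \<tau> \<longleftrightarrow> \<tau> ''w'' 0 = 2 ^ j \<and> \<tau> ''L'' 0 = int j \<and> \<tau> ''S'' 0 = S" for j and \<tau> :: state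
  have "runs b (While (BNot (Less eD (V ''w'')))
      (Seq (Set ''w'' (Times (N 2) (V ''w''))) (Set ''L'' (Plus (V ''L'') (N 1)))))
    (\<sigma>(''w'' := (\<sigma> ''w'')(0 := 1))) (1 + L * (1 + 2)) (I L)"
  proof (rule runs_While)
    fix j \<tau> assume j: "j < L" and I: "I j \<tau>"
    have "(2 :: int) ^ Suc j \<le> 2 ^ L" using j by (intro power_increasing) auto
    then have w: "\<bar>(2 :: int) ^ Suc j\<bar> < 2 ^ b" using b by (simp only: abs_of_nonneg zero_le_power zero_le_numeral)
    have "int (Suc j) \<le> int L" using j by linarith
    then have l: "\<bar>int (Suc j)\<bar> < 2 ^ b" using b of_nat_less_two_power[of L, where 'a = int] by linarith
    have v1: "aval (Times (N 2) (V ''w'')) \<tau> = 2 ^ Suc j" using I by (simp add: I_def)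
    have v2: "aval (Plus (V ''L'') (N 1)) (\<tau>(''w'' := (\<tau> ''w'')(0 := 2 ^ Suc j))) = int (Suc j)"
      using I by (simp add: I_def)
    have "runs b (Set ''L'' (Plus (V ''L'') (N 1))) (\<tau>(''w'' := (\<tau> ''w'')(0 := 2 ^ Suc j))) (2 - 1) (I (Suc j))"
      by (rule runs_Assign_val[OF aval.simps(1) v2 l]) (use I in \<open>simp_all add: I_def\<close>)
    then have "runs b (Seq (Set ''w'' (Times (N 2) (V ''w''))) (Set ''L'' (Plus (V ''L'') (N 1)))) \<tau> 2 (I (Suc j))"
      by (intro runs_Assign_Seq_val[OF aval.simps(1) v1 w]) simp_all
    moreover have "bval (BNot (Less eD (V ''w''))) \<tau>" using L(2)[OF j] I by (simp add: I_def)
    ultimately show "bval (BNot (Less eD (V ''w''))) \<tau> \<and>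
      runs b (Seq (Set ''w'' (Times (N 2) (V ''w''))) (Set ''L'' (Plus (V ''L'') (N 1)))) \<tau> 2 (I (Suc j))" by simp
  next
    fix \<tau> assume "I L \<tau>"
    then show "\<not> bval (BNot (Less eD (V ''w''))) \<tau>" using L(1) by (simp add: I_def)
  next
    show "I 0 (\<sigma>(''w'' := (\<sigma> ''w'')(0 := 1)))" using S L0 by (simp add: I_def)
  qed
  note * = this
  have "(1 :: int) \<le> 2 ^ L" by simp
  then have one: "\<bar>1 :: int\<bar> < 2 ^ b" using b by linarith
  show ?thesis
    unfolding Bits_def
    by (rule runs_Assign_Seq_val[OF aval.simps(1) aval.simps(1) one], simp, rule runs_conseq[OF *])
      (simp_all add: I_def)
qed

lemma (in runnable) runs_Output:
  assumes inp: "input_at \<sigma>" and fb: "\<sigma> ''fb'' 0 = opt"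
  shows "runs b' (Output r s) \<sigma> 3
    (\<lambda>\<tau>. read_output \<tau> = (if opt \<le> S * S then 2 # map (cells ''out'' \<sigma>) [0..<n] else [0]))"
    (is "runs _ _ _ _ ?R")
proof -
  have S\<sigma>: "\<sigma> ''S'' 0 = S" and in0: "\<sigma> ''in'' 0 = int l" using inp by (simp_all add: input_at_def)
  have small: "\<bar>0 :: int\<bar> < 2 ^ b'" "\<bar>1 :: int\<bar> < 2 ^ b'" "\<bar>2 :: int\<bar> < 2 ^ b'"
    using S2 b_S_less by linarith+
  show ?thesis
    unfolding Output_def
  proof (rule runs_Cond)
    assume "bval (Less (Times (V ''S'') (V ''S'')) (V ''fb'')) \<sigma>"
    then have "\<not> opt \<le> S * S" by (simp add: S\<sigma> fb)
    then show "runs b' (Seq (Assign ''out'' (N 0) (N 0)) (Set ''outlen'' (N 1))) \<sigma> (3 - 1) ?R"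
      by (intro runs_Assign_Seq_val[OF aval.simps(1) aval.simps(1) small(1)] runs_Assign_val[OF aval.simps(1) aval.simps(1) small(2)])
        (simp_all add: read_output_def)
  next
    assume "\<not> bval (Less (Times (V ''S'') (V ''S'')) (V ''fb'')) \<sigma>"
    then have opt_le: "opt \<le> S * S" by (simp add: S\<sigma> fb)
    define \<sigma>1 where "\<sigma>1 = \<sigma>(''out'' := (\<sigma> ''out'')(0 := 2))"
    have v: "aval (Plus (N 1) (eN r s)) \<sigma>1 = 1 + int n" by (simp add: \<sigma>1_def in0)
    have lt: "\<bar>1 + int n\<bar> < 2 ^ b'" using len_less by linarith
    have upt: "[0..<Suc n] = 0 # map Suc [0..<n]"
      by (simp add: upt_conv_Cons map_Suc_upt del: upt_Suc)
    have nat_eq: "nat (1 + int n) = Suc n" by linarith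
    have "runs b' (Set ''outlen'' (Plus (N 1) (eN r s))) \<sigma>1 1 ?R"
      by (rule runs_Assign_val[OF aval.simps(1) v lt])
        (use opt_le in \<open>simp_all add: read_output_def nat_eq upt \<sigma>1_def comp_def del: upt_Suc of_nat_mult\<close>)
    then show "runs b' (Seq (Assign ''out'' (N 0) (N 2)) (Set ''outlen'' (Plus (N 1) (eN r s)))) \<sigma> (3 - 1) ?R"
      by (intro runs_Assign_Seq_val[OF aval.simps(1) aval.simps(1) small(3)]) (simp_all add: \<sigma>1_def)
  qed simp
qed

lemma runs_Solve:
  fixes r s l K L b' :: nat and c0 :: "nat \<Rightarrow> nat \<Rightarrow> nat \<Rightarrow> int" and u v w :: "nat \<Rightarrow> nat \<Rightarrow> int"
  defines "xs \<equiv> encode_input r s l c0 u v w" and "n \<equiv> r * s * l"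
  defines "S \<equiv> 2 + (\<Sum>q<length xs. \<bar>xs ! q\<bar>)"
  defines "Y \<equiv> 5 * S + int K * 2 ^ L"
  assumes pos: "0 < l"
    and K: "\<And>d. \<exists>p<n. d p \<noteq> 0 \<Longrightarrow>
       \<exists>g. (\<exists>p<n. g p \<noteq> 0) \<and> (\<Sum>p<n. \<bar>g p\<bar>) \<le> int K \<and> conform r s l g d"
    and least: "8 * S * S * S < 2 ^ L" "\<And>j. j < L \<Longrightarrow> \<not> 8 * S * S * S < 2 ^ j"
    and bounds: "int (length xs) < 2 ^ b'" "S + 3 * int n * Y < 2 ^ b'"
      "int n * (S * Y + 4 * S * S * Y) + int (nlines r s l) * (4 * S * S * (S + 3 * int n * Y)) < 2 ^ b'"
      "Y < 2 ^ b'" "(2 :: int) ^ L < 2 ^ b'" "int (2 * n + 2) < 2 ^ b'" "int K < 2 ^ b'"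
      "int ((2 * n + 2) ^ K * (L * L)) < 2 ^ b'"
  shows "\<exists>res. correct_outcome r s l c0 u v w res \<and> bounded b' (init_state xs) \<and> 0 < b' \<and>
    runs b' (Solve r s K) (init_state xs)
      (12 + 4 * length xs + 3 * L + (2 * n + 2) ^ K * (L * L) *
        (11 + 5 * K + L * (5 + (2 * n + 2) ^ K * (19 + 12 * n + 5 * K + 7 * nlines r s l))))
      (\<lambda>\<tau>. read_output \<tau> = encode_outcome r s l res)"
proof -
  let ?m = "(2 * n + 2) ^ K * (L * L) *
        (11 + 5 * K + L * (5 + (2 * n + 2) ^ K * (19 + 12 * n + 5 * K + 7 * nlines r s l)))"
  define c where "c p = xs ! (1 + p)" for p
  define b where "b t = xs ! (1 + n + t)" for t
  have len: "length xs = 1 + n + nlines r s l" by (simp add: xs_def n_def length_encode_input)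
  have S_ge: "2 \<le> S" unfolding S_def by (simp add: sum_nonneg)
  have c_le: "\<bar>c p\<bar> \<le> S" if "p < n" for p
  proof -
    have "\<bar>xs ! (1 + p)\<bar> \<le> (\<Sum>q<length xs. \<bar>xs ! q\<bar>)"
      using that len by (intro member_le_sum[of "1 + p" _ "\<lambda>q. \<bar>xs ! q\<bar>"]) auto
    then show ?thesis by (simp add: c_def S_def)
  qed
  have b_le: "(\<Sum>t<nlines r s l. \<bar>b t\<bar>) \<le> S"
  proof -
    have "(\<Sum>t<nlines r s l. \<bar>b t\<bar>) = (\<Sum>q\<in>(\<lambda>t. 1 + n + t) ` {..<nlines r s l}. \<bar>xs ! q\<bar>)"
      by (subst sum.reindex) (auto simp: b_def)
    also have "\<dots> \<le> (\<Sum>q<length xs. \<bar>xs ! q\<bar>)" using len by (intro sum_mono2) auto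
    finally show ?thesis by (simp add: S_def)
  qed
  interpret runnable r s l c b S K L b' Y
  proof
    show "8 * S * S * S < 2 ^ L" by (rule least)
    show "0 \<le> Y" using S_ge by (simp add: Y_def)
  qed (use S_ge c_le b_le pos K bounds len in \<open>simp_all add: n_def Y_def\<close>)
  let ?\<sigma> = "init_state xs"
  have in_eq: "?\<sigma> ''in'' (int q) = xs ! q" if "q < length xs" for q
    using that by (simp add: init_state_def)
  have S_less: "S < 2 ^ b'" by (rule b_S_less)
  have entry: "\<bar>xs ! q\<bar> < 2 ^ b'" if "q < length xs" for q
  proof -
    have "\<bar>xs ! q\<bar> \<le> (\<Sum>q<length xs. \<bar>xs ! q\<bar>)" using that by (intro member_le_sum) auto
    then show ?thesis using S_less unfolding S_def by linarith
  qed
  have "bounded b' ?\<sigma>"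
    using entry bounds(1) by (auto simp: bounded_def init_state_def nat_less_iff)
  moreover
  define \<sigma>1 where "\<sigma>1 = ?\<sigma>(''S'' := (?\<sigma> ''S'')(0 := 2))"
  have \<sigma>1: "\<sigma>1 ''in'' = ?\<sigma> ''in''" "\<sigma>1 ''S'' 0 = 2" "\<sigma>1 ''inlen'' 0 = int (length xs)" "\<sigma>1 ''L'' 0 = 0" "\<sigma>1 ''out'' i = 0" for i
    by (simp_all add: \<sigma>1_def init_state_def)
  have sum_eq: "(\<Sum>q<length xs. \<bar>\<sigma>1 ''in'' (int q)\<bar>) = (\<Sum>q<length xs. \<bar>xs ! q\<bar>)"
    using in_eq \<sigma>1(1) by simp
  define res where "res x = (if opt \<le> S * S then Optimal (unflat s l x) else Infeasible)" for x
  \<comment> \<open>The result depends on the final array, which is known only after the run; it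
    stays existential until one execution is opened at the end.\<close>
  define good where "good \<tau> \<longleftrightarrow> (\<exists>x. F x = opt \<and> read_output \<tau> = encode_outcome r s l (res x))" for \<tau>
  have c_eq: "c p = encode_input r s l c0 u v w ! (1 + p)" for p by (simp add: c_def xs_def)
  have b_eq: "b t = encode_input r s l c0 u v w ! (1 + r * s * l + t)" for t by (simp add: b_def xs_def n_def)
  have "runs b' (Seq AbsSum (Seq Bits (Seq (Search r s K) (Output r s)))) \<sigma>1
      (11 + 4 * length xs + 3 * L + ?m) good"
  proof (rule runs_Seq)
    have "runs b' AbsSum \<sigma>1 (2 + length xs * 4) (\<lambda>\<tau>. \<tau> ''S'' 0 = 2 + (\<Sum>q<length xs. \<bar>\<sigma>1 ''in'' (int q)\<bar>))"
    proof (rule runs_AbsSum)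
      show "2 + (\<Sum>q<length xs. \<bar>\<sigma>1 ''in'' (int q)\<bar>) < 2 ^ b'"
        using S_less unfolding sum_eq S_def .
    qed (fact \<sigma>1 bounds(1))+
    then show "runs b' AbsSum \<sigma>1 (2 + length xs * 4) (\<lambda>\<tau>. \<tau> ''S'' 0 = S)"
      unfolding sum_eq S_def .
    fix \<tau>1 assume S1: "\<tau>1 ''S'' 0 = S" and agr1: "agree (mods AbsSum) \<sigma>1 \<tau>1"
    show "runs b' (Seq Bits (Seq (Search r s K) (Output r s))) \<tau>1
      (9 + 3 * L + ?m) good"
    proof (rule runs_Seq)
      show "runs b' Bits \<tau>1 (2 + L * 3) (\<lambda>\<tau>. \<tau> ''L'' 0 = int L)"
      proof (rule runs_Bits)
        show "\<tau>1 ''S'' 0 = S" by (rule S1)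
        show "\<tau>1 ''L'' 0 = 0" using agreeD[OF agr1] \<sigma>1 by simp
        show "8 * S * S * S < 2 ^ L" by (rule least)
        show "\<And>j. j < L \<Longrightarrow> \<not> 8 * S * S * S < 2 ^ j" by (rule least)
        show "(2 :: int) ^ L < 2 ^ b'" by (rule bounds)
      qed
      fix \<tau>2 assume L2: "\<tau>2 ''L'' 0 = int L" and agr2: "agree (mods Bits) \<tau>1 \<tau>2"
      have in2: "\<tau>2 ''in'' = ?\<sigma> ''in''" using agreeD[OF agr2] agreeD[OF agr1] \<sigma>1 by simp
      have out2: "\<tau>2 ''out'' (1 + int p) = 0" for p using agreeD[OF agr2] agreeD[OF agr1] \<sigma>1 by simp
      have S2': "\<tau>2 ''S'' 0 = S" using agreeD[OF agr2] S1 by simp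
      have inp2: "input_at \<tau>2"
      proof -
        have "\<tau>2 ''in'' 0 = int l" using in_eq[of 0] in2 len nth_encode_input_0[of r s l c0 u v w] unfolding xs_def by simp
        moreover have "\<tau>2 ''in'' (1 + int p) = c p" if "p < n" for p
          using in_eq[of "1 + p"] in2 len that by (simp add: c_def)
        moreover have "\<tau>2 ''in'' (1 + int n + int t) = b t" if "t < nlines r s l" for t
          using in_eq[of "1 + n + t"] in2 len that by (simp add: b_def add.assoc)
        ultimately show ?thesis using S2' by (simp add: input_at_def n_def)
      qed
      show "runs b' (Seq (Search r s K) (Output r s)) \<tau>2
        (7 + ?m) good"
      proof (rule runs_Seq[OF runs_Search[OF inp2 L2 out2]])
        fix \<tau>3 assume \<tau>3: "F (cells ''out'' \<tau>3) = opt \<and> \<tau>3 ''fb'' 0 = opt"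
          and agr3: "agree (mods (Search r s K)) \<tau>2 \<tau>3"
        have inp3: "input_at \<tau>3" using input_at_agree[OF inp2 agr3] by (simp add: Search_def)
        from \<tau>3 have fb3: "\<tau>3 ''fb'' 0 = opt" by simp
        show "runs b' (Output r s) \<tau>3 3 good"
        proof (rule runs_conseq[OF runs_Output[OF inp3 fb3]])
          fix \<tau>4 assume \<tau>4: "read_output \<tau>4 = (if opt \<le> S * S then 2 # map (cells ''out'' \<tau>3) [0..<r * s * l] else [0])"
          define x where "x p = \<tau>3 ''out'' (1 + int p)" for p
          have Fx: "F x = opt" using \<tau>3 by (simp add: x_def[abs_def])
          have "read_output \<tau>4 = encode_outcome r s l (res x)"
          proof (cases "opt \<le> S * S")
            case True
            have "encode_outcome r s l (Optimal (unflat s l x)) = 2 # map x [0..<r * s * l]"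
              by (rule encode_optimal_unflat[OF excess_of_optimal[OF Fx True]])
            then show ?thesis using \<tau>4 True by (simp add: res_def x_def[abs_def])
          next
            case False
            then show ?thesis using \<tau>4 by (simp add: res_def)
          qed
          then show "good \<tau>4" using Fx unfolding good_def by blast
        qed simp
      qed (simp add: n_def)
    qed simp
  qed simp
  note * = this[unfolded \<sigma>1_def]
  have two: "\<bar>2 :: int\<bar> < 2 ^ b'" using S_less S_ge by linarith
  have final: "runs b' (Solve r s K) ?\<sigma>
      (12 + 4 * length xs + 3 * L + ?m) good"
    unfolding Solve_def
    by (rule runs_Assign_Seq_val[OF aval.simps(1) aval.simps(1) two], simp, rule runs_conseq[OF *]) simp_all
  obtain k \<tau> where k: "nexec b' (Solve r s K) ?\<sigma> k \<tau>" "k \<le> (12 + 4 * length xs + 3 * L + ?m)" "good \<tau>"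
    using final unfolding runs_def by blast
  obtain x where x: "F x = opt" "read_output \<tau> = encode_outcome r s l (res x)" using k(3) by (auto simp: good_def)
  have "correct_outcome r s l c0 u v w (res x)"
    using correct_outcome_opt[OF c_eq b_eq] x(1) by (auto simp: res_def)
  moreover have "runs b' (Solve r s K) ?\<sigma>
      (12 + 4 * length xs + 3 * L + ?m)
      (\<lambda>\<tau>. read_output \<tau> = encode_outcome r s l (res x))"
    using k(1,2) x(2) unfolding runs_def by blast
  ultimately show ?thesis using b'_pos by blast
qed

section \<open>Closure properties of polynomial bounds\<close>

definition poly_bounded :: "(nat \<Rightarrow> nat) \<Rightarrow> bool" where
  "poly_bounded f \<longleftrightarrow> (\<exists>q. \<forall>x. f x \<le> poly q x)"

lemma poly_bounded_intros:
  "poly_bounded (\<lambda>_. k)" "poly_bounded (\<lambda>x. x)"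
  "poly_bounded f \<Longrightarrow> poly_bounded g \<Longrightarrow> poly_bounded (\<lambda>x. f x + g x)"
  "poly_bounded f \<Longrightarrow> poly_bounded g \<Longrightarrow> poly_bounded (\<lambda>x. f x * g x)"
proof -
  show "poly_bounded (\<lambda>_. k)" unfolding poly_bounded_def by (intro exI[of _ "[:k:]"]) simp
  show "poly_bounded (\<lambda>x. x)" unfolding poly_bounded_def by (intro exI[of _ "[:0, 1:]"]) simp
  assume "poly_bounded f" "poly_bounded g"
  then obtain p q where pq: "\<And>x. f x \<le> poly p x" "\<And>x. g x \<le> poly q x" by (auto simp: poly_bounded_def)
  show "poly_bounded (\<lambda>x. f x + g x)"
    unfolding poly_bounded_def using pq by (intro exI[of _ "p + q"]) (simp add: add_mono)
  show "poly_bounded (\<lambda>x. f x * g x)"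
    unfolding poly_bounded_def using pq by (intro exI[of _ "p * q"]) (simp add: mult_mono)
qed

text \<open>Covers \<open>(2 * z + 2) ^ K\<close>, since the exponent does not depend on
  \<open>z\<close>.\<close>

lemma poly_bounded_power: "poly_bounded f \<Longrightarrow> poly_bounded (\<lambda>x. f x ^ k)"
  by (induction k) (auto intro: poly_bounded_intros)

section \<open>Polynomial running time\<close>

text \<open>From \<open>(A - 1) * (B - 1) \<ge> 0\<close>, an integer below \<open>A\<close> plus
  one below \<open>B\<close> is below \<open>A * B\<close>; so bit sizes may simply be
  added.\<close>

lemma sum_abs_less_power:
  "sum_list (map abs xs) < (2 :: int) ^ sum_list (map bit_size xs)"
proof (induction xs)
  case (Cons x xs)
  have "nat \<bar>x\<bar> < 2 ^ floorlog 2 (nat \<bar>x\<bar>)"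
    using floorlog_bounds[of "nat \<bar>x\<bar>" 2] by (cases "x = 0") auto
  then have "\<bar>x\<bar> < 2 ^ floorlog 2 (nat \<bar>x\<bar>)" by (simp add: nat_less_iff)
  moreover have "(2 :: int) ^ floorlog 2 (nat \<bar>x\<bar>) \<le> 2 ^ bit_size x"
    by (intro power_increasing) (simp_all add: bit_size_def)
  ultimately have x: "\<bar>x\<bar> < 2 ^ bit_size x" by linarith
  have "0 \<le> ((2 :: int) ^ bit_size x - 1) * (2 ^ sum_list (map bit_size xs) - 1)"
    by (intro mult_nonneg_nonneg) auto
  then show ?case using x Cons.IH by (simp add: power_add algebra_simps)
qed simp

lemma length_le_bit_size: "length xs \<le> sum_list (map bit_size xs)"
  by (induction xs) (auto simp: bit_size_def)

text \<open>The sign bit of each entry makes the number of entries at most \<open>z\<close>. The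
  size counts \<open>l\<close> by value, so \<open>l < 2 ^ l\<close> covers its cell.\<close>

lemma input_size_bounds:
  fixes r s l :: nat and c :: "nat \<Rightarrow> nat \<Rightarrow> nat \<Rightarrow> int" and u v w :: "nat \<Rightarrow> nat \<Rightarrow> int"
  defines "z \<equiv> input_size r s l c u v w" and "xs \<equiv> encode_input r s l c u v w"
  shows "r * s * l + nlines r s l \<le> z" "2 + (\<Sum>q<length xs. \<bar>xs ! q\<bar>) < 2 ^ (z + 2)"
proof -
  define ys where "ys = input_data r s l c u v w"
  have z: "z = l + sum_list (map bit_size ys)" by (simp add: z_def input_size_def ys_def)
  have xs: "xs = int l # ys" by (simp add: xs_def encode_input_def ys_def)
  have "length ys = r * s * l + nlines r s l"
    using length_encode_input[of r s l c u v w] xs by (simp add: xs_def)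
  then show "r * s * l + nlines r s l \<le> z"
    using length_le_bit_size[of ys] z by linarith
  have "(\<Sum>q<length xs. \<bar>xs ! q\<bar>) = sum_list (map abs xs)"
    by (simp add: sum_list_sum_nth atLeast0LessThan)
  also have "\<dots> = int l + sum_list (map abs ys)" by (simp add: xs)
  finally have eq: "(\<Sum>q<length xs. \<bar>xs ! q\<bar>) = int l + sum_list (map abs ys)" .
  have "int l < 2 ^ l" using of_nat_less_two_power[of l, where 'a = int] by simp
  moreover have "0 \<le> ((2 :: int) ^ l - 1) * (2 ^ sum_list (map bit_size ys) - 1)"
    by (intro mult_nonneg_nonneg) auto
  then have "(2 :: int) ^ l + 2 ^ sum_list (map bit_size ys) \<le> 2 ^ z + 1"
    unfolding z by (simp add: power_add algebra_simps)
  moreover have "(1 :: int) \<le> 2 ^ z" "(2 :: int) ^ (z + 2) = 4 * 2 ^ z" by simp_all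
  ultimately show "2 + (\<Sum>q<length xs. \<bar>xs ! q\<bar>) < 2 ^ (z + 2)"
    using sum_abs_less_power[of ys] unfolding eq by linarith
qed

text \<open>First bracket: with \<open>T = 2 ^ (3 * z + K + 12)\<close> above all basic quantities,
  the values in an evaluation are at most \<open>21 * T ^ 5 < 2 ^ 5 * T ^ 5\<close>. Second bracket:
  the number of rounds, from \<open>2 * n + 2 \<le> 2 ^ (z + 1)\<close> and
  \<open>L < 2 ^ (3 * z + 9)\<close>.\<close>

definition bits :: "nat \<Rightarrow> nat \<Rightarrow> nat" where
  "bits K z = (5 * (3 * z + K + 12) + 5) + ((z + 1) * K + (6 * z + 18))"

lemma bits_bounds:
  fixes S Y :: int and n m z K L :: nat
  assumes S: "0 \<le> S" "S < 2 ^ (z + 2)" and nm: "n + m \<le> z" and L: "L \<le> 3 * z + 9"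
    and Y_eq: "Y = 5 * S + int K * 2 ^ L"
  shows "int (1 + n + m) < 2 ^ bits K z" "S + 3 * int n * Y < 2 ^ bits K z"
    "int n * (S * Y + 4 * S * S * Y) + int m * (4 * S * S * (S + 3 * int n * Y)) < 2 ^ bits K z"
    "Y < 2 ^ bits K z" "(2 :: int) ^ L < 2 ^ bits K z" "int (2 * n + 2) < 2 ^ bits K z"
    "int K < 2 ^ bits K z" "int ((2 * n + 2) ^ K * (L * L)) < 2 ^ bits K z"
proof -
  define T :: int where "T = 2 ^ (3 * z + K + 12)"
  have zT: "2 ^ e \<le> T" if "e \<le> 3 * z + K + 12" for e
    unfolding T_def using that by (intro power_increasing) auto
  have T1: "1 \<le> T" by (simp add: T_def)
  have z_less: "int z < 2 ^ z" by (rule of_nat_less_two_power)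
  have K_less: "int K < 2 ^ K" by (rule of_nat_less_two_power)
  have ST: "S \<le> T" using S(2) zT[of "z + 2"] by simp
  have "(2 :: int) ^ z * 4 \<le> T" using zT[of "z + 2"] by (simp add: power_add)
  then have zzT: "4 * int z + 3 \<le> T" using z_less by linarith
  then have nT: "int n \<le> T" "int m \<le> T" "int (1 + n + m) \<le> T" "int (2 * n + 2) \<le> T"
    using nm by linarith+
  \<comment> \<open>\<open>K * 2 ^ L\<close> takes at most one eighth of \<open>T\<close>, and
    \<open>5 * S\<close> at most five eighths.\<close>
  have YT: "Y \<le> T"
  proof -
    have "int K * 2 ^ L \<le> 2 ^ K * 2 ^ (3 * z + 9)"
      using K_less L by (intro mult_mono power_increasing) auto
    also have "\<dots> = 2 ^ (3 * z + K + 9)" by (simp add: power_add)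
    finally have "int K * 2 ^ L \<le> 2 ^ (3 * z + K + 9)" .
    moreover have "T = 8 * 2 ^ (3 * z + K + 9)" by (simp add: T_def power_add)
    ultimately have "8 * (int K * 2 ^ L) \<le> T" by linarith
    moreover have "32 * 2 ^ z \<le> T" using zT[of "z + 5"] by (simp add: power_add)
    then have "8 * S \<le> T" using S(2) by (simp add: power_add)
    ultimately show ?thesis using S(1) T1 unfolding Y_eq by linarith
  qed
  have Y0: "0 \<le> Y" using S(1) by (simp add: Y_eq)
  \<comment> \<open>21 = 1 + 8 + 12, the coefficients of \<open>T ^ 3\<close>, \<open>T ^ 4\<close>
    and \<open>T ^ 5\<close> in the bound for \<open>f_less\<close>.\<close>
  have five: "21 * T ^ 5 < 2 ^ bits K z"
  proof -
    have "21 * T ^ 5 < 2 ^ 5 * T ^ 5" using T1 by simp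
    also have "\<dots> = 2 ^ (5 * (3 * z + K + 12) + 5)"
      unfolding T_def power_mult[symmetric] power_add[symmetric]
      by (rule arg_cong[where f = "\<lambda>e. 2 ^ e"]) simp
    also have "\<dots> \<le> 2 ^ bits K z" by (intro power_increasing) (auto simp: bits_def)
    finally show ?thesis .
  qed
  have pows: "T ^ i \<le> T ^ 5" if "i \<le> 5" for i using that T1 by (intro power_increasing) auto
  have T_le: "T \<le> T ^ 5" using pows[of 1] by simp
  have T5: "1 \<le> T ^ 5" using T1 by simp
  have lift: "a < 2 ^ bits K z" if "a \<le> T" for a using that T_le T5 five by linarith
  show "int (1 + n + m) < 2 ^ bits K z" "Y < 2 ^ bits K z" "int (2 * n + 2) < 2 ^ bits K z"
    by (intro lift nT YT)+
  show "(2 :: int) ^ L < 2 ^ bits K z" using L by (intro lift zT) simp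
  have "2 ^ K \<le> T" by (rule zT) simp
  then have "int K \<le> T" using K_less by linarith
  then show "int K < 2 ^ bits K z" by (rule lift)
  have Z: "S + 3 * int n * Y \<le> T + 3 * T * T" "0 \<le> S + 3 * int n * Y"
    using ST nT(1) YT Y0 T1 S(1) by (auto intro!: add_mono mult_mono)
  have TT: "T * T = T ^ 2" by (simp add: power2_eq_square)
  show "S + 3 * int n * Y < 2 ^ bits K z"
    using Z(1) pows[of 2] T_le T5 five TT by (simp add: mult.assoc)
  have "int n * (S * Y + 4 * S * S * Y) \<le> T * (T * T + 4 * T * T * T)"
    using ST nT(1) YT Y0 T1 S(1) by (intro mult_mono add_mono) auto
  moreover have "int m * (4 * S * S * (S + 3 * int n * Y)) \<le> T * (4 * T * T * (T + 3 * T * T))"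
    using ST nT(2) Z T1 S(1) by (intro mult_mono) auto
  moreover have "T * (T * T + 4 * T * T * T) + T * (4 * T * T * (T + 3 * T * T)) = T ^ 3 + 8 * T ^ 4 + 12 * T ^ 5"
    by (simp add: algebra_simps eval_nat_numeral)
  ultimately show "int n * (S * Y + 4 * S * S * Y) + int m * (4 * S * S * (S + 3 * int n * Y)) < 2 ^ bits K z"
    using pows[of 3] pows[of 4] five by linarith
  have "int ((2 * n + 2) ^ K * (L * L)) < 2 ^ ((z + 1) * K + (6 * z + 18))"
  proof -
    have "(2 :: int) ^ (z + 1) = 2 * 2 ^ z" by simp
    then have "int (2 * n + 2) \<le> 2 ^ (z + 1)" using nm z_less by linarith
    then have "int (2 * n + 2) ^ K \<le> (2 ^ (z + 1)) ^ K" by (intro power_mono) auto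
    moreover have "int L < 2 ^ (3 * z + 9)"
      using L of_nat_less_two_power[of "3 * z + 9", where 'a = int] by linarith
    then have "int L * int L < 2 ^ (3 * z + 9) * 2 ^ (3 * z + 9)" by (intro mult_strict_mono') auto
    ultimately have "int (2 * n + 2) ^ K * (int L * int L) < (2 ^ (z + 1)) ^ K * (2 ^ (3 * z + 9) * 2 ^ (3 * z + 9))"
      by (rule mult_le_less_imp_less) auto
    also have "\<dots> = 2 ^ ((z + 1) * K + (6 * z + 18))"
      unfolding power_mult[symmetric] power_add[symmetric] by (simp add: algebra_simps)
    finally show ?thesis by simp
  qed
  also have "(2 :: int) ^ ((z + 1) * K + (6 * z + 18)) \<le> 2 ^ bits K z"
    by (intro power_increasing) (auto simp: bits_def)
  finally show "int ((2 * n + 2) ^ K * (L * L)) < 2 ^ bits K z" .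
qed

theorem corollary2p2:
  fixes r s :: nat
  assumes "r > 0" and "s > 0"
  shows "\<exists>(prog :: com) (q :: nat poly).
    \<forall>l::nat. l > 0 \<longrightarrow> (\<forall>(c :: nat \<Rightarrow> nat \<Rightarrow> nat \<Rightarrow> int) (u :: nat \<Rightarrow> nat \<Rightarrow> int) (v :: nat \<Rightarrow> nat \<Rightarrow> int) (w :: nat \<Rightarrow> nat \<Rightarrow> int).
      \<exists>res. computes_within prog (encode_input r s l c u v w)
               (poly q (input_size r s l c u v w)) (encode_outcome r s l res) \<and>
            correct_outcome r s l c u v w res)"
proof -
  obtain K where K: "\<And>l d. \<exists>p<r * s * l. d p \<noteq> 0 \<Longrightarrow>
     \<exists>g. (\<exists>p<r * s * l. g p \<noteq> 0) \<and> (\<Sum>p<r * s * l. \<bar>g p\<bar>) \<le> int K \<and> conform r s l g d"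
    using graver_bound_flat[of r s] by blast
  \<comment> \<open>The budget of \<open>runs_Solve\<close> with \<open>z\<close> for the numbers of
    entries and of lines, \<open>1 + z\<close> for the input length and \<open>3 * z + 9\<close> for
    \<open>L\<close>, times the cost of one step.\<close>
  define time where "time z = (16 + 4 * z + 3 * (3 * z + 9) + (2 * z + 2) ^ K * ((3 * z + 9) * (3 * z + 9)) *
      (11 + 5 * K + (3 * z + 9) * (5 + (2 * z + 2) ^ K * (19 + 12 * z + 5 * K + 7 * z)))) *
      (bits K z * weight (Solve r s K))" for z
  have "poly_bounded time"
    unfolding time_def bits_def by (intro poly_bounded_intros poly_bounded_power)
  then obtain q where q: "\<And>z. time z \<le> poly q z" by (auto simp: poly_bounded_def)
  show ?thesis
  proof (intro exI[of _ "Solve r s K"] exI[of _ q] allI impI)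
    fix l c u v w
    assume l: "0 < (l :: nat)"
    define xs where "xs = encode_input r s l c u v w"
    define z where "z = input_size r s l c u v w"
    define S where "S = 2 + (\<Sum>q<length xs. \<bar>xs ! q\<bar>)"
    define L where "L = (LEAST L. 8 * S * S * S < 2 ^ L)"
    have nm: "r * s * l + nlines r s l \<le> z" and S_less: "S < 2 ^ (z + 2)"
      using input_size_bounds[of r s l c u v w] by (simp_all add: z_def S_def xs_def)
    have len: "length xs = 1 + r * s * l + nlines r s l" by (simp add: xs_def length_encode_input)
    have S2: "2 \<le> S" unfolding S_def by (simp add: sum_nonneg)
    \<comment> \<open>\<open>S < 2 ^ (z + 2)\<close> is cubed, and the factor 8 adds three more
      bits.\<close>
    have ex: "8 * S * S * S < 2 ^ (3 * z + 9)"
    proof -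
      have "S ^ 3 < (2 ^ (z + 2)) ^ 3" using S_less S2 by (intro power_strict_mono) auto
      then show ?thesis by (simp add: eval_nat_numeral power_add algebra_simps)
    qed
    have L: "8 * S * S * S < 2 ^ L" unfolding L_def by (rule LeastI[where P = "\<lambda>L. 8 * S * S * S < 2 ^ L", OF ex])
    have L_least: "\<not> 8 * S * S * S < 2 ^ j" if "j < L" for j
      using not_less_Least[of j "\<lambda>L. 8 * S * S * S < 2 ^ L"] that unfolding L_def by blast
    have L_le: "L \<le> 3 * z + 9" unfolding L_def by (rule Least_le) (rule ex)
    note bd = bits_bounds[where n = "r * s * l" and m = "nlines r s l" and K = K, OF _ S_less nm L_le refl]
    obtain res where res: "correct_outcome r s l c u v w res"
      "bounded (bits K z) (init_state xs)" "0 < bits K z"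
      "runs (bits K z) (Solve r s K) (init_state xs)
      (12 + 4 * length xs + 3 * L + (2 * (r * s * l) + 2) ^ K * (L * L) *
        (11 + 5 * K + L * (5 + (2 * (r * s * l) + 2) ^ K * (19 + 12 * (r * s * l) + 5 * K + 7 * nlines r s l))))
      (\<lambda>\<tau>. read_output \<tau> = encode_outcome r s l res)" (is "runs _ _ _ ?k _")
      using runs_Solve[OF l K, where L = L and b' = "bits K z" and ?c0.0 = c and u = u and v = v and w = w,
        folded xs_def, folded S_def, OF _ L L_least] bd S2 len by auto
    then obtain k \<sigma> where k: "nexec (bits K z) (Solve r s K) (init_state xs) k \<sigma>" "k \<le> ?k"
      "read_output \<sigma> = encode_outcome r s l res" by (auto simp: runs_def)
    obtain t where t: "t \<le> k * (bits K z * weight (Solve r s K))" "exec (Solve r s K) (init_state xs) t \<sigma>"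
      using nexec_exec[OF k(1) res(2,3)] by blast
    have "r * s * l \<le> z" "nlines r s l \<le> z" "length xs \<le> 1 + z" using nm len by linarith+
    then have "?k \<le> 12 + 4 * (1 + z) + 3 * (3 * z + 9) + (2 * z + 2) ^ K * ((3 * z + 9) * (3 * z + 9)) *
      (11 + 5 * K + (3 * z + 9) * (5 + (2 * z + 2) ^ K * (19 + 12 * z + 5 * K + 7 * z)))"
      using L_le by (intro add_mono mult_mono power_mono) auto
    then have "t \<le> time z"
      using t(1) k(2) unfolding time_def by (elim order_trans) (intro mult_right_mono, simp_all)
    then have "t \<le> poly q z" using q[of z] by linarith
    then have "computes_within (Solve r s K) xs (poly q z) (encode_outcome r s l res)"
      unfolding computes_within_def using t(2) k(3) by blast
    then show "\<exists>res. computes_within (Solve r s K) (encode_input r s l c u v w)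
               (poly q (input_size r s l c u v w)) (encode_outcome r s l res) \<and>
            correct_outcome r s l c u v w res"
      using res(1) unfolding xs_def z_def by blast
  qed
qed

end
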